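(* Let $H$ be a Hopf algebra with invertible antipode, $(\Omega^1(H),\mathrm{d}_H)$ a bicovariant FODC on $H$ with ${}^{\mathrm{co}H}\Omega^1(H)$ finite-dimensional of dimension $n$, $B$ a $\sigma$-twisted left $H$-module algebra and $(\Omega^1(B),\mathrm{d}_B)$ a $\sigma$-twisted $H$-module FODC on $B$. Let $\{x_j\}_{j=1}^n$ be a basis of $T_\varepsilon H$ and $\{x^j\}_{j=1}^n$ the dual basis of ${}^{\mathrm{co}H}\Omega^1(H)$. For the crossed product calculus $(\Omega^1(B\#_\sigma H),\mathrm{d}_{\#_\sigma})$ there is a bijection between connections and connection $1$-forms. Explicitly, to a connection $c:(B\#_\sigma H)\otimes{}^{\mathrm{co}H}\Omega^1(H)\to\Omega^1(B\#_\sigma H)$ one assigns the connection $1$-form $$\phi_c:=\sum_{j=1}^nx_j\otimes c(1_B\otimes1_H\otimes x^j)\in(T_\varepsilon H\otimes\Omega^1(B\#_\sigma H))^{\mathrm{co}H},$$ while a connection $1$-form $\phi=\sum_{j=1}^nx_j\otimes\phi_j\in(T_\varepsilon H\otimes\Omega^1(B\#_\sigma H))^{\mathrm{co}H}$ corresponds to the connection $$c_\phi:(B\#_\sigma H)\otimes{}^{\mathrm{co}H}\Omega^1(H)\to\Omega^1(B\#_\sigma H),\qquad b\otimes h\otimes\gamma\mapsto\sum_{j=1}^nx_j(\gamma)\,((b\otimes h)\cdot\phi_j).$$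
   Context: Everything is over a field $\Bbbk$; algebras are associative and unital. Sweedler notation: $\Delta(h)=h_1\otimes h_2$; right coactions $m\mapsto m_0\otimes m_1$; left coactions $m\mapsto m_{-1}\otimes m_0$, with $m_{-2}\otimes m_{-1}\otimes m_0$ the iterated left coaction. $B$ is a $\sigma$-twisted left $H$-module algebra: there are a linear map $\cdot:H\otimes B\to B$ (a measure) with $h\cdot 1_B=\varepsilon(h)1_B$, $h\cdot(bb')=(h_1\cdot b)(h_2\cdot b')$, and a convolution invertible linear map $\sigma:H\otimes H\to B$ with convolution inverse $\sigma^{-1}$, such that $1_H\cdot b=b$, $h\cdot(h'\cdot b)=\sigma(h_1\otimes h'_1)(h_2h'_2\cdot b)\sigma^{-1}(h_3\otimes h'_3)$, $\sigma(h\otimes1_H)=\varepsilon(h)1_B=\sigma(1_H\otimes h)$ and $(h_1\cdot\sigma(h'_1\otimes h''_1))\sigma(h_2\otimes h'_2h''_2)=\sigma(h_1\otimes h'_1)\sigma(h_2h'_2\otimes h'')$. The crossed product algebra $B\#_\sigma H$ is $B\otimes H$ with unit $1_B\otimes1_H$ and product $(b\otimes h)(b'\otimes h')=b(h_1\cdot b')\sigma(h_2\otimes h'_1)\otimes h_3h'_2$; it is a right $H$-comodule algebra via $\mathrm{Id}_B\otimes\Delta$. A FODC on an algebra $A$ is a pair $(\Omega^1(A),\mathrm{d}_A)$ with $\Omega^1(A)$ an $A$-bimodule, $\mathrm{d}_A:A\to\Omega^1(A)$ linear satisfying the Leibniz rule, and $\Omega^1(A)=\mathrm{span}_\Bbbk\{a\,\mathrm{d}_Ab\}$.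 A FODC on $H$ is bicovariant if $\Omega^1(H)$ is an $H$-bicomodule with coactions compatible with the $H$-bimodule structure and $\mathrm{d}_H$ is left and right $H$-colinear; ${}^{\mathrm{co}H}\Omega^1(H)=\{\gamma:\gamma_{-1}\otimes\gamma_0=1_H\otimes\gamma\}$. $(\Omega^1(B),\mathrm{d}_B)$ is a $\sigma$-twisted $H$-module FODC if there is a linear map $\cdot:H\otimes\Omega^1(B)\to\Omega^1(B)$ with $h\cdot(b\,\mathrm{d}_Bb')=(h_1\cdot b)(h_2\cdot\mathrm{d}_Bb')$, $\mathrm{d}_B(h\cdot b)=h\cdot\mathrm{d}_Bb$ and $\mathrm{d}_B\circ\sigma=0$. The crossed product calculus is the right $H$-covariant FODC $\Omega^1(B\#_\sigma H)=(\Omega^1(B)\otimes H)\oplus(B\otimes\Omega^1(H))$, $\mathrm{d}_{\#_\sigma}(b\otimes h)=\mathrm{d}_Bb\otimes h+b\otimes\mathrm{d}_Hh$, with actions $(b'\otimes h')\cdot(\beta\otimes h+b\otimes\gamma)=b'(h'_1\cdot\beta)\sigma(h'_2\otimes h_1)\otimes h'_3h_2+b'(h'_1\cdot b)\sigma(h'_2\otimes\gamma_{-1})\otimes h'_3\gamma_0$, $(\beta\otimes h+b\otimes\gamma)\cdot(b'\otimes h')=\beta(h_1\cdot b')\sigma(h_2\otimes h'_1)\otimes h_3h'_2+b(\gamma_{-2}\cdot b')\sigma(\gamma_{-1}\otimes h'_1)\otimes\gamma_0h'_2$, and right coaction $\beta\otimes h+b\otimes\gamma\mapsto\beta\otimes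 h_1\otimes h_2+b\otimes\gamma_0\otimes\gamma_1$. The vertical map is $\mathrm{ver}:\Omega^1(B\#_\sigma H)\to(B\#_\sigma H)\otimes{}^{\mathrm{co}H}\Omega^1(H)$, $a\,\mathrm{d}_{\#_\sigma}a'\mapsto aa'_0\otimes S(a'_1)\mathrm{d}_Ha'_2$; explicitly $\mathrm{ver}(\beta\otimes h+b\otimes\gamma)=b\otimes\gamma_{-2}\otimes S(\gamma_{-1})\gamma_0$. A connection is a left $B\#_\sigma H$-linear (action on the first factor), right $H$-colinear (diagonal coaction on the source) map $c:(B\#_\sigma H)\otimes{}^{\mathrm{co}H}\Omega^1(H)\to\Omega^1(B\#_\sigma H)$ with $\mathrm{ver}\circ c=\mathrm{Id}$. The quantum tangent space is $T_\varepsilon H=\mathrm{Hom}_\Bbbk({}^{\mathrm{co}H}\Omega^1(H),\Bbbk)$, a right $H$-comodule via $\alpha\mapsto\alpha_0\otimes\alpha_1$ with $\alpha_0(\gamma)\alpha_1=\alpha(\gamma_0)S^{-1}(\gamma_1)$. For $\alpha\in T_\varepsilon H$ the fundamental vector field is $\overline\alpha=(\mathrm{Id}\otimes\alpha)\circ\mathrm{ver}:\Omega^1(B\#_\sigma H)\to B\#_\sigma H$. A connection $1$-form is an element $\phi=\sum_jx_j\otimes\phi_j\in(T_\varepsilon H\otimes\Omega^1(B\#_\sigma H))^{\mathrm{co}H}$ (coinvariants for the diagonal right coaction) such that $\sum_jx_j\otimes\overline\alpha(\phi_j)=\alpha\otimes1_B\otimes1_H$ for all $\alpha\in T_\varepsilon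 H$. *)

theory Defs
  imports HOL.Vector_Spaces "HOL-Library.Function_Algebras" "HOL-Library.Product_Plus" "HOL-Library.FuncSet"
begin

section \<open>Vector spaces and linear maps\<close>

text \<open>
  A vector space is a subspace \<open>car V\<close> of an ambient vector space that fills a whole type and has
  scalar multiplication \<open>scl V\<close>; the addition is that of the type class.
\<close>

record ('k, 'a) vs =
  scl :: "'k \<Rightarrow> 'a \<Rightarrow> 'a"
  car :: "'a set"

definition is_vs :: "('k::field, 'a::ab_group_add) vs \<Rightarrow> bool" where
  "is_vs V \<longleftrightarrow> vector_space (scl V) \<and> module.subspace (scl V) (car V)"

definition full :: "('k \<Rightarrow> 'a \<Rightarrow> 'a) \<Rightarrow> ('k, 'a) vs" where
  "full s = \<lparr>scl = s, car = UNIV\<rparr>"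

definition ground :: "('k::field, 'k) vs" where
  "ground = full (*)"

definition linear_map ::
  "('k::field, 'a::ab_group_add) vs \<Rightarrow> ('k, 'b::ab_group_add) vs \<Rightarrow> ('a \<Rightarrow> 'b) \<Rightarrow> bool" where
  "linear_map V W f \<longleftrightarrow>
     (\<forall>v\<in>car V. f v \<in> car W) \<and>
     (\<forall>v\<in>car V. \<forall>v'\<in>car V. f (v + v') = f v + f v') \<and>
     (\<forall>c. \<forall>v\<in>car V. f (scl V c v) = scl W c (f v))"

definition bilinear_map ::
  "('k::field, 'a::ab_group_add) vs \<Rightarrow> ('k, 'b::ab_group_add) vs \<Rightarrow> ('k, 'c::ab_group_add) vs \<Rightarrow>
   ('a \<Rightarrow> 'b \<Rightarrow> 'c) \<Rightarrow> bool" where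
  "bilinear_map V W X f \<longleftrightarrow>
     (\<forall>v\<in>car V. linear_map W X (f v)) \<and> (\<forall>w\<in>car W. linear_map V X (\<lambda>v. f v w))"

definition indexed_basis :: "('k::field, 'a::ab_group_add) vs \<Rightarrow> nat \<Rightarrow> (nat \<Rightarrow> 'a) \<Rightarrow> bool" where
  "indexed_basis V n e \<longleftrightarrow>
     inj_on e {1..n} \<and> \<not> module.dependent (scl V) (e ` {1..n}) \<and>
     module.span (scl V) (e ` {1..n}) = car V"

definition dsum :: "('k, 'a) vs \<Rightarrow> ('k, 'b) vs \<Rightarrow> ('k, 'a \<times> 'b) vs" where
  "dsum V W = \<lparr>scl = (\<lambda>c p. (scl V c (fst p), scl W c (snd p))), car = car V \<times> car W\<rparr>"


section \<open>Tensor products\<close>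

text \<open>
  \<open>V \<otimes> W\<close> is realised inside the dual of the space of bilinear forms on the ambient spaces:
  \<open>v \<otimes> w\<close> is evaluation at \<open>(v, w)\<close>. Theorems \<open>tlift_universal\<close> and \<open>tlift_unique\<close> below give the
  universal property, with respect to bilinear maps on \<open>car V \<times> car W\<close>. As \<open>tens V W\<close> depends only
  on the two scalar multiplications, \<open>V' \<otimes> W'\<close> is literally a subspace of \<open>V \<otimes> W\<close>
  for subspaces \<open>V'\<close> of \<open>V\<close> and \<open>W'\<close> of \<open>W\<close>.
\<close>

typedef ('k, 'a, 'b) tensor = "UNIV :: (('a \<Rightarrow> 'b \<Rightarrow> 'k) \<Rightarrow> 'k) set"
  morphisms teval Tensor
  by simp

instantiation tensor :: (ab_group_add, type, type) ab_group_add
begin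

definition "0 = Tensor (\<lambda>\<beta>. 0)"
definition "s + t = Tensor (\<lambda>\<beta>. teval s \<beta> + teval t \<beta>)"
definition "s - t = Tensor (\<lambda>\<beta>. teval s \<beta> - teval t \<beta>)"
definition "- t = Tensor (\<lambda>\<beta>. - teval t \<beta>)"

instance
  by standard
    (simp_all add: zero_tensor_def plus_tensor_def minus_tensor_def uminus_tensor_def
      Tensor_inverse teval_inverse ac_simps)

end

definition tscale :: "'k::field \<Rightarrow> ('k, 'a, 'b) tensor \<Rightarrow> ('k, 'a, 'b) tensor" where
  "tscale c t = Tensor (\<lambda>\<beta>. c * teval t \<beta>)"

definition tens ::
  "('k::field, 'a::ab_group_add) vs \<Rightarrow> ('k, 'b::ab_group_add) vs \<Rightarrow> 'a \<Rightarrow> 'b \<Rightarrow> ('k, 'a, 'b) tensor" where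
  "tens V W v w =
     Tensor (\<lambda>\<beta>. if bilinear_map (full (scl V)) (full (scl W)) ground \<beta> then \<beta> v w else 0)"

definition tprod ::
  "('k::field, 'a::ab_group_add) vs \<Rightarrow> ('k, 'b::ab_group_add) vs \<Rightarrow> ('k, ('k, 'a, 'b) tensor) vs"
  (infixl "\<otimes>" 70) where
  "V \<otimes> W = \<lparr>scl = tscale, car = module.span tscale {tens V W v w | v w. v \<in> car V \<and> w \<in> car W}\<rparr>"

text \<open>
  \<open>tlift V W f\<close> is the linear map on \<open>V \<otimes> W\<close> induced by a map \<open>f\<close> that is bilinear on
  \<open>car V \<times> car W\<close>. Every Sweedler sum below is written with it: for \<open>t = t\<^sub>1 \<otimes> t\<^sub>2\<close> in \<open>V \<otimes> W\<close>,
  \<open>tlift V W (\<lambda>t\<^sub>1 t\<^sub>2. E) t\<close> is the element written \<open>E\<close> in Sweedler notation.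
\<close>

definition tlift ::
  "('k::field, 'a::ab_group_add) vs \<Rightarrow> ('k, 'b::ab_group_add) vs \<Rightarrow>
   ('a \<Rightarrow> 'b \<Rightarrow> 'c::ab_group_add) \<Rightarrow> ('k, 'a, 'b) tensor \<Rightarrow> 'c" where
  "tlift V W f t =
     (\<Sum>(v, w) \<leftarrow> (SOME ps. set ps \<subseteq> car V \<times> car W \<and> t = (\<Sum>(v, w) \<leftarrow> ps. tens V W v w)). f v w)"

lemma teval_simps [simp]:
  "teval 0 \<beta> = 0" "teval (s + t) \<beta> = teval s \<beta> + teval t \<beta>" "teval (tscale c s) \<beta> = c * teval s \<beta>"
  by (simp_all add: zero_tensor_def plus_tensor_def tscale_def Tensor_inverse)

lemma tensor_eqI: "(\<And>\<beta>. teval s \<beta> = teval t \<beta>) \<Longrightarrow> s = t"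
  by (simp add: teval_inject[symmetric] fun_eq_iff)

lemma teval_tens:
  "teval (tens V W v w) \<beta> =
     (if bilinear_map (full (scl V)) (full (scl W)) ground \<beta> then \<beta> v w else 0)"
  by (simp add: tens_def Tensor_inverse)

lemma vector_space_tscale: "vector_space (tscale :: 'k::field \<Rightarrow> ('k, 'a, 'b) tensor \<Rightarrow> _)"
  by unfold_locales (auto intro!: tensor_eqI simp: algebra_simps)

interpretation tensor: vector_space "tscale :: 'k::field \<Rightarrow> ('k, 'a, 'b) tensor \<Rightarrow> ('k, 'a, 'b) tensor"
  by (rule vector_space_tscale)

lemma is_vs_tprod: "is_vs (V \<otimes> W)"
  by (simp add: is_vs_def tprod_def vector_space_tscale)

lemma bilinear_tens:
  assumes "is_vs V" "is_vs W"
  shows "bilinear_map V W (V \<otimes> W) (tens V W)"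
proof -
  have "tens V W v w \<in> car (V \<otimes> W)" if "v \<in> car V" "w \<in> car W" for v w
    using that by (auto simp: tprod_def intro!: tensor.span_base)
  moreover have "tens V W (v + v') w = tens V W v w + tens V W v' w"
    and "tens V W v (w + w') = tens V W v w + tens V W v w'"
    and "tens V W (scl V c v) w = tscale c (tens V W v w)"
    and "tens V W v (scl W c w) = tscale c (tens V W v w)" for c v v' w w'
    by (rule tensor_eqI,
        simp add: teval_tens bilinear_map_def linear_map_def full_def ground_def)+
  ultimately show ?thesis
    unfolding bilinear_map_def linear_map_def by (simp add: tprod_def)
qed

lemma tprod_sum_list:
  assumes "is_vs V" "t \<in> car (V \<otimes> W)"
  shows "\<exists>ps. set ps \<subseteq> car V \<times> car W \<and> t = (\<Sum>(v, w) \<leftarrow> ps. tens V W v w)"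
proof -
  interpret V: vector_space "scl V" using assms by (simp add: is_vs_def)
  let ?G = "{tens V W v w | v w. v \<in> car V \<and> w \<in> car W}"
  have "t \<in> tensor.span ?G" using assms by (simp add: tprod_def)
  then show ?thesis
  proof (induction rule: tensor.span_induct_alt)
    case base
    show ?case by (rule exI[of _ "[]"]) simp
  next
    case (step c x y)
    then obtain v w ps where *: "v \<in> car V" "w \<in> car W" "x = tens V W v w"
      "set ps \<subseteq> car V \<times> car W" "y = (\<Sum>(v, w) \<leftarrow> ps. tens V W v w)" by blast
    have "scl V c v \<in> car V" using assms * by (simp add: is_vs_def V.subspace_def)
    moreover have "tscale c x = tens V W (scl V c v) w"
      by (rule tensor_eqI)
        (simp add: * teval_tens bilinear_map_def linear_map_def full_def ground_def)
    ultimately show ?case using * by (intro exI[of _ "(scl V c v, w) # ps"]) auto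
  qed
qed

lemma subspace_projection:
  assumes "is_vs (V :: ('k::field, 'a::ab_group_add) vs)"
  obtains p where "linear_map (full (scl V)) V p" "\<And>v. v \<in> car V \<Longrightarrow> p v = v"
proof -
  interpret V: vector_space "scl V" using assms by (simp add: is_vs_def)
  interpret VV: vector_space_pair "scl V" "scl V" ..
  have sub: "V.subspace (car V)" using assms by (simp add: is_vs_def)
  obtain g where g: "range g \<subseteq> car V" "Vector_Spaces.linear (scl V) (scl V) g"
      "\<forall>v\<in>car V. g (id v) = v"
    using VV.linear_exists_left_inverse_on[OF V.linear_id sub] by auto
  interpret g: Vector_Spaces.linear "scl V" "scl V" g by fact
  show ?thesis
    by (rule that[of g]) (use g in \<open>auto simp: linear_map_def full_def g.add g.scale\<close>)
qed

lemma bilinear_sum_list_eq: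
  fixes V :: "('k::field, 'a::ab_group_add) vs" and W :: "('k, 'b::ab_group_add) vs"
    and X :: "('k, 'c::ab_group_add) vs"
  assumes vs: "is_vs V" "is_vs W" "is_vs X" and f: "bilinear_map V W X f"
    and ps: "set ps \<subseteq> car V \<times> car W" and qs: "set qs \<subseteq> car V \<times> car W"
    and eq: "(\<Sum>(v, w) \<leftarrow> ps. tens V W v w) = (\<Sum>(v, w) \<leftarrow> qs. tens V W v w)"
  shows "(\<Sum>(v, w) \<leftarrow> ps. f v w) = (\<Sum>(v, w) \<leftarrow> qs. f v w)"
proof (rule ccontr)
  define y where "y = (\<Sum>(v, w) \<leftarrow> ps. f v w) - (\<Sum>(v, w) \<leftarrow> qs. f v w)"
  assume "\<not> ?thesis"
  then have y: "y \<noteq> 0" by (simp add: y_def)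
  interpret X: vector_space "scl X" using vs by (simp add: is_vs_def)
  interpret K: vector_space "(*) :: 'k \<Rightarrow> 'k \<Rightarrow> 'k" by unfold_locales (auto simp: algebra_simps)
  interpret XK: vector_space_pair "scl X" "(*) :: 'k \<Rightarrow> 'k \<Rightarrow> 'k" ..
  obtain l where l: "Vector_Spaces.linear (scl X) (*) l" "l y = (1 :: 'k)"
    using XK.linear_independent_extend[of "{y}" "\<lambda>_. 1"] y by auto
  interpret l: Vector_Spaces.linear "scl X" "(*)" l by fact
  obtain p where p: "linear_map (full (scl V)) V p" "\<And>v. v \<in> car V \<Longrightarrow> p v = v"
    using subspace_projection[OF vs(1)] by blast
  obtain q where q: "linear_map (full (scl W)) W q" "\<And>w. w \<in> car W \<Longrightarrow> q w = w"
    using subspace_projection[OF vs(2)] by blast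
  define \<beta> where "\<beta> = (\<lambda>v w. l (f (p v) (q w)))"
  have \<beta>: "bilinear_map (full (scl V)) (full (scl W)) ground \<beta>"
    using f p(1) q(1)
    by (auto simp: bilinear_map_def linear_map_def full_def ground_def \<beta>_def l.add l.scale)
  have ev: "teval (\<Sum>(v, w) \<leftarrow> rs. tens V W v w) \<beta> = l (\<Sum>(v, w) \<leftarrow> rs. f v w)"
    if "set rs \<subseteq> car V \<times> car W" for rs
    using that by (induction rs) (auto simp: teval_tens \<beta> p q l.add l.zero, auto simp: \<beta>_def p q)
  have "l y = 0"
    unfolding y_def using ev[OF ps] ev[OF qs] eq by (simp add: l.diff)
  with l show False by simp
qed

lemma tlift_sum_list:
  assumes "is_vs V" "is_vs W" "is_vs X" "bilinear_map V W X f" "set ps \<subseteq> car V \<times> car W"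
  shows "tlift V W f (\<Sum>(v, w) \<leftarrow> ps. tens V W v w) = (\<Sum>(v, w) \<leftarrow> ps. f v w)"
proof -
  let ?P = "\<lambda>qs. set qs \<subseteq> car V \<times> car W \<and>
    (\<Sum>(v, w) \<leftarrow> ps. tens V W v w) = (\<Sum>(v, w) \<leftarrow> qs. tens V W v w)"
  define qs where "qs = (SOME qs. ?P qs)"
  have "?P qs" unfolding qs_def by (rule someI[of ?P ps]) (use assms in simp)
  then have "(\<Sum>(v, w) \<leftarrow> ps. f v w) = (\<Sum>(v, w) \<leftarrow> qs. f v w)"
    using bilinear_sum_list_eq[OF assms(1-5), of qs] by blast
  moreover have "tlift V W f (\<Sum>(v, w) \<leftarrow> ps. tens V W v w) = (\<Sum>(v, w) \<leftarrow> qs. f v w)"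
    unfolding tlift_def qs_def ..
  ultimately show ?thesis by simp
qed

theorem tlift_universal:
  assumes "is_vs V" "is_vs W" "is_vs X" "bilinear_map V W X f"
  shows "linear_map (V \<otimes> W) X (tlift V W f)"
    and "\<lbrakk>v \<in> car V; w \<in> car W\<rbrakk> \<Longrightarrow> tlift V W f (tens V W v w) = f v w"
proof -
  note L = tlift_sum_list[OF assms]
  interpret V: vector_space "scl V" using assms by (simp add: is_vs_def)
  interpret X: vector_space "scl X" using assms by (simp add: is_vs_def)
  have X: "X.subspace (car X)" and V: "V.subspace (car V)" using assms by (auto simp: is_vs_def)
  have in_X: "(\<Sum>(v, w) \<leftarrow> ps. f v w) \<in> car X" if "set ps \<subseteq> car V \<times> car W" for ps
    using that assms(4)
    by (induction ps)
      (auto simp: X.subspace_0[OF X] bilinear_map_def linear_map_def intro!: X.subspace_add[OF X])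
  have add: "tlift V W f (s + t) = tlift V W f s + tlift V W f t"
    if s: "s \<in> car (V \<otimes> W)" and t: "t \<in> car (V \<otimes> W)" for s t
  proof -
    obtain ps qs where ps: "set ps \<subseteq> car V \<times> car W" "s = (\<Sum>(v, w) \<leftarrow> ps. tens V W v w)"
      and qs: "set qs \<subseteq> car V \<times> car W" "t = (\<Sum>(v, w) \<leftarrow> qs. tens V W v w)"
      using tprod_sum_list[OF assms(1)] s t by metis
    have "s + t = (\<Sum>(v, w) \<leftarrow> ps @ qs. tens V W v w)" by (simp add: ps qs)
    then show ?thesis using L[of ps] L[of qs] L[of "ps @ qs"] ps qs by simp
  qed
  have scale: "tlift V W f (tscale c s) = scl X c (tlift V W f s)"
    if s: "s \<in> car (V \<otimes> W)" for c s
  proof -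
    obtain ps where ps: "set ps \<subseteq> car V \<times> car W" "s = (\<Sum>(v, w) \<leftarrow> ps. tens V W v w)"
      using tprod_sum_list[OF assms(1) s] by blast
    let ?qs = "map (\<lambda>(v, w). (scl V c v, w)) ps"
    have "tscale c s = (\<Sum>(v, w) \<leftarrow> ?qs. tens V W v w)"
      unfolding ps(2)
      by (induction ps) (auto simp: tensor.scale_right_distrib teval_tens bilinear_map_def
          linear_map_def full_def ground_def intro!: tensor_eqI)
    moreover have qs: "set ?qs \<subseteq> car V \<times> car W" using ps(1) V.subspace_scale[OF V] by fastforce
    moreover have "(\<Sum>(v, w) \<leftarrow> ?qs. f v w) = scl X c (\<Sum>(v, w) \<leftarrow> ps. f v w)"
      using ps(1) assms(4)
      by (induction ps) (auto simp: X.scale_right_distrib bilinear_map_def linear_map_def)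
    ultimately show ?thesis using L[OF qs] L[OF ps(1)] ps(2) by simp
  qed
  have "tlift V W f s \<in> car X" if s: "s \<in> car (V \<otimes> W)" for s
    using tprod_sum_list[OF assms(1) s] L in_X by metis
  then show "linear_map (V \<otimes> W) X (tlift V W f)"
    unfolding linear_map_def using add scale by (simp add: tprod_def)
  show "tlift V W f (tens V W v w) = f v w" if "v \<in> car V" "w \<in> car W"
    using L[of "[(v, w)]"] that by simp
qed

theorem tlift_unique:
  assumes "is_vs V" "is_vs W" "is_vs X" "bilinear_map V W X f" "linear_map (V \<otimes> W) X g"
    and "\<And>v w. \<lbrakk>v \<in> car V; w \<in> car W\<rbrakk> \<Longrightarrow> g (tens V W v w) = f v w"
    and "t \<in> car (V \<otimes> W)"
  shows "g t = tlift V W f t"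
proof -
  interpret X: vector_space "scl X" using assms by (simp add: is_vs_def)
  obtain ps where ps: "set ps \<subseteq> car V \<times> car W" "t = (\<Sum>(v, w) \<leftarrow> ps. tens V W v w)"
    using tprod_sum_list[OF assms(1,7)] by blast
  have mem1: "tens V W v w \<in> car (V \<otimes> W)" if "v \<in> car V" "w \<in> car W" for v w
    using that by (auto simp: tprod_def intro!: tensor.span_base)
  have add_mem: "a + b \<in> car (V \<otimes> W)" if "a \<in> car (V \<otimes> W)" "b \<in> car (V \<otimes> W)" for a b
    using that by (simp add: tprod_def tensor.span_add)
  have mem: "(\<Sum>(v, w) \<leftarrow> qs. tens V W v w) \<in> car (V \<otimes> W)" if "set qs \<subseteq> car V \<times> car W" for qs
    using that
  proof (induction qs)
    case Nil
    show ?case by (simp add: tprod_def tensor.span_zero)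
  next
    case (Cons q qs)
    then show ?case using mem1 add_mem by (cases q) auto
  qed
  have "0 \<in> car (V \<otimes> W)" by (simp add: tprod_def tensor.span_zero)
  then have "g (0 + 0) = g 0 + g 0"
    using assms(5) unfolding linear_map_def by blast
  then have g0: "g 0 = 0" by simp
  have "g (\<Sum>(v, w) \<leftarrow> ps. tens V W v w) = (\<Sum>(v, w) \<leftarrow> ps. f v w)" 
    using ps(1)
  proof (induction ps)
    case (Cons p ps)
    obtain v w where p: "p = (v, w)" "v \<in> car V" "w \<in> car W" using Cons.prems by (cases p) auto
    have "g (tens V W v w + (\<Sum>(v, w) \<leftarrow> ps. tens V W v w)) =
        g (tens V W v w) + g (\<Sum>(v, w) \<leftarrow> ps. tens V W v w)"
      using assms(5) mem[of ps] mem1[OF p(2,3)] Cons.prems unfolding linear_map_def by simp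
    then show ?case using Cons assms(6) p by simp
  qed (simp add: g0)
  then show ?thesis using tlift_sum_list[OF assms(1-4) ps(1)] ps(2) by simp
qed


section \<open>Algebras and first order differential calculi\<close>

definition k_algebra :: "('k::field \<Rightarrow> 'a \<Rightarrow> 'a::{ring, monoid_mult}) \<Rightarrow> bool" where
  "k_algebra s \<longleftrightarrow>
     vector_space s \<and> (\<forall>c a b. s c (a * b) = s c a * b) \<and> (\<forall>c a b. s c (a * b) = a * s c b)"

record ('k, 'a, 'w) fodc =
  fscale :: "'k \<Rightarrow> 'w \<Rightarrow> 'w"
  lact :: "'a \<Rightarrow> 'w \<Rightarrow> 'w"
  ract :: "'w \<Rightarrow> 'a \<Rightarrow> 'w"
  diff :: "'a \<Rightarrow> 'w"

abbreviation forms :: "('k, 'a, 'w, 'm) fodc_scheme \<Rightarrow> ('k, 'w) vs" where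
  "forms F \<equiv> full (fscale F)"

definition is_fodc ::
  "('k::field \<Rightarrow> 'a \<Rightarrow> 'a::{ring, monoid_mult}) \<Rightarrow> ('k, 'a, 'w::ab_group_add, 'm) fodc_scheme \<Rightarrow> bool" where
  "is_fodc s F \<longleftrightarrow>
     k_algebra s \<and> vector_space (fscale F) \<and>
     bilinear_map (full s) (forms F) (forms F) (lact F) \<and>
     bilinear_map (forms F) (full s) (forms F) (ract F) \<and>
     (\<forall>\<omega>. lact F 1 \<omega> = \<omega> \<and> ract F \<omega> 1 = \<omega>) \<and>
     (\<forall>a b \<omega>. lact F (a * b) \<omega> = lact F a (lact F b \<omega>)) \<and>
     (\<forall>a b \<omega>. ract F \<omega> (a * b) = ract F (ract F \<omega> a) b) \<and>
     (\<forall>a b \<omega>. ract F (lact F a \<omega>) b = lact F a (ract F \<omega> b)) \<and>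
     linear_map (full s) (forms F) (diff F) \<and>
     (\<forall>a b. diff F (a * b) = ract F (diff F a) b + lact F a (diff F b)) \<and>
     module.span (fscale F) {lact F a (diff F b) | a b. True} = UNIV"


section \<open>Hopf algebras\<close>

record ('k, 'h) hopf =
  hscale :: "'k \<Rightarrow> 'h \<Rightarrow> 'h"
  comult :: "'h \<Rightarrow> ('k, 'h, 'h) tensor"
  counit :: "'h \<Rightarrow> 'k"
  antipode :: "'h \<Rightarrow> 'h"

abbreviation hspace :: "('k, 'h) hopf \<Rightarrow> ('k, 'h) vs" where
  "hspace H \<equiv> full (hscale H)"

definition sw2 ::
  "('k::field, 'h::ab_group_add) hopf \<Rightarrow> 'h \<Rightarrow> ('h \<Rightarrow> 'h \<Rightarrow> 'c::ab_group_add) \<Rightarrow> 'c" where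
  "sw2 H h f = tlift (hspace H) (hspace H) f (comult H h)"

definition sw3 ::
  "('k::field, 'h::ab_group_add) hopf \<Rightarrow> 'h \<Rightarrow> ('h \<Rightarrow> 'h \<Rightarrow> 'h \<Rightarrow> 'c::ab_group_add) \<Rightarrow> 'c" where
  "sw3 H h f = sw2 H h (\<lambda>h1 h'. sw2 H h' (\<lambda>h2 h3. f h1 h2 h3))"

definition hopf_algebra :: "('k::field, 'h::{ring, monoid_mult}) hopf \<Rightarrow> bool" where
  "hopf_algebra H \<longleftrightarrow>
     (let V = hspace H; t = tens V V; t3 = (\<lambda>a b c. tens (V \<otimes> V) V (t a b) c) in
      k_algebra (hscale H) \<and>
      linear_map V (V \<otimes> V) (comult H) \<and>
      linear_map V ground (counit H) \<and>
      linear_map V V (antipode H) \<and>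
      (\<forall>h. sw2 H h (\<lambda>a h3. sw2 H a (\<lambda>h1 h2. t3 h1 h2 h3)) =
           sw2 H h (\<lambda>h1 b. sw2 H b (\<lambda>h2 h3. t3 h1 h2 h3))) \<and>
      (\<forall>h. sw2 H h (\<lambda>h1 h2. hscale H (counit H h1) h2) = h \<and>
           sw2 H h (\<lambda>h1 h2. hscale H (counit H h2) h1) = h) \<and>
      comult H 1 = t 1 1 \<and>
      (\<forall>h h'. comult H (h * h') =
         sw2 H h (\<lambda>h1 h2. sw2 H h' (\<lambda>h1' h2'. t (h1 * h1') (h2 * h2')))) \<and>
      counit H 1 = 1 \<and>
      (\<forall>h h'. counit H (h * h') = counit H h * counit H h') \<and>
      (\<forall>h. sw2 H h (\<lambda>h1 h2. antipode H h1 * h2) = hscale H (counit H h) 1 \<and>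
           sw2 H h (\<lambda>h1 h2. h1 * antipode H h2) = hscale H (counit H h) 1))"

definition right_comodule ::
  "('k::field, 'h::ab_group_add) hopf \<Rightarrow> ('k, 'w::ab_group_add) vs \<Rightarrow>
   ('w \<Rightarrow> ('k, 'w, 'h) tensor) \<Rightarrow> bool" where
  "right_comodule H M \<rho> \<longleftrightarrow>
     (let V = hspace H; t3 = (\<lambda>m a b. tens (M \<otimes> V) V (tens M V m a) b) in
      linear_map M (M \<otimes> V) \<rho> \<and>
      (\<forall>m\<in>car M. tlift M V (\<lambda>m' h2. tlift M V (\<lambda>m0 h1. t3 m0 h1 h2) (\<rho> m')) (\<rho> m) =
                  tlift M V (\<lambda>m0 h. sw2 H h (\<lambda>h1 h2. t3 m0 h1 h2)) (\<rho> m)) \<and>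
      (\<forall>m\<in>car M. tlift M V (\<lambda>m0 h. scl M (counit H h) m0) (\<rho> m) = m))"

definition left_comodule ::
  "('k::field, 'h::ab_group_add) hopf \<Rightarrow> ('k, 'w::ab_group_add) vs \<Rightarrow>
   ('w \<Rightarrow> ('k, 'h, 'w) tensor) \<Rightarrow> bool" where
  "left_comodule H M \<delta> \<longleftrightarrow>
     (let V = hspace H; t3 = (\<lambda>a b m. tens (V \<otimes> V) M (tens V V a b) m) in
      linear_map M (V \<otimes> M) \<delta> \<and>
      (\<forall>m\<in>car M. tlift V M (\<lambda>h1 m'. tlift V M (\<lambda>h2 m0. t3 h1 h2 m0) (\<delta> m')) (\<delta> m) =
                  tlift V M (\<lambda>h m0. sw2 H h (\<lambda>h1 h2. t3 h1 h2 m0)) (\<delta> m)) \<and>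
      (\<forall>m\<in>car M. tlift V M (\<lambda>h m0. scl M (counit H h) m0) (\<delta> m) = m))"


section \<open>Bicovariant calculi\<close>

record ('k, 'h, 'w) bicov_fodc = "('k, 'h, 'w) fodc" +
  lcoact :: "'w \<Rightarrow> ('k, 'h, 'w) tensor"
  rcoact :: "'w \<Rightarrow> ('k, 'w, 'h) tensor"

definition bicovariant_fodc ::
  "('k::field, 'h::{ring, monoid_mult}) hopf \<Rightarrow> ('k, 'h, 'w::ab_group_add) bicov_fodc \<Rightarrow> bool" where
  "bicovariant_fodc H L \<longleftrightarrow>
     (let V = hspace H; M = forms L;
          t3 = (\<lambda>a m b. tens (V \<otimes> M) V (tens V M a m) b) in
      is_fodc (hscale H) L \<and>
      left_comodule H M (lcoact L) \<and> right_comodule H M (rcoact L) \<and>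
      (\<forall>\<omega>. tlift M V (\<lambda>\<omega>' b. tlift V M (\<lambda>a \<omega>0. t3 a \<omega>0 b) (lcoact L \<omega>')) (rcoact L \<omega>) =
           tlift V M (\<lambda>a \<omega>'. tlift M V (\<lambda>\<omega>0 b. t3 a \<omega>0 b) (rcoact L \<omega>')) (lcoact L \<omega>)) \<and>
      (\<forall>h \<omega>. lcoact L (lact L h \<omega>) =
         sw2 H h (\<lambda>h1 h2. tlift V M (\<lambda>a \<omega>0. tens V M (h1 * a) (lact L h2 \<omega>0)) (lcoact L \<omega>))) \<and>
      (\<forall>h \<omega>. lcoact L (ract L \<omega> h) =
         sw2 H h (\<lambda>h1 h2. tlift V M (\<lambda>a \<omega>0. tens V M (a * h1) (ract L \<omega>0 h2)) (lcoact L \<omega>))) \<and>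
      (\<forall>h \<omega>. rcoact L (lact L h \<omega>) =
         sw2 H h (\<lambda>h1 h2. tlift M V (\<lambda>\<omega>0 a. tens M V (lact L h1 \<omega>0) (h2 * a)) (rcoact L \<omega>))) \<and>
      (\<forall>h \<omega>. rcoact L (ract L \<omega> h) =
         sw2 H h (\<lambda>h1 h2. tlift M V (\<lambda>\<omega>0 a. tens M V (ract L \<omega>0 h1) (a * h2)) (rcoact L \<omega>))) \<and>
      (\<forall>h. lcoact L (diff L h) = sw2 H h (\<lambda>h1 h2. tens V M h1 (diff L h2))) \<and>
      (\<forall>h. rcoact L (diff L h) = sw2 H h (\<lambda>h1 h2. tens M V (diff L h1) h2)))"

definition coinv_forms ::
  "('k::field, 'h::{ring, monoid_mult}) hopf \<Rightarrow> ('k, 'h, 'w::ab_group_add) bicov_fodc \<Rightarrow> ('k, 'w) vs" where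
  "coinv_forms H L =
     \<lparr>scl = fscale L, car = {\<gamma>. lcoact L \<gamma> = tens (hspace H) (forms L) 1 \<gamma>}\<rparr>"

text \<open>
  Linear functionals on the coinvariant forms are represented by functions that vanish outside
  the coinvariant forms.
\<close>

definition tangent_space ::
  "('k::field, 'h::{ring, monoid_mult}) hopf \<Rightarrow> ('k, 'h, 'w::ab_group_add) bicov_fodc \<Rightarrow>
   ('k, 'w \<Rightarrow> 'k) vs" where
  "tangent_space H L =
     \<lparr>scl = (\<lambda>c \<alpha> \<gamma>. c * \<alpha> \<gamma>),
      car = {\<alpha>. linear_map (coinv_forms H L) ground \<alpha> \<and> (\<forall>\<gamma>. \<gamma> \<notin> car (coinv_forms H L) \<longrightarrow> \<alpha> \<gamma> = 0)}\<rparr>"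

text \<open>
  The coaction on the tangent space is determined by \<open>\<alpha>\<^sub>0(\<gamma>) \<alpha>\<^sub>1 = \<alpha>(\<gamma>\<^sub>0) S\<^sup>-\<^sup>1(\<gamma>\<^sub>1)\<close>; such a tensor
  exists when the space of coinvariant forms is finite-dimensional.
\<close>

definition tangent_coact ::
  "('k::field, 'h::{ring, monoid_mult}) hopf \<Rightarrow> ('k, 'h, 'w::ab_group_add) bicov_fodc \<Rightarrow>
   ('w \<Rightarrow> 'k) \<Rightarrow> ('k, 'w \<Rightarrow> 'k, 'h) tensor" where
  "tangent_coact H L \<alpha> =
     (THE t. t \<in> car (tangent_space H L \<otimes> hspace H) \<and>
        (\<forall>\<gamma>\<in>car (coinv_forms H L).
           tlift (tangent_space H L) (hspace H) (\<lambda>\<alpha>0 \<alpha>1. hscale H (\<alpha>0 \<gamma>) \<alpha>1) t =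
           tlift (coinv_forms H L) (hspace H)
             (\<lambda>\<gamma>0 \<gamma>1. hscale H (\<alpha> \<gamma>0) (inv (antipode H) \<gamma>1)) (rcoact L \<gamma>)))"


section \<open>Twisted module algebras and the crossed product\<close>

record ('k, 'h, 'b) twisted_alg =
  bscale :: "'k \<Rightarrow> 'b \<Rightarrow> 'b"
  meas :: "'h \<Rightarrow> 'b \<Rightarrow> 'b"
  sigma :: "'h \<Rightarrow> 'h \<Rightarrow> 'b"
  sigma_inv :: "'h \<Rightarrow> 'h \<Rightarrow> 'b"

abbreviation bspace :: "('k, 'h, 'b) twisted_alg \<Rightarrow> ('k, 'b) vs" where
  "bspace B \<equiv> full (bscale B)"

definition twisted_module_algebra ::
  "('k::field, 'h::{ring, monoid_mult}) hopf \<Rightarrow> ('k, 'h, 'b::{ring, monoid_mult}) twisted_alg \<Rightarrow> bool" where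
  "twisted_module_algebra H B \<longleftrightarrow>
     k_algebra (bscale B) \<and>
     bilinear_map (hspace H) (bspace B) (bspace B) (meas B) \<and>
     bilinear_map (hspace H) (hspace H) (bspace B) (sigma B) \<and>
     bilinear_map (hspace H) (hspace H) (bspace B) (sigma_inv B) \<and>
     (\<forall>h h'. sw2 H h (\<lambda>h1 h2. sw2 H h' (\<lambda>h1' h2'. sigma B h1 h1' * sigma_inv B h2 h2')) =
              bscale B (counit H h * counit H h') 1) \<and>
     (\<forall>h h'. sw2 H h (\<lambda>h1 h2. sw2 H h' (\<lambda>h1' h2'. sigma_inv B h1 h1' * sigma B h2 h2')) =
              bscale B (counit H h * counit H h') 1) \<and>
     (\<forall>h. meas B h 1 = bscale B (counit H h) 1) \<and>
     (\<forall>h b b'. meas B h (b * b') = sw2 H h (\<lambda>h1 h2. meas B h1 b * meas B h2 b')) \<and>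
     (\<forall>b. meas B 1 b = b) \<and>
     (\<forall>h h' b. meas B h (meas B h' b) =
        sw3 H h (\<lambda>h1 h2 h3. sw3 H h' (\<lambda>h1' h2' h3'.
          sigma B h1 h1' * meas B (h2 * h2') b * sigma_inv B h3 h3'))) \<and>
     (\<forall>h. sigma B h 1 = bscale B (counit H h) 1 \<and> sigma B 1 h = bscale B (counit H h) 1) \<and>
     (\<forall>h h' h''.
        sw2 H h (\<lambda>h1 h2. sw2 H h' (\<lambda>h1' h2'. sw2 H h'' (\<lambda>h1'' h2''.
          meas B h1 (sigma B h1' h1'') * sigma B h2 (h2' * h2'')))) =
        sw2 H h (\<lambda>h1 h2. sw2 H h' (\<lambda>h1' h2'. sigma B h1 h1' * sigma B (h2 * h2') h'')))"

record ('k, 'h, 'b, 'v) twisted_fodc = "('k, 'b, 'v) fodc" +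
  hact :: "'h \<Rightarrow> 'v \<Rightarrow> 'v"

definition twisted_module_fodc ::
  "('k::field, 'h::{ring, monoid_mult}) hopf \<Rightarrow> ('k, 'h, 'b::{ring, monoid_mult}) twisted_alg \<Rightarrow>
   ('k, 'h, 'b, 'v::ab_group_add) twisted_fodc \<Rightarrow> bool" where
  "twisted_module_fodc H B E \<longleftrightarrow>
     is_fodc (bscale B) E \<and>
     bilinear_map (hspace H) (forms E) (forms E) (hact E) \<and>
     (\<forall>h b b'. hact E h (lact E b (diff E b')) =
        sw2 H h (\<lambda>h1 h2. lact E (meas B h1 b) (hact E h2 (diff E b')))) \<and>
     (\<forall>h b. diff E (meas B h b) = hact E h (diff E b)) \<and>
     (\<forall>h h'. diff E (sigma B h h') = 0)"

abbreviation cp_space ::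
  "('k::field, 'h::ab_group_add) hopf \<Rightarrow> ('k, 'h, 'b::ab_group_add) twisted_alg \<Rightarrow>
   ('k, ('k, 'b, 'h) tensor) vs" where
  "cp_space H B \<equiv> bspace B \<otimes> hspace H"

definition cp_one ::
  "('k::field, 'h::{ring, monoid_mult}) hopf \<Rightarrow> ('k, 'h, 'b::{ring, monoid_mult}) twisted_alg \<Rightarrow>
   ('k, 'b, 'h) tensor" where
  "cp_one H B = tens (bspace B) (hspace H) 1 1"

definition cp_mult ::
  "('k::field, 'h::{ring, monoid_mult}) hopf \<Rightarrow> ('k, 'h, 'b::{ring, monoid_mult}) twisted_alg \<Rightarrow>
   ('k, 'b, 'h) tensor \<Rightarrow> ('k, 'b, 'h) tensor \<Rightarrow> ('k, 'b, 'h) tensor" where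
  "cp_mult H B x y =
     tlift (bspace B) (hspace H) (\<lambda>b h. tlift (bspace B) (hspace H) (\<lambda>b' h'.
       sw3 H h (\<lambda>h1 h2 h3. sw2 H h' (\<lambda>h1' h2'.
         tens (bspace B) (hspace H) (b * meas B h1 b' * sigma B h2 h1') (h3 * h2')))) y) x"

definition cp_coact ::
  "('k::field, 'h::{ring, monoid_mult}) hopf \<Rightarrow> ('k, 'h, 'b::{ring, monoid_mult}) twisted_alg \<Rightarrow>
   ('k, 'b, 'h) tensor \<Rightarrow> ('k, ('k, 'b, 'h) tensor, 'h) tensor" where
  "cp_coact H B =
     tlift (bspace B) (hspace H) (\<lambda>b h. sw2 H h (\<lambda>h1 h2.
       tens (cp_space H B) (hspace H) (tens (bspace B) (hspace H) b h1) h2))"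


section \<open>The crossed product calculus\<close>

abbreviation cp_forms ::
  "('k::field, 'h::ab_group_add) hopf \<Rightarrow> ('k, 'h, 'w::ab_group_add) bicov_fodc \<Rightarrow>
   ('k, 'h, 'b::ab_group_add) twisted_alg \<Rightarrow> ('k, 'h, 'b, 'v::ab_group_add) twisted_fodc \<Rightarrow>
   ('k, ('k, 'v, 'h) tensor \<times> ('k, 'b, 'w) tensor) vs" where
  "cp_forms H L B E \<equiv> dsum (forms E \<otimes> hspace H) (bspace B \<otimes> forms L)"

definition cp_calculus ::
  "('k::field, 'h::{ring, monoid_mult}) hopf \<Rightarrow> ('k, 'h, 'w::ab_group_add) bicov_fodc \<Rightarrow>
   ('k, 'h, 'b::{ring, monoid_mult}) twisted_alg \<Rightarrow> ('k, 'h, 'b, 'v::ab_group_add) twisted_fodc \<Rightarrow>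
   ('k, ('k, 'b, 'h) tensor, ('k, 'v, 'h) tensor \<times> ('k, 'b, 'w) tensor) fodc" where
  "cp_calculus H L B E =
     (let VH = hspace H; VB = bspace B; ML = forms L; ME = forms E in
      \<lparr>fscale = scl (cp_forms H L B E),
       lact = (\<lambda>x \<omega>.
         (tlift VB VH (\<lambda>b' h'. tlift ME VH (\<lambda>\<beta> h.
            sw3 H h' (\<lambda>h1' h2' h3'. sw2 H h (\<lambda>h1 h2.
              tens ME VH (ract E (lact E b' (hact E h1' \<beta>)) (sigma B h2' h1)) (h3' * h2)))) (fst \<omega>)) x,
          tlift VB VH (\<lambda>b' h'. tlift VB ML (\<lambda>b \<gamma>.
            sw3 H h' (\<lambda>h1' h2' h3'. tlift VH ML (\<lambda>g \<gamma>0.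
              tens VB ML (b' * meas B h1' b * sigma B h2' g) (lact L h3' \<gamma>0)) (lcoact L \<gamma>))) (snd \<omega>)) x)),
       ract = (\<lambda>\<omega> x.
         (tlift ME VH (\<lambda>\<beta> h. tlift VB VH (\<lambda>b' h'.
            sw3 H h (\<lambda>h1 h2 h3. sw2 H h' (\<lambda>h1' h2'.
              tens ME VH (ract E (ract E \<beta> (meas B h1 b')) (sigma B h2 h1')) (h3 * h2')))) x) (fst \<omega>),
          tlift VB ML (\<lambda>b \<gamma>. tlift VB VH (\<lambda>b' h'.
            tlift VH ML (\<lambda>g2 \<gamma>'. tlift VH ML (\<lambda>g1 \<gamma>0. sw2 H h' (\<lambda>h1' h2'.
              tens VB ML (b * meas B g2 b' * sigma B g1 h1') (ract L \<gamma>0 h2'))) (lcoact L \<gamma>')) (lcoact L \<gamma>)) x) (snd \<omega>))),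
       diff = (\<lambda>x. (tlift VB VH (\<lambda>b h. tens ME VH (diff E b) h) x,
                     tlift VB VH (\<lambda>b h. tens VB ML b (diff L h)) x))\<rparr>)"

definition cp_forms_coact ::
  "('k::field, 'h::{ring, monoid_mult}) hopf \<Rightarrow> ('k, 'h, 'w::ab_group_add) bicov_fodc \<Rightarrow>
   ('k, 'h, 'b::{ring, monoid_mult}) twisted_alg \<Rightarrow> ('k, 'h, 'b, 'v::ab_group_add) twisted_fodc \<Rightarrow>
   ('k, 'v, 'h) tensor \<times> ('k, 'b, 'w) tensor \<Rightarrow>
   ('k, ('k, 'v, 'h) tensor \<times> ('k, 'b, 'w) tensor, 'h) tensor" where
  "cp_forms_coact H L B E \<omega> =
     tlift (forms E) (hspace H) (\<lambda>\<beta> h. sw2 H h (\<lambda>h1 h2.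
       tens (cp_forms H L B E) (hspace H) (tens (forms E) (hspace H) \<beta> h1, 0) h2)) (fst \<omega>) +
     tlift (bspace B) (forms L) (\<lambda>b \<gamma>. tlift (forms L) (hspace H) (\<lambda>\<gamma>0 \<gamma>1.
       tens (cp_forms H L B E) (hspace H) (0, tens (bspace B) (forms L) b \<gamma>0) \<gamma>1) (rcoact L \<gamma>)) (snd \<omega>)"

abbreviation hor_space ::
  "('k::field, 'h::{ring, monoid_mult}) hopf \<Rightarrow> ('k, 'h, 'w::ab_group_add) bicov_fodc \<Rightarrow>
   ('k, 'h, 'b::{ring, monoid_mult}) twisted_alg \<Rightarrow> ('k, ('k, ('k, 'b, 'h) tensor, 'w) tensor) vs" where
  "hor_space H L B \<equiv> cp_space H B \<otimes> coinv_forms H L"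

definition hor_lact ::
  "('k::field, 'h::{ring, monoid_mult}) hopf \<Rightarrow> ('k, 'h, 'w::ab_group_add) bicov_fodc \<Rightarrow>
   ('k, 'h, 'b::{ring, monoid_mult}) twisted_alg \<Rightarrow>
   ('k, 'b, 'h) tensor \<Rightarrow> ('k, ('k, 'b, 'h) tensor, 'w) tensor \<Rightarrow> ('k, ('k, 'b, 'h) tensor, 'w) tensor" where
  "hor_lact H L B a =
     tlift (cp_space H B) (coinv_forms H L) (\<lambda>a' \<gamma>.
       tens (cp_space H B) (coinv_forms H L) (cp_mult H B a a') \<gamma>)"

definition hor_coact ::
  "('k::field, 'h::{ring, monoid_mult}) hopf \<Rightarrow> ('k, 'h, 'w::ab_group_add) bicov_fodc \<Rightarrow>
   ('k, 'h, 'b::{ring, monoid_mult}) twisted_alg \<Rightarrow>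
   ('k, ('k, 'b, 'h) tensor, 'w) tensor \<Rightarrow> ('k, ('k, ('k, 'b, 'h) tensor, 'w) tensor, 'h) tensor" where
  "hor_coact H L B =
     tlift (cp_space H B) (coinv_forms H L) (\<lambda>a \<gamma>.
       tlift (cp_space H B) (hspace H) (\<lambda>a0 a1. tlift (coinv_forms H L) (hspace H) (\<lambda>\<gamma>0 \<gamma>1.
         tens (hor_space H L B) (hspace H) (tens (cp_space H B) (coinv_forms H L) a0 \<gamma>0) (a1 * \<gamma>1))
         (rcoact L \<gamma>)) (cp_coact H B a))"

text \<open>
  \<open>ver\<close> is the map \<open>a da' \<mapsto> a a'\<^sub>0 \<otimes> S(a'\<^sub>1) da'\<^sub>2\<close>, given here by its formula
  \<open>\<beta> \<otimes> h + b \<otimes> \<gamma> \<mapsto> b \<otimes> \<gamma>\<^sub>-\<^sub>2 \<otimes> S(\<gamma>\<^sub>-\<^sub>1)\<gamma>\<^sub>0\<close>. The individual terms \<open>S(\<gamma>\<^sub>-\<^sub>1)\<gamma>\<^sub>0\<close> become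
  coinvariant only after summation over the inner coaction.
\<close>

definition ver ::
  "('k::field, 'h::{ring, monoid_mult}) hopf \<Rightarrow> ('k, 'h, 'w::ab_group_add) bicov_fodc \<Rightarrow>
   ('k, 'h, 'b::{ring, monoid_mult}) twisted_alg \<Rightarrow> ('k, 'h, 'b, 'v::ab_group_add) twisted_fodc \<Rightarrow>
   ('k, 'v, 'h) tensor \<times> ('k, 'b, 'w) tensor \<Rightarrow> ('k, ('k, 'b, 'h) tensor, 'w) tensor" where
  "ver H L B E \<omega> =
     tlift (bspace B) (forms L) (\<lambda>b \<gamma>.
       tlift (hspace H) (forms L) (\<lambda>g2 \<gamma>'. tlift (hspace H) (forms L) (\<lambda>g1 \<gamma>0.
         tens (cp_space H B) (coinv_forms H L)
           (tens (bspace B) (hspace H) b g2) (lact L (antipode H g1) \<gamma>0))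
         (lcoact L \<gamma>')) (lcoact L \<gamma>)) (snd \<omega>)"


section \<open>Connections and connection 1-forms\<close>

text \<open>
  Maps in \<open>\<rightarrow>\<^sub>E\<close> are fixed outside their domain, so distinct members of \<open>connections\<close> differ on it.
\<close>

definition connections ::
  "('k::field, 'h::{ring, monoid_mult}) hopf \<Rightarrow> ('k, 'h, 'w::ab_group_add) bicov_fodc \<Rightarrow>
   ('k, 'h, 'b::{ring, monoid_mult}) twisted_alg \<Rightarrow> ('k, 'h, 'b, 'v::ab_group_add) twisted_fodc \<Rightarrow>
   (('k, ('k, 'b, 'h) tensor, 'w) tensor \<Rightarrow> ('k, 'v, 'h) tensor \<times> ('k, 'b, 'w) tensor) set" where
  "connections H L B E =
     {c \<in> car (hor_space H L B) \<rightarrow>\<^sub>E car (cp_forms H L B E).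
        linear_map (hor_space H L B) (cp_forms H L B E) c \<and>
        (\<forall>a\<in>car (cp_space H B). \<forall>t\<in>car (hor_space H L B).
           c (hor_lact H L B a t) = lact (cp_calculus H L B E) a (c t)) \<and>
        (\<forall>t\<in>car (hor_space H L B).
           cp_forms_coact H L B E (c t) =
           tlift (hor_space H L B) (hspace H) (\<lambda>t0 t1. tens (cp_forms H L B E) (hspace H) (c t0) t1)
             (hor_coact H L B t)) \<and>
        (\<forall>t\<in>car (hor_space H L B). ver H L B E (c t) = t)}"

definition fundamental_field ::
  "('k::field, 'h::{ring, monoid_mult}) hopf \<Rightarrow> ('k, 'h, 'w::ab_group_add) bicov_fodc \<Rightarrow>
   ('k, 'h, 'b::{ring, monoid_mult}) twisted_alg \<Rightarrow> ('k, 'h, 'b, 'v::ab_group_add) twisted_fodc \<Rightarrow>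
   ('w \<Rightarrow> 'k) \<Rightarrow> ('k, 'v, 'h) tensor \<times> ('k, 'b, 'w) tensor \<Rightarrow> ('k, 'b, 'h) tensor" where
  "fundamental_field H L B E \<alpha> \<omega> =
     tlift (cp_space H B) (coinv_forms H L) (\<lambda>a \<gamma>. tscale (\<alpha> \<gamma>) a) (ver H L B E \<omega>)"

abbreviation tangent_forms ::
  "('k::field, 'h::{ring, monoid_mult}) hopf \<Rightarrow> ('k, 'h, 'w::ab_group_add) bicov_fodc \<Rightarrow>
   ('k, 'h, 'b::{ring, monoid_mult}) twisted_alg \<Rightarrow> ('k, 'h, 'b, 'v::ab_group_add) twisted_fodc \<Rightarrow>
   ('k, ('k, 'w \<Rightarrow> 'k, ('k, 'v, 'h) tensor \<times> ('k, 'b, 'w) tensor) tensor) vs" where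
  "tangent_forms H L B E \<equiv> tangent_space H L \<otimes> cp_forms H L B E"

definition tangent_forms_coact ::
  "('k::field, 'h::{ring, monoid_mult}) hopf \<Rightarrow> ('k, 'h, 'w::ab_group_add) bicov_fodc \<Rightarrow>
   ('k, 'h, 'b::{ring, monoid_mult}) twisted_alg \<Rightarrow> ('k, 'h, 'b, 'v::ab_group_add) twisted_fodc \<Rightarrow>
   ('k, 'w \<Rightarrow> 'k, ('k, 'v, 'h) tensor \<times> ('k, 'b, 'w) tensor) tensor \<Rightarrow>
   ('k, ('k, 'w \<Rightarrow> 'k, ('k, 'v, 'h) tensor \<times> ('k, 'b, 'w) tensor) tensor, 'h) tensor" where
  "tangent_forms_coact H L B E =
     tlift (tangent_space H L) (cp_forms H L B E) (\<lambda>\<alpha> \<omega>.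
       tlift (tangent_space H L) (hspace H) (\<lambda>\<alpha>0 \<alpha>1. tlift (cp_forms H L B E) (hspace H) (\<lambda>\<omega>0 \<omega>1.
         tens (tangent_forms H L B E) (hspace H)
           (tens (tangent_space H L) (cp_forms H L B E) \<alpha>0 \<omega>0) (\<alpha>1 * \<omega>1))
         (cp_forms_coact H L B E \<omega>)) (tangent_coact H L \<alpha>))"

definition connection_forms ::
  "('k::field, 'h::{ring, monoid_mult}) hopf \<Rightarrow> ('k, 'h, 'w::ab_group_add) bicov_fodc \<Rightarrow>
   ('k, 'h, 'b::{ring, monoid_mult}) twisted_alg \<Rightarrow> ('k, 'h, 'b, 'v::ab_group_add) twisted_fodc \<Rightarrow>
   ('k, 'w \<Rightarrow> 'k, ('k, 'v, 'h) tensor \<times> ('k, 'b, 'w) tensor) tensor set" where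
  "connection_forms H L B E =
     {\<phi> \<in> car (tangent_forms H L B E).
        tangent_forms_coact H L B E \<phi> = tens (tangent_forms H L B E) (hspace H) \<phi> 1 \<and>
        (\<forall>\<alpha>\<in>car (tangent_space H L).
           tlift (tangent_space H L) (cp_forms H L B E) (\<lambda>x \<omega>.
             tens (tangent_space H L) (cp_space H B) x (fundamental_field H L B E \<alpha> \<omega>)) \<phi> =
           tens (tangent_space H L) (cp_space H B) \<alpha> (cp_one H B))}"

definition form_of_connection ::
  "('k::field, 'h::{ring, monoid_mult}) hopf \<Rightarrow> ('k, 'h, 'w::ab_group_add) bicov_fodc \<Rightarrow>
   ('k, 'h, 'b::{ring, monoid_mult}) twisted_alg \<Rightarrow> ('k, 'h, 'b, 'v::ab_group_add) twisted_fodc \<Rightarrow>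
   nat \<Rightarrow> (nat \<Rightarrow> 'w \<Rightarrow> 'k) \<Rightarrow> (nat \<Rightarrow> 'w) \<Rightarrow>
   (('k, ('k, 'b, 'h) tensor, 'w) tensor \<Rightarrow> ('k, 'v, 'h) tensor \<times> ('k, 'b, 'w) tensor) \<Rightarrow>
   ('k, 'w \<Rightarrow> 'k, ('k, 'v, 'h) tensor \<times> ('k, 'b, 'w) tensor) tensor" where
  "form_of_connection H L B E n x xd c =
     (\<Sum>j=1..n. tens (tangent_space H L) (cp_forms H L B E) (x j)
        (c (tens (cp_space H B) (coinv_forms H L) (cp_one H B) (xd j))))"

definition connection_of_form ::
  "('k::field, 'h::{ring, monoid_mult}) hopf \<Rightarrow> ('k, 'h, 'w::ab_group_add) bicov_fodc \<Rightarrow>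
   ('k, 'h, 'b::{ring, monoid_mult}) twisted_alg \<Rightarrow> ('k, 'h, 'b, 'v::ab_group_add) twisted_fodc \<Rightarrow>
   nat \<Rightarrow> (nat \<Rightarrow> 'w \<Rightarrow> 'k) \<Rightarrow> (nat \<Rightarrow> ('k, 'v, 'h) tensor \<times> ('k, 'b, 'w) tensor) \<Rightarrow>
   (('k, ('k, 'b, 'h) tensor, 'w) tensor \<Rightarrow> ('k, 'v, 'h) tensor \<times> ('k, 'b, 'w) tensor)" where
  "connection_of_form H L B E n x \<phi> =
     restrict
       (tlift (cp_space H B) (coinv_forms H L) (\<lambda>a \<gamma>.
          \<Sum>j=1..n. scl (cp_forms H L B E) (x j \<gamma>) (lact (cp_calculus H L B E) a (\<phi> j))))
       (car (hor_space H L B))"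

end

theory Submission
  imports Defs
begin

text \<open>
  Write \<open>A\<close> for the crossed product, \<open>\<Omega>\<close> for its calculus, \<open>\<Gamma>\<close> for the coinvariant forms on \<open>H\<close> and \<open>T\<close>
  for the tangent space, with dual bases \<open>x\<^sup>j\<close> of \<open>\<Gamma>\<close> and \<open>x\<^sub>j\<close> of \<open>T\<close>. As a left \<open>A\<close>-module \<open>A \<otimes> \<Gamma>\<close> is
  free on the elements \<open>1 \<otimes> x\<^sup>j\<close>. A left linear map \<open>c\<close> is therefore the same thing as the family
  \<open>\<phi>\<^sub>j = c(1 \<otimes> x\<^sup>j)\<close>, that is, as the tensor \<open>\<Sum> x\<^sub>j \<otimes> \<phi>\<^sub>j\<close>, and what has to be shown is that the other two
  conditions on \<open>c\<close> are the two conditions on this tensor.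

  Let \<open>x\<^sup>j \<mapsto> \<Sum> x\<^sup>k \<otimes> m\<^sub>k\<^sub>j\<close> be the right coaction on \<open>\<Gamma>\<close>. Then \<open>m\<close> is a comultiplicative matrix, the
  coaction on \<open>T\<close> is \<open>x\<^sub>j \<mapsto> \<Sum> x\<^sub>k \<otimes> S\<^sup>-\<^sup>1(m\<^sub>j\<^sub>k)\<close>, and \<open>S\<^sup>-\<^sup>1(m)\<close> is inverse to \<open>m\<close> up to the order of the
  factors (\<open>mc_inverse\<close>, which needs that \<open>S\<close> reverses products). Multiplying by \<open>m\<close> turns
  coinvariance of \<open>\<Sum> x\<^sub>j \<otimes> \<phi>\<^sub>j\<close> into the statement that \<open>\<phi>\<^sub>k\<close> has coaction \<open>\<Sum> \<phi>\<^sub>l \<otimes> m\<^sub>l\<^sub>k\<close>, which is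
  colinearity of \<open>c\<close> on the generators (\<open>coinvariant_iff\<close>). Pairing with all fundamental fields
  determines an element of \<open>A \<otimes> \<Gamma>\<close>, so the normalisation says that the vertical map sends \<open>\<phi>\<^sub>k\<close> to
  \<open>1 \<otimes> x\<^sup>k\<close> (\<open>connection_forms_iff\<close>). To pass from the generators to all of \<open>A \<otimes> \<Gamma>\<close> one uses that \<open>\<Omega>\<close> is
  a left \<open>A\<close>-module (\<open>lact_assoc\<close>), that its coaction is compatible with the action (\<open>coact_lact\<close>), and
  that the vertical map takes values in \<open>A \<otimes> \<Gamma>\<close> and is left linear (\<open>linear_ver\<close>, \<open>ver_lact\<close>).

  The algebra \<open>A\<close> and both summands of \<open>\<Omega>\<close> are spaces \<open>M \<otimes> N\<close> with the same action
  \<open>(b \<otimes> h)(m \<otimes> \<gamma>) = b(h1 \<cdot> m)\<sigma>(h2 \<otimes> \<gamma>\<^sub>-\<^sub>1) \<otimes> h3\<gamma>\<^sub>0\<close>, where \<open>M\<close> is \<open>B\<close> or its space of forms and \<open>N\<close> is \<open>H\<close> or its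
  space of forms. The action is studied once, for any \<open>B\<close>-bimodule \<open>M\<close> with a twisted action of \<open>H\<close> and any
  left \<open>H\<close>-module \<open>N\<close> with compatible coactions; its associativity (\<open>act_assoc\<close>) combines the
  cocycle identity for \<open>\<sigma>\<close> with the twisted module identity for \<open>M\<close>. For the forms on \<open>B\<close> the latter
  identity follows from the one for \<open>B\<close> because \<open>d\<sigma> = 0\<close> (\<open>fodc_bimodule\<close>). For the vertical map the essential object is
  the projection \<open>P(\<gamma>) = S(\<gamma>\<^sub>-\<^sub>1)\<gamma>\<^sub>0\<close> onto the coinvariants, with \<open>P(h\<gamma>) = \<epsilon>(h)P(\<gamma>)\<close>.

  Sweedler sums are handled as follows. For fixed spaces and a fixed tensor, \<open>tlift\<close> sums a function over one
  chosen list of pure tensors. Hence two Sweedler sums commute, and additive maps pass through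
  them, for arbitrary summands. Multilinearity matters when the tensor itself is
  rewritten, as in coassociativity; it is proved by simplification with the rules for \<open>lin\<close>.
\<close>

section \<open>Linear maps on tensor products\<close>

abbreviation lin ::
  "('k::field \<Rightarrow> 'a::ab_group_add \<Rightarrow> 'a) \<Rightarrow> ('k \<Rightarrow> 'b::ab_group_add \<Rightarrow> 'b) \<Rightarrow> ('a \<Rightarrow> 'b) \<Rightarrow> bool" where
  "lin s t \<equiv> linear_map (full s) (full t)"

lemma car_full [simp]: "car (full s) = UNIV" and scl_full [simp]: "scl (full s) = s"
  by (simp_all add: full_def)

declare vector_space_tscale [simp]

lemma scl_tprod [simp]: "scl (V \<otimes> W) = tscale"
  by (simp add: tprod_def)

lemma is_vs_full [simp]: "is_vs (full s) \<longleftrightarrow> vector_space s"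
  by (auto simp: is_vs_def module.subspace_UNIV module_iff_vector_space)

lemma lin_iff:
  "lin s t f \<longleftrightarrow>
     (\<forall>x y. f (x + y) = f x + f y) \<and> (\<forall>c x. f (s c x) = t c (f x))"
  by (auto simp: linear_map_def)

lemma lin_add: "lin s t f \<Longrightarrow> f (x + y) = f x + f y"
  and lin_scale: "lin s t f \<Longrightarrow> f (s c x) = t c (f x)"
  by (simp_all add: lin_iff)

lemma additive_sum_list:
  fixes F :: "'a::ab_group_add \<Rightarrow> 'b::ab_group_add"
  assumes "\<And>x y. F (x + y) = F x + F y"
  shows "F (sum_list xs) = sum_list (map F xs)"
proof -
  have "F 0 = 0" using assms[of 0 0] by simp
  then show ?thesis by (induction xs) (simp_all add: assms)
qed

lemma is_vs_mem:
  assumes "is_vs V"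
  shows "0 \<in> car V" "v \<in> car V \<Longrightarrow> v' \<in> car V \<Longrightarrow> v + v' \<in> car V"
    "v \<in> car V \<Longrightarrow> scl V c v \<in> car V"
  using assms by (auto simp: is_vs_def module.subspace_def module_iff_vector_space[symmetric])

lemma is_vs_sum: "is_vs V \<Longrightarrow> (\<And>i. i \<in> I \<Longrightarrow> f i \<in> car V) \<Longrightarrow> (\<Sum>i\<in>I. f i) \<in> car V"
  by (induction I rule: infinite_finite_induct) (auto intro: is_vs_mem)

lemma is_vs_tprod' [simp]: "is_vs (V \<otimes> W)"
  by (rule is_vs_tprod)

lemma is_vs_vector_space: "is_vs V \<Longrightarrow> vector_space (scl V)"
  by (simp add: is_vs_def)

lemma tens_mem [simp, intro]: "v \<in> car V \<Longrightarrow> w \<in> car W \<Longrightarrow> tens V W v w \<in> car (V \<otimes> W)"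
  by (auto simp: tprod_def intro!: tensor.span_base)

lemma tens_cong: "scl V = scl V' \<Longrightarrow> scl W = scl W' \<Longrightarrow> tens V W = tens V' W'"
  by (intro ext) (simp add: tens_def)

lemma tens_simps:
  "tens V W (v + v') w = tens V W v w + tens V W v' w"
  "tens V W v (w + w') = tens V W v w + tens V W v w'"
  "tens V W (scl V c v) w = tscale c (tens V W v w)"
  "tens V W v (scl W c w) = tscale c (tens V W v w)"
  by (rule tensor_eqI,
      simp add: teval_tens bilinear_map_def linear_map_def full_def ground_def)+

lemma tens_zero [simp]: "tens V W 0 w = 0" "tens V W v 0 = 0"
  using tens_simps(1)[of V W 0 0 w] tens_simps(2)[of V W v 0 0] by simp_all

text \<open>
  The list of pure tensors over which \<open>tlift\<close> sums. It depends on neither the function nor its target, which is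
  what makes \<open>tlift_swap\<close> and \<open>tlift_additive\<close> unconditional.
\<close>

definition trep ::
  "('k::field, 'a::ab_group_add) vs \<Rightarrow> ('k, 'b::ab_group_add) vs \<Rightarrow> ('k, 'a, 'b) tensor \<Rightarrow> ('a \<times> 'b) list" where
  "trep V W t = (SOME ps. set ps \<subseteq> car V \<times> car W \<and> t = (\<Sum>(v, w) \<leftarrow> ps. tens V W v w))"

lemma tlift_trep: "tlift V W f t = (\<Sum>(v, w) \<leftarrow> trep V W t. f v w)"
  by (simp add: tlift_def trep_def)

lemma trep:
  assumes "is_vs V" "t \<in> car (V \<otimes> W)"
  shows "set (trep V W t) \<subseteq> car V \<times> car W" "t = (\<Sum>(v, w) \<leftarrow> trep V W t. tens V W v w)"
  using someI_ex[OF tprod_sum_list[OF assms]] unfolding trep_def by auto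

lemma tlift_swap:
  "tlift V W (\<lambda>a b. tlift V' W' (\<lambda>c d. f a b c d) t') t =
   tlift V' W' (\<lambda>c d. tlift V W (\<lambda>a b. f a b c d) t) t'"
proof -
  have "(\<Sum>(a, b)\<leftarrow>ps. \<Sum>(c, d)\<leftarrow>qs. f a b c d) = (\<Sum>(c, d)\<leftarrow>qs. \<Sum>(a, b)\<leftarrow>ps. f a b c d)" for ps qs
    by (induction ps) (auto simp: sum_list_addf case_prod_unfold)
  then show ?thesis by (simp add: tlift_trep)
qed

lemma tlift_additive:
  assumes "\<And>x y. F (x + y) = F x + F y"
  shows "F (tlift V W f t) = tlift V W (\<lambda>a b. F (f a b)) t"
  by (simp add: tlift_trep additive_sum_list[of F, OF assms] comp_def case_prod_unfold)

lemma tlift_cong: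
  assumes "is_vs V" "t \<in> car (V \<otimes> W)" "\<And>v w. v \<in> car V \<Longrightarrow> w \<in> car W \<Longrightarrow> f v w = g v w"
  shows "tlift V W f t = tlift V W g t"
  unfolding tlift_trep by (rule arg_cong[of _ _ sum_list], rule map_cong)
    (use trep(1)[OF assms(1,2)] assms(3) in auto)

lemma tlift_mem:
  assumes "is_vs V" "is_vs X" "t \<in> car (V \<otimes> W)"
    and "\<And>v w. v \<in> car V \<Longrightarrow> w \<in> car W \<Longrightarrow> f v w \<in> car X"
  shows "tlift V W f t \<in> car X"
proof -
  have "set ps \<subseteq> car V \<times> car W \<Longrightarrow> (\<Sum>(v, w) \<leftarrow> ps. f v w) \<in> car X" for ps
    by (induction ps) (auto intro!: is_vs_mem[OF assms(2)] assms(4))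
  then show ?thesis using trep(1)[OF assms(1,3)] by (simp add: tlift_trep)
qed

lemma linear_tlift:
  assumes "is_vs V" "is_vs X" "t \<in> car (V \<otimes> W)" "linear_map X Y F"
    and "\<And>v w. v \<in> car V \<Longrightarrow> w \<in> car W \<Longrightarrow> f v w \<in> car X"
  shows "F (tlift V W f t) = tlift V W (\<lambda>a b. F (f a b)) t"
proof -
  have "F 0 = 0"
    using assms(4) is_vs_mem(1)[OF assms(2)] unfolding linear_map_def by (metis add_cancel_right_right)
  have "set ps \<subseteq> car V \<times> car W \<Longrightarrow> (\<Sum>(v, w) \<leftarrow> ps. f v w) \<in> car X \<and>
      F (\<Sum>(v, w) \<leftarrow> ps. f v w) = (\<Sum>(v, w) \<leftarrow> ps. F (f v w))" for ps
  proof (induction ps)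
    case Nil then show ?case using \<open>F 0 = 0\<close> by (simp add: is_vs_mem[OF assms(2)])
  next
    case (Cons p ps) then show ?case
      using assms(4,5) is_vs_mem(2)[OF assms(2)] by (cases p) (auto simp: linear_map_def)
  qed
  then show ?thesis using trep(1)[OF assms(1,3)] by (simp add: tlift_trep)
qed

lemma tensor_induct [consumes 2, case_names tens add]:
  assumes "t \<in> car (V \<otimes> W)" "is_vs V"
    and "\<And>v w. v \<in> car V \<Longrightarrow> w \<in> car W \<Longrightarrow> P (tens V W v w)"
    and "\<And>s t. s \<in> car (V \<otimes> W) \<Longrightarrow> t \<in> car (V \<otimes> W) \<Longrightarrow> P s \<Longrightarrow> P t \<Longrightarrow> P (s + t)"
    and "is_vs W"
  shows "P t"
proof -
  have "set ps \<subseteq> car V \<times> car W \<Longrightarrow> (\<Sum>(v, w) \<leftarrow> ps. tens V W v w) \<in> car (V \<otimes> W)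
      \<and> P (\<Sum>(v, w) \<leftarrow> ps. tens V W v w)" for ps
  proof (induction ps)
    case Nil then show ?case
      using assms(3)[of 0 0] is_vs_mem(1)[OF assms(2)] is_vs_mem(1)[OF assms(5)] 
      by (simp add: is_vs_mem[OF is_vs_tprod])
  next
    case (Cons p ps) then show ?case 
      using assms(3,4) is_vs_mem(2)[OF is_vs_tprod, of _ V W] by (cases p) auto
  qed
  then show ?thesis using trep[OF assms(2,1)] by metis
qed

lemma linear_map_zero: "is_vs V \<Longrightarrow> linear_map V X f \<Longrightarrow> f 0 = 0"
  unfolding linear_map_def using is_vs_mem(1) by (metis add_cancel_right_right)

lemma linear_map_sum:
  assumes "is_vs V" "linear_map V X f" "\<And>i. i \<in> I \<Longrightarrow> v i \<in> car V"
  shows "f (\<Sum>i\<in>I. v i) = (\<Sum>i\<in>I. f (v i))"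
  using assms(3)
proof (induction I rule: infinite_finite_induct)
  case (insert i I)
  have "(\<Sum>i\<in>I. v i) \<in> car V" by (rule is_vs_sum[OF assms(1)]) (use insert.prems in auto)
  then have "f (v i + (\<Sum>i\<in>I. v i)) = f (v i) + f (\<Sum>i\<in>I. v i)"
    using assms(2) insert.prems by (simp add: linear_map_def)
  then show ?case using insert by simp
qed (simp_all add: linear_map_zero[OF assms(1,2)])

lemma linear_map_comp: "linear_map V W f \<Longrightarrow> linear_map W X g \<Longrightarrow> linear_map V X (\<lambda>v. g (f v))"
  by (simp add: linear_map_def)

lemma linear_ext_tens:
  assumes "is_vs V" "is_vs W" "linear_map (V \<otimes> W) X f" "linear_map (V \<otimes> W) X' g"
    and "\<And>v w. v \<in> car V \<Longrightarrow> w \<in> car W \<Longrightarrow> f (tens V W v w) = g (tens V W v w)"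
    and "t \<in> car (V \<otimes> W)"
  shows "f t = g t"
  using assms(6,1)
proof (induction rule: tensor_induct)
  case (add s t)
  then show ?case using assms(3,4) by (simp add: linear_map_def)
qed (use assms in simp_all)

lemma bilinear_full:
  assumes "\<And>w. lin s t (\<lambda>v. f v w)" "\<And>v. linear_map (full s') (full t) (\<lambda>w. f v w)"
  shows "bilinear_map (full s) (full s') (full t) f"
  using assms by (simp add: bilinear_map_def)

lemma bilinear_mono:
  assumes "bilinear_map V W X f" "car V' \<subseteq> car V" "car W' \<subseteq> car W" "scl V = scl V'" "scl W = scl W'"
    "scl X = scl X'" "car X \<subseteq> car X'"
  shows "bilinear_map V' W' X' f"
  using assms unfolding bilinear_map_def linear_map_def by (simp add: subset_iff)

lemma tlift_sum:
  assumes "is_vs V" "is_vs W" "is_vs X" "bilinear_map V W X f"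
    and "\<And>i. i \<in> I \<Longrightarrow> v i \<in> car V" "\<And>i. i \<in> I \<Longrightarrow> w i \<in> car W"
  shows "tlift V W f (\<Sum>i\<in>I. tens V W (v i) (w i)) = (\<Sum>i\<in>I. f (v i) (w i))"
  by (subst linear_map_sum[OF is_vs_tprod tlift_universal(1)[OF assms(1-4)]])
    (use assms tlift_universal(2)[OF assms(1-4)] in auto)

text \<open>
  Sweedler sums over the coinvariant forms and over all forms agree when both make sense; this is how the two are compared.
\<close>

lemma tlift_subspace:
  assumes "is_vs V" "is_vs W" "is_vs X" "bilinear_map V W X f" "is_vs V'" "is_vs W'"
    and "car V' \<subseteq> car V" "car W' \<subseteq> car W" "scl V = scl V'" "scl W = scl W'" "t \<in> car (V' \<otimes> W')"
  shows "tlift V W f t = tlift V' W' f t"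
proof -
  note r = trep[OF assms(5,11)]
  have "tlift V W f (\<Sum>(v, w) \<leftarrow> trep V' W' t. tens V W v w) = (\<Sum>(v, w) \<leftarrow> trep V' W' t. f v w)"
    by (rule tlift_sum_list[OF assms(1-4)]) (use r(1) assms(7,8) in auto)
  then show ?thesis using r(2) tens_cong[OF assms(9,10)] by (simp add: tlift_trep[of V'])
qed

lemma lin_id [simp]: "lin s s (\<lambda>x. x)"
  by (simp add: lin_iff)

lemma lin_tens [simp]:
  "linear_map (full s) (full (scl V)) f \<Longrightarrow> lin s tscale (\<lambda>x. tens V W (f x) w)"
  "linear_map (full s) (full (scl W)) g \<Longrightarrow> lin s tscale (\<lambda>x. tens V W v (g x))"
  by (simp_all add: lin_iff tens_simps)

text \<open>
  A sum over a fixed list is linear in its terms, so linearity in a parameter passes from the summand to the sum.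
  Linearity in the tensor that is summed over is the subject of \<open>lin_tlift_arg\<close>.
\<close>

lemma lin_tlift [simp]:
  assumes "vector_space t" "\<And>a b. lin s t (\<lambda>x. f x a b)"
  shows "lin s t (\<lambda>x. tlift V W (\<lambda>a b. f x a b) u)"
proof -
  interpret vector_space t by fact
  have "(\<Sum>(v, w)\<leftarrow>ps. f (s c x) v w) = t c (\<Sum>(v, w)\<leftarrow>ps. f x v w)" for ps c x
    by (induction ps) (use assms(2) in \<open>auto simp: lin_iff scale_right_distrib\<close>)
  moreover have "(\<Sum>(v, w)\<leftarrow>ps. f (x+y) v w) = (\<Sum>(v, w)\<leftarrow>ps. f x v w) + (\<Sum>(v, w)\<leftarrow>ps. f y v w)" for ps x y
    by (induction ps) (use assms(2) in \<open>auto simp: lin_iff\<close>)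
  ultimately show ?thesis by (simp add: lin_iff tlift_trep)
qed

lemma lin_comp_bilinear:
  assumes "bilinear_map (full s1) (full s2) (full t) F"
  shows "lin s s1 f \<Longrightarrow> lin s t (\<lambda>x. F (f x) w)"
    "lin s s2 g \<Longrightarrow> lin s t (\<lambda>x. F v (g x))"
  using assms by (auto simp: lin_iff bilinear_map_def)

lemma lin_comp:
  assumes "lin s1 t F" "lin s s1 f"
  shows "lin s t (\<lambda>x. F (f x))"
  using assms by (auto simp: lin_iff)

lemma lin_tlift_arg:
  assumes \<rho>: "linear_map (full r) (full s \<otimes> full s') \<rho>" and vs: "vector_space s" "vector_space s'" "vector_space t"
    and f: "lin q r f"
    and g: "\<And>b. lin s t (\<lambda>a. g a b)" "\<And>a. linear_map (full s') (full t) (\<lambda>b. g a b)"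
  shows "lin q t (\<lambda>x. tlift (full s) (full s') g (\<rho> (f x)))"
proof -
  have "linear_map (full s \<otimes> full s') (full t) (tlift (full s) (full s') g)"
    by (rule tlift_universal(1)) (use vs bilinear_full[OF g] in simp_all)
  then have "lin r t (\<lambda>x. tlift (full s) (full s') g (\<rho> x))"
    using linear_map_comp[OF \<rho>] by blast
  then show ?thesis using lin_comp f by blast
qed

lemma tlift_tens_full:
  assumes "vector_space s" "vector_space s'" "vector_space t"
    "\<And>b. lin s t (\<lambda>a. g a b)" "\<And>a. linear_map (full s') (full t) (\<lambda>b. g a b)"
  shows "tlift (full s) (full s') g (tens (full s) (full s') v w) = g v w"
  by (rule tlift_universal(2)[OF _ _ _ bilinear_full[OF assms(4,5)]]) (use assms in simp_all)

text \<open>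
  The axioms for comodules are equations between elements of a triple tensor product. Composition
  with \<open>F\<close> turns each of them into a rule for the Sweedler sums of a trilinear function.
\<close>

lemma trilinear_lift:
  fixes f :: "'a::ab_group_add \<Rightarrow> 'b::ab_group_add \<Rightarrow> 'c::ab_group_add \<Rightarrow> 'd::ab_group_add"
  assumes vs: "vector_space s1" "vector_space s2" "vector_space s3" "vector_space t"
    and f: "\<And>b c. lin s1 t (\<lambda>a. f a b c)"
      "\<And>a c. lin s2 t (\<lambda>b. f a b c)"
      "\<And>a b. lin s3 t (\<lambda>c. f a b c)"
  obtains F where "linear_map ((full s1 \<otimes> full s2) \<otimes> full s3) (full t) F"
    "\<And>a b c. F (tens (full s1 \<otimes> full s2) (full s3) (tens (full s1) (full s2) a b) c) = f a b c"
proof -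
  let ?U = "full s1 \<otimes> full s2"
  have "linear_map ?U (full t) (tlift (full s1) (full s2) (\<lambda>a b. f a b c))" for c
    by (rule tlift_universal(1)) (use vs bilinear_full[OF f(1,2)] in simp_all)
  moreover have "lin s3 t (\<lambda>c. tlift (full s1) (full s2) (\<lambda>a b. f a b c) u)" for u
    by (rule lin_tlift) (use vs f in simp_all)
  ultimately have bil: "bilinear_map ?U (full s3) (full t) (\<lambda>u c. tlift (full s1) (full s2) (\<lambda>a b. f a b c) u)"
    by (simp add: bilinear_map_def)
  show ?thesis
  proof (rule that)
    show "linear_map (?U \<otimes> full s3) (full t)
        (tlift ?U (full s3) (\<lambda>u c. tlift (full s1) (full s2) (\<lambda>a b. f a b c) u))"
      by (rule tlift_universal(1)) (use vs bil in simp_all)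
    show "tlift ?U (full s3) (\<lambda>u c. tlift (full s1) (full s2) (\<lambda>a b. f a b c) u)
        (tens ?U (full s3) (tens (full s1) (full s2) a b) c) = f a b c" for a b c
      by (subst tlift_universal(2)[OF _ _ _ bil])
        (use vs tlift_tens_full[OF vs(1,2,4) f(1,2)] in simp_all)
  qed
qed

lemma linear_tlift_tlift:
  assumes "linear_map X Y F" "is_vs V" "is_vs V'" "is_vs X" "t \<in> car (V \<otimes> W)"
    "\<And>x y. x \<in> car V \<Longrightarrow> y \<in> car W \<Longrightarrow> \<tau> x y \<in> car (V' \<otimes> W')"
    "\<And>x y u v. x \<in> car V \<Longrightarrow> y \<in> car W \<Longrightarrow> u \<in> car V' \<Longrightarrow> v \<in> car W' \<Longrightarrow> g x y u v \<in> car X"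
  shows "F (tlift V W (\<lambda>x y. tlift V' W' (g x y) (\<tau> x y)) t) =
    tlift V W (\<lambda>x y. tlift V' W' (\<lambda>u v. F (g x y u v)) (\<tau> x y)) t"
proof -
  have "F (tlift V W (\<lambda>x y. tlift V' W' (g x y) (\<tau> x y)) t) =
      tlift V W (\<lambda>x y. F (tlift V' W' (g x y) (\<tau> x y))) t"
    by (rule linear_tlift[OF assms(2,4,5,1)]) (auto intro!: tlift_mem assms)
  also have "... = tlift V W (\<lambda>x y. tlift V' W' (\<lambda>u v. F (g x y u v)) (\<tau> x y)) t"
    by (rule tlift_cong[OF assms(2,5)], rule linear_tlift[OF assms(3,4) _ assms(1)]) (auto intro!: assms)
  finally show ?thesis .
qed

lemma lin_eq_on_span:
  assumes "vector_space s" "lin s t F" "lin s t G"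
    "\<And>x. x \<in> X \<Longrightarrow> F x = G x" "module.span s X = UNIV" "vector_space t"
  shows "F = G"
proof
  interpret vector_space s by fact
  interpret t: vector_space t by fact
  have "subspace {x. F x = G x}"
    using linear_map_zero[OF _ assms(2)] linear_map_zero[OF _ assms(3)] assms
    by (simp add: subspace_def lin_iff)
  then have "span X \<subseteq> {x. F x = G x}" using assms(4) by (intro span_minimal) auto
  then show "F x = G x" for x using assms(5) by auto
qed

lemma linear_map_ident: "linear_map V V (\<lambda>v. v)"
  by (simp add: linear_map_def)

lemma linear_map_tlift_param:
  assumes "is_vs V" "is_vs X" "u \<in> car (V \<otimes> W)"
    and "\<And>v w. v \<in> car V \<Longrightarrow> w \<in> car W \<Longrightarrow> linear_map U X (\<lambda>x. f x v w)"
  shows "linear_map U X (\<lambda>x. tlift V W (f x) u)"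
proof -
  interpret X: vector_space "scl X" using assms(2) by (rule is_vs_vector_space)
  have "linear_map U X (\<lambda>x. \<Sum>(v, w)\<leftarrow>ps. f x v w)" if "set ps \<subseteq> car V \<times> car W" for ps
    using that
  proof (induction ps)
    case Nil
    then show ?case by (simp add: linear_map_def is_vs_mem[OF assms(2)])
  next
    case (Cons p ps)
    then show ?case
      using assms(4)[of "fst p" "snd p"] is_vs_mem(2)[OF assms(2)]
      by (cases p) (auto simp: linear_map_def X.scale_right_distrib algebra_simps)
  qed
  then show ?thesis using trep(1)[OF assms(1,3)] by (simp add: tlift_trep)
qed

lemma bilinear_mapI:
  "(\<And>v. v \<in> car V \<Longrightarrow> linear_map W X (f v)) \<Longrightarrow> (\<And>w. w \<in> car W \<Longrightarrow> linear_map V X (\<lambda>v. f v w)) \<Longrightarrow>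
    bilinear_map V W X f"
  by (simp add: bilinear_map_def)

lemma bilinear_mapD:
  "bilinear_map V W X f \<Longrightarrow> v \<in> car V \<Longrightarrow> linear_map W X (f v)"
  "bilinear_map V W X f \<Longrightarrow> w \<in> car W \<Longrightarrow> linear_map V X (\<lambda>v. f v w)"
  by (simp_all add: bilinear_map_def)

lemma linear_mapD:
  "linear_map V W f \<Longrightarrow> v \<in> car V \<Longrightarrow> f v \<in> car W"
  "linear_map V W f \<Longrightarrow> v \<in> car V \<Longrightarrow> v' \<in> car V \<Longrightarrow> f (v + v') = f v + f v'"
  "linear_map V W f \<Longrightarrow> v \<in> car V \<Longrightarrow> f (scl V c v) = scl W c (f v)"
  by (simp_all add: linear_map_def)

lemma bilinear_map_codomain:
  assumes "bilinear_map V W (full (scl X)) f" "\<And>v w. v \<in> car V \<Longrightarrow> w \<in> car W \<Longrightarrow> f v w \<in> car X"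
  shows "bilinear_map V W X f"
  using assms by (simp add: bilinear_map_def linear_map_def)

lemma linear_map_add:
  assumes "is_vs W" "linear_map V W f" "linear_map V W g"
  shows "linear_map V W (\<lambda>v. f v + g v)"
proof -
  interpret W: vector_space "scl W" using assms(1) by (rule is_vs_vector_space)
  show ?thesis using assms is_vs_mem(2)[OF assms(1)] by (simp add: linear_map_def W.scale_right_distrib algebra_simps)
qed

lemma linear_map_sum_fun:
  assumes "is_vs W" "\<And>i. i \<in> I \<Longrightarrow> linear_map V W (f i)"
  shows "linear_map V W (\<lambda>v. \<Sum>i\<in>I. f i v)"
proof -
  interpret W: vector_space "scl W" using assms(1) by (rule is_vs_vector_space)
  have "linear_map V W (\<lambda>v. 0)" by (simp add: linear_map_def is_vs_mem[OF assms(1)])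
  then show ?thesis using assms(2)
    by (induction I rule: infinite_finite_induct) (simp_all add: linear_map_add[OF assms(1)])
qed

lemma linear_map_tens:
  assumes "is_vs V" "is_vs W"
  shows "linear_map U V f \<Longrightarrow> w \<in> car W \<Longrightarrow> linear_map U (V \<otimes> W) (\<lambda>u. tens V W (f u) w)"
    "linear_map U W g \<Longrightarrow> v \<in> car V \<Longrightarrow> linear_map U (V \<otimes> W) (\<lambda>u. tens V W v (g u))"
  using bilinear_tens[OF assms] by (auto simp: bilinear_map_def linear_map_def)

lemma is_vs_dsum [simp]:
  assumes "is_vs V" "is_vs W"
  shows "is_vs (dsum V W)"
proof -
  interpret V: vector_space "scl V" using assms(1) by (rule is_vs_vector_space)
  interpret W: vector_space "scl W" using assms(2) by (rule is_vs_vector_space)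
  have "vector_space (scl (dsum V W))"
    by unfold_locales (simp_all add: dsum_def V.scale_right_distrib W.scale_right_distrib
        V.scale_left_distrib W.scale_left_distrib)
  moreover have "module.subspace (scl (dsum V W)) (car (dsum V W))"
    using is_vs_mem[OF assms(1)] is_vs_mem[OF assms(2)] calculation
    by (auto simp: module.subspace_def module_iff_vector_space dsum_def zero_prod_def)
  ultimately show ?thesis by (simp add: is_vs_def)
qed

lemma linear_map_scale:
  assumes "is_vs W" "linear_map V W f"
  shows "linear_map V W (\<lambda>v. scl W c (f v))"
proof -
  interpret W: vector_space "scl W" using assms(1) by (rule is_vs_vector_space)
  show ?thesis using assms is_vs_mem(3)[OF assms(1)]
    by (simp add: linear_map_def W.scale_right_distrib W.scale_left_commute)
qed

lemma bilinear_scale: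
  assumes "is_vs V" "linear_map \<Gamma> ground \<xi>"
  shows "bilinear_map V \<Gamma> V (\<lambda>v \<gamma>. scl V (\<xi> \<gamma>) v)" "bilinear_map \<Gamma> V V (\<lambda>\<gamma> v. scl V (\<xi> \<gamma>) v)"
proof -
  interpret V: vector_space "scl V" using assms(1) by (rule is_vs_vector_space)
  show "bilinear_map V \<Gamma> V (\<lambda>v \<gamma>. scl V (\<xi> \<gamma>) v)" "bilinear_map \<Gamma> V V (\<lambda>\<gamma> v. scl V (\<xi> \<gamma>) v)"
    using assms(2) is_vs_mem(3)[OF assms(1)]
    by (auto simp: bilinear_map_def linear_map_def ground_def V.scale_right_distrib V.scale_left_distrib mult.commute)
qed

lemma tens_sum:
  "tens V W (\<Sum>i\<in>I. v i) w = (\<Sum>i\<in>I. tens V W (v i) w)"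
  "tens V W v' (\<Sum>i\<in>I. w' i) = (\<Sum>i\<in>I. tens V W v' (w' i))"
  by (induction I rule: infinite_finite_induct) (simp_all add: tens_simps)

text \<open>
  The factor with a finite basis is \<open>T\<close> in one application and \<open>\<Gamma>\<close> in the others.
\<close>

lemma tens_expand:
  assumes W: "is_vs W" and X: "is_vs X" and \<xi>: "\<And>j. j \<in> I \<Longrightarrow> linear_map W ground (\<xi> j)"
    and w: "\<And>j. j \<in> I \<Longrightarrow> w j \<in> car W"
    and expand: "\<And>v. v \<in> car W \<Longrightarrow> v = (\<Sum>j\<in>I. scl W (\<xi> j v) (w j))"
  shows "t \<in> car (W \<otimes> X) \<Longrightarrow> t = (\<Sum>j\<in>I. tens W X (w j) (tlift W X (\<lambda>v a. scl X (\<xi> j v) a) t))"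
    and "u \<in> car (X \<otimes> W) \<Longrightarrow> u = (\<Sum>j\<in>I. tens X W (tlift X W (\<lambda>a v. scl X (\<xi> j v) a) u) (w j))"
proof -
  note bil = bilinear_scale[OF X \<xi>]
  note lift1 = tlift_universal[OF W X X bil(2)] and lift2 = tlift_universal[OF X W X bil(1)]
  have eq: "tens W X v a = (\<Sum>j\<in>I. tens W X (w j) (scl X (\<xi> j v) a))"
    "tens X W a v = (\<Sum>j\<in>I. tens X W (scl X (\<xi> j v) a) (w j))" if "v \<in> car W" for v a
    using arg_cong[OF expand[OF that], of "\<lambda>z. tens W X z a"] arg_cong[OF expand[OF that], of "tens X W a"]
    by (simp_all only: tens_sum tens_simps)
  have "linear_map (W \<otimes> X) (W \<otimes> X) (\<lambda>t. \<Sum>j\<in>I. tens W X (w j) (tlift W X (\<lambda>v a. scl X (\<xi> j v) a) t))"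
    by (intro linear_map_sum_fun linear_map_tens lift1 w W X) simp_all
  from linear_ext_tens[OF W X linear_map_ident this]
  show "t = (\<Sum>j\<in>I. tens W X (w j) (tlift W X (\<lambda>v a. scl X (\<xi> j v) a) t))" if "t \<in> car (W \<otimes> X)"
    using that by (auto simp: lift1(2) intro!: trans[OF eq(1)])
  have "linear_map (X \<otimes> W) (X \<otimes> W) (\<lambda>u. \<Sum>j\<in>I. tens X W (tlift X W (\<lambda>a v. scl X (\<xi> j v) a) u) (w j))"
    by (intro linear_map_sum_fun linear_map_tens lift2 w W X) simp_all
  from linear_ext_tens[OF X W linear_map_ident this]
  show "u = (\<Sum>j\<in>I. tens X W (tlift X W (\<lambda>a v. scl X (\<xi> j v) a) u) (w j))" if "u \<in> car (X \<otimes> W)"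
    using that by (auto simp: lift2(2) intro!: trans[OF eq(2)])
qed

lemma linear_map_weaken: "linear_map V W f \<Longrightarrow> scl W = t \<Longrightarrow> linear_map V (full t) f"
  by (simp add: linear_map_def)

lemma linear_map_cong:
  assumes "linear_map V W f" "is_vs V" "\<And>v. v \<in> car V \<Longrightarrow> g v = f v"
  shows "linear_map V W g"
  using assms(1,3) is_vs_mem[OF assms(2)] by (simp add: linear_map_def)

section \<open>Sweedler calculus in a Hopf algebra\<close>

text \<open>
  The elements \<open>sw2 H h f\<close> are the Sweedler sums of \<open>f(h1, h2)\<close>; nested sums are iterated
  coproducts.
\<close>

locale hopf_sweedler =
  fixes H :: "('k::field, 'h::{ring, monoid_mult}) hopf"
  assumes hopf: "hopf_algebra H"
begin

abbreviation "sH \<equiv> hscale H"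
abbreviation "\<epsilon> \<equiv> counit H"
abbreviation "S \<equiv> antipode H"

lemmas hopfD = hopf[unfolded hopf_algebra_def Let_def]

lemma vs_H [simp]: "vector_space sH"
  using hopfD by (simp add: k_algebra_def)

lemma H_mult_scale: "sH c (a * b) = sH c a * b" "sH c (a * b) = a * sH c b"
  using hopfD unfolding k_algebra_def by blast+

lemma lin_comult: "linear_map (full sH) (full sH \<otimes> full sH) (comult H)"
  and lin_antipode: "lin sH sH S"
  and lin_counit: "lin sH (*) \<epsilon>"
  using hopfD unfolding ground_def by blast+

lemma comult_mem [simp]: "comult H h \<in> car (full sH \<otimes> full sH)"
  using lin_comult by (simp add: linear_map_def)

lemma lin_H [simp]:
  "lin s sH f \<Longrightarrow> lin s sH (\<lambda>x. f x * b)"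
  "lin s sH f \<Longrightarrow> lin s sH (\<lambda>x. b * f x)"
  "lin s sH f \<Longrightarrow> lin s sH (\<lambda>x. S (f x))"
  by (auto simp: lin_iff distrib_left distrib_right H_mult_scale[symmetric]
      lin_add[OF lin_antipode] lin_scale[OF lin_antipode])

lemma lin_counit_scale [simp]:
  assumes "vector_space t"
  shows "lin s sH f \<Longrightarrow> lin s t (\<lambda>x. t (\<epsilon> (f x)) b)"
    "lin s t g \<Longrightarrow> lin s t (\<lambda>x. t c (g x))"
proof -
  interpret vector_space t by fact
  show "lin s sH f \<Longrightarrow> lin s t (\<lambda>x. t (\<epsilon> (f x)) b)"
    "lin s t g \<Longrightarrow> lin s t (\<lambda>x. t c (g x))"
    using lin_counit by (auto simp: lin_iff scale_left_distrib scale_right_distrib mult.commute)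
qed

lemma lin_sw2 [simp]:
  assumes "vector_space t"
  shows "(\<And>a b. lin s t (\<lambda>x. f x a b)) \<Longrightarrow>
      lin s t (\<lambda>x. sw2 H h (\<lambda>a b. f x a b))"
    "lin s sH g \<Longrightarrow> (\<And>b. lin sH t (\<lambda>a. f' a b)) \<Longrightarrow>
      (\<And>a. lin sH t (\<lambda>b. f' a b)) \<Longrightarrow>
      lin s t (\<lambda>x. sw2 H (g x) f')"
  unfolding sw2_def using assms
  by (auto intro!: lin_tlift lin_tlift_arg[OF lin_comult])

lemma lin_comult_tens: 
  assumes "\<And>b. lin sH t (\<lambda>a. f a b)" "\<And>a. lin sH t (\<lambda>b. f a b)"
    "vector_space t"
  shows "linear_map (full sH \<otimes> full sH) (full t) (tlift (full sH) (full sH) f)"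
  by (rule tlift_universal(1)) (use assms bilinear_full[OF assms(1,2)] in simp_all)

lemma sw2_swap: "sw2 H h (\<lambda>a b. sw2 H h' (\<lambda>c d. f a b c d)) = sw2 H h' (\<lambda>c d. sw2 H h (\<lambda>a b. f a b c d))"
  unfolding sw2_def by (rule tlift_swap)

lemma sw2_push: "(\<And>x y. F (x + y) = F x + F y) \<Longrightarrow> F (sw2 H h f) = sw2 H h (\<lambda>a b. F (f a b))"
  unfolding sw2_def by (rule tlift_additive)

lemma coassoc:
  fixes f :: "'h \<Rightarrow> 'h \<Rightarrow> 'h \<Rightarrow> 'c::ab_group_add"
  assumes t: "vector_space t"
    and f: "\<And>b c. lin sH t (\<lambda>a. f a b c)"
      "\<And>a c. lin sH t (\<lambda>b. f a b c)"
      "\<And>a b. lin sH t (\<lambda>c. f a b c)"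
  shows "sw2 H h (\<lambda>a c. sw2 H a (\<lambda>x y. f x y c)) = sw2 H h (\<lambda>x b. sw2 H b (\<lambda>y z. f x y z))"
proof -
  obtain F where F: "linear_map ((full sH \<otimes> full sH) \<otimes> full sH) (full t) F"
    "\<And>a b c. F (tens (full sH \<otimes> full sH) (full sH) (tens (full sH) (full sH) a b) c) = f a b c"
    using trilinear_lift[OF vs_H vs_H vs_H t f] by blast
  let ?t3 = "\<lambda>a b c. tens (full sH \<otimes> full sH) (full sH) (tens (full sH) (full sH) a b) c"
  have "sw2 H h (\<lambda>a c. sw2 H a (\<lambda>x y. ?t3 x y c)) = sw2 H h (\<lambda>x b. sw2 H b (\<lambda>y z. ?t3 x y z))"
    using hopfD by blast
  from arg_cong[of _ _ F, OF this] show ?thesis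
    unfolding sw2_def by (simp add: linear_tlift_tlift[OF F(1)] F(2))
qed

lemma sw2_lin: "lin s t g \<Longrightarrow> g (sw2 H h f) = sw2 H h (\<lambda>a b. g (f a b))"
  by (rule sw2_push) (rule lin_add)

lemma counit_left: "lin sH t g \<Longrightarrow> sw2 H h (\<lambda>a b. t (\<epsilon> a) (g b)) = g h"
  and counit_right: "lin sH t g \<Longrightarrow> sw2 H h (\<lambda>a b. t (\<epsilon> b) (g a)) = g h"
  and antipode_left: "lin sH t g \<Longrightarrow> sw2 H h (\<lambda>a b. g (S a * b)) = t (\<epsilon> h) (g 1)"
  and antipode_right: "lin sH t g \<Longrightarrow> sw2 H h (\<lambda>a b. g (a * S b)) = t (\<epsilon> h) (g 1)"
proof -
  have ax: "sw2 H h (\<lambda>h1 h2. sH (\<epsilon> h1) h2) = h" "sw2 H h (\<lambda>h1 h2. sH (\<epsilon> h2) h1) = h"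
    "sw2 H h (\<lambda>h1 h2. S h1 * h2) = sH (\<epsilon> h) 1" "sw2 H h (\<lambda>h1 h2. h1 * S h2) = sH (\<epsilon> h) 1"
    using hopfD by blast+
  assume g: "lin sH t g"
  note gs = lin_scale[OF g]
  show "sw2 H h (\<lambda>a b. t (\<epsilon> a) (g b)) = g h" "sw2 H h (\<lambda>a b. t (\<epsilon> b) (g a)) = g h"
    "sw2 H h (\<lambda>a b. g (S a * b)) = t (\<epsilon> h) (g 1)" "sw2 H h (\<lambda>a b. g (a * S b)) = t (\<epsilon> h) (g 1)"
    by (simp_all only: gs[symmetric] sw2_lin[OF g, symmetric] ax)
qed

lemma sw2_mult:
  fixes f :: "'h \<Rightarrow> 'h \<Rightarrow> 'c::ab_group_add"
  assumes "vector_space t" "\<And>b. lin sH t (\<lambda>a. f a b)"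
    "\<And>a. lin sH t (\<lambda>b. f a b)"
  shows "sw2 H (h * h') f = sw2 H h (\<lambda>a b. sw2 H h' (\<lambda>a' b'. f (a * a') (b * b')))"
proof -
  let ?V = "full sH"
  note F = lin_comult_tens[OF assms(2,3,1)]
  have 1: "tlift ?V ?V f (sw2 H h' (\<lambda>u v. tens ?V ?V (p u v) (q u v))) = sw2 H h' (\<lambda>u v. f (p u v) (q u v))" for h' p q
    unfolding sw2_def by (subst linear_tlift[OF _ _ _ F]) (simp_all add: tlift_tens_full[OF _ _ assms])
  have 2: "sw2 H h' (\<lambda>u v. tens ?V ?V (p u v) (q u v)) \<in> car (?V \<otimes> ?V)" for h' p q
    unfolding sw2_def by (rule tlift_mem) simp_all
  have "comult H (h * h') = sw2 H h (\<lambda>a b. sw2 H h' (\<lambda>a' b'. tens ?V ?V (a * a') (b * b')))"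
    using hopfD by blast
  moreover have "tlift ?V ?V f (sw2 H h (\<lambda>a b. sw2 H h' (\<lambda>a' b'. tens ?V ?V (a * a') (b * b')))) =
     sw2 H h (\<lambda>a b. sw2 H h' (\<lambda>a' b'. f (a * a') (b * b')))"
    unfolding sw2_def[of H h]
    by (subst linear_tlift[OF _ _ _ F]) (simp_all add: 1 2)
  ultimately show ?thesis unfolding sw2_def[of H "h * h'"] by simp
qed

lemma sw2_one:
  assumes "vector_space t" "\<And>b. lin sH t (\<lambda>a. f a b)"
    "\<And>a. lin sH t (\<lambda>b. f a b)"
  shows "sw2 H 1 f = f 1 1"
proof -
  have "comult H 1 = tens (full sH) (full sH) 1 1" using hopfD by blast
  then show ?thesis unfolding sw2_def by (simp add: tlift_tens_full[OF _ _ assms])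
qed

lemma counit_one: "\<epsilon> 1 = 1" and counit_mult: "\<epsilon> (a * b) = \<epsilon> a * \<epsilon> b"
  using hopfD by blast+

text \<open>
  The coproduct of the tensor coalgebra \<open>H \<otimes> H\<close>. Identities that involve two elements of \<open>H\<close>, such as the cocycle
  condition, are convolution identities over this coalgebra.
\<close>

definition sw22 where
  "sw22 h h' f = sw2 H h (\<lambda>a b. sw2 H h' (\<lambda>a' b'. f a a' b b'))"

lemma sw22_push: "(\<And>x y. F (x + y) = F x + F y) \<Longrightarrow> F (sw22 h h' f) = sw22 h h' (\<lambda>a a' b b'. F (f a a' b b'))"
  unfolding sw22_def by (simp add: sw2_push)

lemma coassoc22:
  fixes f :: "'h \<Rightarrow> 'h \<Rightarrow> 'h \<Rightarrow> 'h \<Rightarrow> 'h \<Rightarrow> 'h \<Rightarrow> 'c::ab_group_add"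
  assumes t: "vector_space t"
    and [simp]: "\<And>a' b b' c c'. lin sH t (\<lambda>a. f a a' b b' c c')"
      "\<And>a b b' c c'. lin sH t (\<lambda>a'. f a a' b b' c c')"
      "\<And>a a' b' c c'. lin sH t (\<lambda>b. f a a' b b' c c')"
      "\<And>a a' b c c'. lin sH t (\<lambda>b'. f a a' b b' c c')"
      "\<And>a a' b b' c'. lin sH t (\<lambda>c. f a a' b b' c c')"
      "\<And>a a' b b' c. lin sH t (\<lambda>c'. f a a' b b' c c')"
  shows "sw22 h h' (\<lambda>q q' c c'. sw22 q q' (\<lambda>a a' b b'. f a a' b b' c c')) =
    sw22 h h' (\<lambda>a a' q q'. sw22 q q' (\<lambda>b b' c c'. f a a' b b' c c'))"
proof -
  have "sw22 h h' (\<lambda>q q' c c'. sw22 q q' (\<lambda>a a' b b'. f a a' b b' c c')) =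
    sw2 H h (\<lambda>q c. sw2 H q (\<lambda>a b. sw2 H h' (\<lambda>q' c'. sw2 H q' (\<lambda>a' b'. f a a' b b' c c'))))"
    unfolding sw22_def by (subst sw2_swap) (rule refl)
  also have "... = sw2 H h (\<lambda>q c. sw2 H q (\<lambda>a b. sw2 H h' (\<lambda>a' q'. sw2 H q' (\<lambda>b' c'. f a a' b b' c c'))))"
    by (subst coassoc[OF t]) simp_all
  also have "... = sw2 H h (\<lambda>a q. sw2 H q (\<lambda>b c. sw2 H h' (\<lambda>a' q'. sw2 H q' (\<lambda>b' c'. f a a' b b' c c'))))"
    by (subst coassoc[OF t]) (simp_all add: t)
  also have "... = sw22 h h' (\<lambda>a a' q q'. sw22 q q' (\<lambda>b b' c c'. f a a' b b' c c'))"
    unfolding sw22_def by (subst (2) sw2_swap) (rule refl)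
  finally show ?thesis .
qed

lemma lin_sw22 [simp]:
  assumes "vector_space t"
  shows "(\<And>a a' b b'. lin s t (\<lambda>x. f x a a' b b')) \<Longrightarrow>
      lin s t (\<lambda>x. sw22 h h' (\<lambda>a a' b b'. f x a a' b b'))"
    "lin s sH g \<Longrightarrow> (\<And>a' b b'. lin sH t (\<lambda>a. f' a a' b b')) \<Longrightarrow>
      (\<And>a a' b'. lin sH t (\<lambda>b. f' a a' b b')) \<Longrightarrow>
      lin s t (\<lambda>x. sw22 (g x) h' f')"
    "lin s sH g \<Longrightarrow> (\<And>a b b'. lin sH t (\<lambda>a'. f' a a' b b')) \<Longrightarrow>
      (\<And>a a' b. lin sH t (\<lambda>b'. f' a a' b b')) \<Longrightarrow>
      lin s t (\<lambda>x. sw22 h (g x) f')"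
  unfolding sw22_def using assms by simp_all

lemma sw22_mult:
  assumes "vector_space t" "\<And>b. lin sH t (\<lambda>a. f a b)"
    "\<And>a. lin sH t (\<lambda>b. f a b)"
  shows "sw2 H (h * h') f = sw22 h h' (\<lambda>a a' b b'. f (a * a') (b * b'))"
  unfolding sw22_def by (rule sw2_mult[OF assms])

lemma counit22_right:
  assumes t: "vector_space t" and f: "\<And>a'. lin sH t (\<lambda>a. f a a')"
    "\<And>a. lin sH t (\<lambda>a'. f a a')"
  shows "sw22 h h' (\<lambda>a a' b b'. t (\<epsilon> b * \<epsilon> b') (f a a')) = f h h'"
proof -
  interpret vs: vector_space t by fact
  have "sw2 H h' (\<lambda>a' b'. t (\<epsilon> b * \<epsilon> b') (f a a')) = t (\<epsilon> b) (f a h')" for a b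
    using counit_right[of t "\<lambda>a'. t (\<epsilon> b) (f a a')" h'] f t by (simp add: mult.commute)
  then show ?thesis unfolding sw22_def using counit_right[where t = t, OF f(1)] by simp
qed

text \<open>
  The fourfold coproduct, bracketed as \<open>1,(2,3),4\<close>: with this bracketing the two middle factors are themselves
  a coproduct, which is where the cocycle condition gets applied.
\<close>

definition sw4 where
  "sw4 h f = sw2 H h (\<lambda>x r. sw2 H r (\<lambda>u c. sw2 H u (\<lambda>y b. f x y b c)))"

lemma sw4_sw2: "sw4 h (\<lambda>x y b c. sw2 H z (\<lambda>p q. f x y b c p q)) = sw2 H z (\<lambda>p q. sw4 h (\<lambda>x y b c. f x y b c p q))"
  unfolding sw4_def by (simp only: sw2_swap[where h' = z])

lemma coassoc_left4:
  assumes t: "vector_space t"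
    and [simp]: "\<And>b c d. lin sH t (\<lambda>a. f a b c d)"
      "\<And>a c d. lin sH t (\<lambda>b. f a b c d)"
      "\<And>a b d. lin sH t (\<lambda>c. f a b c d)"
      "\<And>a b c. lin sH t (\<lambda>d. f a b c d)"
  shows "sw2 H h (\<lambda>a r. sw2 H r (\<lambda>b c. sw2 H a (\<lambda>x y. f x y b c))) = sw4 h f"
proof -
  have "sw2 H h (\<lambda>a r. sw2 H r (\<lambda>b c. sw2 H a (\<lambda>x y. f x y b c))) =
      sw2 H h (\<lambda>a r. sw2 H a (\<lambda>x y. sw2 H r (\<lambda>b c. f x y b c)))"
    by (subst (2) sw2_swap) (rule refl)
  also have "... = sw2 H h (\<lambda>x r. sw2 H r (\<lambda>y s. sw2 H s (\<lambda>b c. f x y b c)))"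
    by (rule coassoc[OF t]) (simp_all add: t)
  also have "... = sw4 h f"
    unfolding sw4_def by (simp add: coassoc[OF t] t)
  finally show ?thesis .
qed

lemma coassoc_right4:
  assumes t: "vector_space t"
    and [simp]: "\<And>b c d. lin sH t (\<lambda>a. f a b c d)"
      "\<And>a c d. lin sH t (\<lambda>b. f a b c d)"
      "\<And>a b d. lin sH t (\<lambda>c. f a b c d)"
      "\<And>a b c. lin sH t (\<lambda>d. f a b c d)"
  shows "sw2 H h (\<lambda>a r. sw2 H r (\<lambda>b c. sw2 H c (\<lambda>x y. f a b x y))) = sw4 h f"
  unfolding sw4_def by (simp add: coassoc[OF t] t)

text \<open>
  Two independent fourfold coproducts are one fourfold coproduct in \<open>H \<otimes> H\<close>; only the order of summation changes.
\<close>

lemma sw4_sw4: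
  fixes f :: "'h \<Rightarrow> 'h \<Rightarrow> 'h \<Rightarrow> 'h \<Rightarrow> 'h \<Rightarrow> 'h \<Rightarrow> 'h \<Rightarrow> 'h \<Rightarrow> 'c::ab_group_add"
  shows "sw4 h' (\<lambda>a' b' c' d'. sw4 h (\<lambda>a b c d. f a a' b b' c c' d d')) =
   sw22 h h' (\<lambda>a a' r r'. sw22 r r' (\<lambda>u u' d d'. sw22 u u' (\<lambda>b b' c c'. f a a' b b' c c' d d')))"
proof -
  have mid: "sw2 H r' (\<lambda>u' d'. sw2 H u' (\<lambda>b' c'. sw2 H r (\<lambda>u d. sw2 H u (\<lambda>b c. g b b' c c' d d')))) =
     sw22 r r' (\<lambda>u u' d d'. sw22 u u' (\<lambda>b b' c c'. g b b' c c' d d'))" for r r' and g :: "_ \<Rightarrow> _ \<Rightarrow> _ \<Rightarrow> _ \<Rightarrow> _ \<Rightarrow> _ \<Rightarrow> 'c"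
  proof -
    have "sw2 H u' (\<lambda>b' c'. sw2 H u (\<lambda>b c. g b b' c c' d d')) = sw22 u u' (\<lambda>b b' c c'. g b b' c c' d d')" for u u' d d'
      unfolding sw22_def by (rule sw2_swap)
    then show ?thesis unfolding sw22_def[of r r'] by (simp only: sw2_swap[where h' = r])
  qed
  have "sw4 h' (\<lambda>a' b' c' d'. sw4 h (\<lambda>a b c d. f a a' b b' c c' d d')) =
    sw2 H h (\<lambda>a r. sw2 H h' (\<lambda>a' r'. sw2 H r' (\<lambda>u' d'. sw2 H u' (\<lambda>b' c'. sw2 H r (\<lambda>u d. sw2 H u (\<lambda>b c. f a a' b b' c c' d d'))))))"
    unfolding sw4_def by (simp only: sw2_swap[where h' = h])
  then show ?thesis by (simp only: mid sw22_def[of h h'])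
qed

section \<open>The antipode\<close>

lemma antipode_one: "S 1 = 1"
proof -
  interpret vs: vector_space sH by simp
  have "sw2 H 1 (\<lambda>a b. S a * b) = S 1 * 1"
    by (rule sw2_one[OF vs_H]) simp_all
  then show ?thesis using antipode_left[OF lin_id, of 1] counit_one by simp
qed

text \<open>
  Both sides are convolution inverses of the multiplication \<open>H \<otimes> H \<rightarrow> H\<close>: the left side is a left inverse (\<open>L\<close>), the right side a right inverse
  (\<open>R\<close>).
\<close>

lemma antipode_mult: "S (h * h') = S h' * S h"
proof -
  interpret vs: vector_space sH by simp
  have scale_push: "sH c (sw2 H h f) = sw2 H h (\<lambda>a b. sH c (f a b))" for c h and f :: "_ \<Rightarrow> _ \<Rightarrow> 'h"
    by (rule sw2_push) (rule vs.scale_right_distrib)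
  have m1: "z * sw22 h h' f = sw22 h h' (\<lambda>a a' b b'. z * f a a' b b')" for z :: 'h and h h' f
    by (rule sw22_push) (rule distrib_left)
  have m2: "sw22 h h' f * z = sw22 h h' (\<lambda>a a' b b'. f a a' b b' * z)" for z :: 'h and h h' f
    by (rule sw22_push[of "\<lambda>x. x * z"]) (rule distrib_right)
  have R: "sw22 h h' (\<lambda>b b' c c'. b * b' * S c' * S c) = sH (\<epsilon> h * \<epsilon> h') 1" for h h'
  proof -
    have "sw2 H h' (\<lambda>b' c'. b * b' * S c' * S c) = sH (\<epsilon> h') (b * S c)" for b c
      using antipode_right[of sH "\<lambda>x. b * x * S c" h'] by (simp add: mult.assoc)
    then have "sw22 h h' (\<lambda>b b' c c'. b * b' * S c' * S c) = sH (\<epsilon> h') (sw2 H h (\<lambda>b c. b * S c))"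
      unfolding sw22_def by (simp add: scale_push)
    then show ?thesis using antipode_right[OF lin_id, of h] by (simp add: mult.commute)
  qed
  have L: "sw22 h h' (\<lambda>a a' b b'. S (a * a') * (b * b')) = sH (\<epsilon> h * \<epsilon> h') 1" for h h'
  proof -
    have "sw2 H (h * h') (\<lambda>a b. S a * b) = sw22 h h' (\<lambda>a a' b b'. S (a * a') * (b * b'))"
      unfolding sw22_def by (rule sw2_mult[OF vs_H]) simp_all
    then show ?thesis using antipode_left[OF lin_id, of "h * h'"] by (simp add: counit_mult)
  qed
  \<comment> \<open>The convolution product of the left inverse, the multiplication and the right inverse is bracketed in both ways.\<close>
  have "S (h * h') = sw22 h h' (\<lambda>a a' q q'. sH (\<epsilon> q) (sH (\<epsilon> q') (S (a * a'))))"
    unfolding sw22_def by (simp add: counit_right[where t = sH] scale_push[symmetric] del: vs.scale_scale)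
  also have "... = sw22 h h' (\<lambda>a a' q q'. sw22 q q' (\<lambda>b b' c c'. S (a * a') * (b * b' * S c' * S c)))"
    by (simp add: m1[symmetric] R H_mult_scale[symmetric])
  also have "... = sw22 h h' (\<lambda>q q' c c'. sw22 q q' (\<lambda>a a' b b'. S (a * a') * (b * b' * S c' * S c)))"
    by (rule coassoc22[symmetric, OF vs_H]) simp_all
  also have "... = sw22 h h' (\<lambda>q q' c c'. sH (\<epsilon> q) (sH (\<epsilon> q') (S c' * S c)))"
    by (simp add: mult.assoc[symmetric] m2[symmetric])
       (simp add: mult.assoc L H_mult_scale[symmetric])
  also have "... = S h' * S h"
    unfolding sw22_def by (simp add: counit_left[where t = sH] scale_push[symmetric] del: vs.scale_scale)
  finally show ?thesis .
qed

text \<open>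
  The identity \<open>S(h1)\<^sub>1 h2 \<otimes> S(h1)\<^sub>2 = 1 \<otimes> S(h)\<close>, a weak form of the fact that \<open>S\<close> reverses
  coproducts. It is obtained by inserting \<open>h3 S(h4)\<close> in the second factor, which completes \<open>S(h1)\<^sub>i h2\<close> to the
  coproduct of \<open>S(h1) h2\<close>.
\<close>

lemma comult_antipode_cancel:
  fixes f :: "'h \<Rightarrow> 'h \<Rightarrow> 'c::ab_group_add"
  assumes t: "vector_space t"
    and f: "\<And>b. lin sH t (\<lambda>a. f a b)" "\<And>a. lin sH t (\<lambda>b. f a b)"
  shows "sw2 H h (\<lambda>a b. sw2 H (S a) (\<lambda>p q. f (p * b) q)) = f 1 (S h)"
proof -
  note f' [simp] = f[THEN lin_comp] t
  interpret vs: vector_space t by fact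
  have scale_push: "t c (sw2 H h f) = sw2 H h (\<lambda>a b. t c (f a b))" for c h and f :: "_ \<Rightarrow> _ \<Rightarrow> 'c"
    by (rule sw2_push) (rule vs.scale_right_distrib)
  have "sw2 H h (\<lambda>a b. sw2 H (S a) (\<lambda>p q. f (p * b) q)) =
     sw2 H h (\<lambda>a b. sw2 H b (\<lambda>b c. t (\<epsilon> c) (sw2 H (S a) (\<lambda>p q. f (p * b) q))))"
    by (simp add: counit_right[where t = t])
  also have "... = sw2 H h (\<lambda>a b. sw2 H b (\<lambda>b c. sw2 H c (\<lambda>c d. sw2 H (S a) (\<lambda>p q. f (p * b) (q * (c * S d))))))"
  proof -
    have "sw2 H c (\<lambda>c d. sw2 H (S a) (\<lambda>p q. f (p * b) (q * (c * S d)))) = 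
      t (\<epsilon> c) (sw2 H (S a) (\<lambda>p q. f (p * b) q))" for a b c
      using antipode_right[of t "\<lambda>x. sw2 H (S a) (\<lambda>p q. f (p * b) (q * x))" c] by simp
    then show ?thesis by simp
  qed
  also have "... = sw2 H h (\<lambda>a b. sw2 H b (\<lambda>e d. sw2 H e (\<lambda>b c. sw2 H (S a) (\<lambda>p q. f (p * b) (q * (c * S d))))))"
    by (subst coassoc[OF t]) simp_all
  also have "... = sw2 H h (\<lambda>g d. sw2 H g (\<lambda>a e. sw2 H e (\<lambda>b c. sw2 H (S a) (\<lambda>p q. f (p * b) (q * (c * S d))))))"
    by (subst coassoc[OF t]) simp_all
  also have "... = sw2 H h (\<lambda>g d. sw2 H g (\<lambda>a e. sw2 H (S a * e) (\<lambda>p q. f p (q * S d))))"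
    by (simp add: sw2_mult[OF t] mult.assoc sw2_swap[of "S _"])
  also have "... = sw2 H h (\<lambda>g d. t (\<epsilon> g) (f 1 (S d)))"
  proof -
    have "sw2 H g (\<lambda>a e. sw2 H (S a * e) (\<lambda>p q. f p (q * S d))) = t (\<epsilon> g) (f 1 (S d))" for g d
      using antipode_left[of t "\<lambda>x. sw2 H x (\<lambda>p q. f p (q * S d))" g] by (simp add: sw2_one[OF t])
    then show ?thesis by simp
  qed
  also have "... = f 1 (S h)"
    by (rule counit_left[where t = t]) simp
  finally show ?thesis .
qed

text \<open>
  The inverse of \<open>S\<close> is an antipode for the opposite multiplication: applying \<open>S\<close> reduces both equations to the axioms for \<open>S\<close>.
\<close>

lemma inv_antipode:
  assumes "bij S"
  shows "sw2 H h (\<lambda>a b. inv S b * a) = sH (\<epsilon> h) 1" "sw2 H h (\<lambda>a b. b * inv S a) = sH (\<epsilon> h) 1"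
proof -
  have [simp]: "S (inv S x) = x" for x using assms by (simp add: bij_is_surj surj_f_inv_f)
  have "S (sw2 H h (\<lambda>a b. inv S b * a)) = sw2 H h (\<lambda>a b. S a * b)"
    by (subst sw2_push[of S]) (simp_all add: lin_add[OF lin_antipode] antipode_mult)
  also have "... = S (sH (\<epsilon> h) 1)"
    using antipode_left[OF lin_id] by (simp add: lin_scale[OF lin_antipode] antipode_one)
  finally show "sw2 H h (\<lambda>a b. inv S b * a) = sH (\<epsilon> h) 1" using assms by (simp add: bij_is_inj inj_eq)
  have "S (sw2 H h (\<lambda>a b. b * inv S a)) = sw2 H h (\<lambda>a b. a * S b)"
    by (subst sw2_push[of S]) (simp_all add: lin_add[OF lin_antipode] antipode_mult)
  also have "... = S (sH (\<epsilon> h) 1)"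
    using antipode_right[OF lin_id] by (simp add: lin_scale[OF lin_antipode] antipode_one)
  finally show "sw2 H h (\<lambda>a b. b * inv S a) = sH (\<epsilon> h) 1" using assms by (simp add: bij_is_inj inj_eq)
qed

lemma lin_inv_antipode:
  assumes "bij S"
  shows "lin sH sH (inv S)"
proof -
  have [simp]: "S (inv S x) = x" for x using assms by (simp add: bij_is_surj surj_f_inv_f)
  have eq: "inv S z = w" if "S w = z" for z w using that assms by (simp add: bij_is_inj inv_f_eq)
  show ?thesis unfolding lin_iff
    by (intro conjI allI; rule eq) (simp_all add: lin_add[OF lin_antipode] lin_scale[OF lin_antipode])
qed

end

section \<open>Hopf modules with a left and a right coaction\<close>

text \<open>
  The left module structure and the two coactions that \<open>H\<close> and its space of forms have in common.
\<close>

locale covariant_module = hopf_sweedler H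
  for H :: "('k::field, 'h::{ring, monoid_mult}) hopf" +
  fixes sN :: "'k \<Rightarrow> 'n::ab_group_add \<Rightarrow> 'n"
    and la :: "'h \<Rightarrow> 'n \<Rightarrow> 'n"
    and lco :: "'n \<Rightarrow> ('k, 'h, 'n) tensor"
    and rco :: "'n \<Rightarrow> ('k, 'n, 'h) tensor"
  assumes vs_N [simp]: "vector_space sN"
    and bil_la: "bilinear_map (full sH) (full sN) (full sN) la"
    and la_one: "la 1 m = m"
    and la_mult: "la (a * b) m = la a (la b m)"
    and lco_comodule: "left_comodule H (full sN) lco"
    and rco_comodule: "right_comodule H (full sN) rco"
    and bicomodule:
      "tlift (full sN) (full sH) (\<lambda>m' b. tlift (full sH) (full sN) (\<lambda>a m0.
         tens (full sH \<otimes> full sN) (full sH) (tens (full sH) (full sN) a m0) b) (lco m')) (rco m) =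
       tlift (full sH) (full sN) (\<lambda>a m'. tlift (full sN) (full sH) (\<lambda>m0 b.
         tens (full sH \<otimes> full sN) (full sH) (tens (full sH) (full sN) a m0) b) (rco m')) (lco m)"
    and lco_la: "lco (la h m) =
      sw2 H h (\<lambda>h1 h2. tlift (full sH) (full sN) (\<lambda>a m0. tens (full sH) (full sN) (h1 * a) (la h2 m0)) (lco m))"
    and rco_la: "rco (la h m) =
      sw2 H h (\<lambda>h1 h2. tlift (full sN) (full sH) (\<lambda>m0 a. tens (full sN) (full sH) (la h1 m0) (h2 * a)) (rco m))"
begin

definition co where "co m f = tlift (full sH) (full sN) f (lco m)"
definition ro where "ro m f = tlift (full sN) (full sH) f (rco m)"

lemma lin_lco: "linear_map (full sN) (full sH \<otimes> full sN) lco"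
  using lco_comodule by (simp add: left_comodule_def Let_def)

lemma lin_rco: "linear_map (full sN) (full sN \<otimes> full sH) rco"
  using rco_comodule by (simp add: right_comodule_def Let_def)

lemma lco_mem [simp]: "lco m \<in> car (full sH \<otimes> full sN)" and rco_mem [simp]: "rco m \<in> car (full sN \<otimes> full sH)"
  using lin_lco lin_rco by (simp_all add: linear_map_def)

lemmas lin_la [simp] = lin_comp_bilinear[OF bil_la]

lemma lin_co [simp]:
  assumes "vector_space t"
  shows "(\<And>a b. lin s t (\<lambda>x. f x a b)) \<Longrightarrow>
      lin s t (\<lambda>x. co m (\<lambda>a b. f x a b))"
    "lin s sN g \<Longrightarrow> (\<And>b. lin sH t (\<lambda>a. f' a b)) \<Longrightarrow>
      (\<And>a. lin sN t (\<lambda>b. f' a b)) \<Longrightarrow>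
      lin s t (\<lambda>x. co (g x) f')"
  unfolding co_def using assms by (auto intro!: lin_tlift lin_tlift_arg[OF lin_lco])

lemma lin_ro [simp]:
  assumes "vector_space t"
  shows "(\<And>a b. lin s t (\<lambda>x. f x a b)) \<Longrightarrow>
      lin s t (\<lambda>x. ro m (\<lambda>a b. f x a b))"
    "lin s sN g \<Longrightarrow> (\<And>b. lin sN t (\<lambda>a. f' a b)) \<Longrightarrow>
      (\<And>a. lin sH t (\<lambda>b. f' a b)) \<Longrightarrow>
      lin s t (\<lambda>x. ro (g x) f')"
  unfolding ro_def using assms by (auto intro!: lin_tlift lin_tlift_arg[OF lin_rco])

lemma co_sw2_swap: "co m (\<lambda>c d. sw2 H h (\<lambda>a b. f a b c d)) = sw2 H h (\<lambda>a b. co m (\<lambda>c d. f a b c d))"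
  unfolding sw2_def co_def by (rule tlift_swap)

lemma ro_sw2_swap: "ro m (\<lambda>c d. sw2 H h (\<lambda>a b. f a b c d)) = sw2 H h (\<lambda>a b. ro m (\<lambda>c d. f a b c d))"
  unfolding sw2_def ro_def by (rule tlift_swap)

lemma co_push: "(\<And>x y. F (x + y) = F x + F y) \<Longrightarrow> F (co m f) = co m (\<lambda>a b. F (f a b))"
  unfolding co_def by (rule tlift_additive)

lemma ro_push: "(\<And>x y. F (x + y) = F x + F y) \<Longrightarrow> F (ro m f) = ro m (\<lambda>a b. F (f a b))"
  unfolding ro_def by (rule tlift_additive)

lemma co_coassoc:
  assumes t: "vector_space t"
    and f: "\<And>b c. lin sH t (\<lambda>a. f a b c)"
      "\<And>a c. lin sH t (\<lambda>b. f a b c)"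
      "\<And>a b. lin sN t (\<lambda>c. f a b c)"
  shows "co m (\<lambda>a m'. co m' (\<lambda>b m0. f a b m0)) = co m (\<lambda>c m0. sw2 H c (\<lambda>a b. f a b m0))"
proof -
  obtain F where F: "linear_map ((full sH \<otimes> full sH) \<otimes> full sN) (full t) F"
    "\<And>a b c. F (tens (full sH \<otimes> full sH) (full sN) (tens (full sH) (full sH) a b) c) = f a b c"
    using trilinear_lift[OF vs_H vs_H vs_N t f] by blast
  let ?t3 = "\<lambda>a b c. tens (full sH \<otimes> full sH) (full sN) (tens (full sH) (full sH) a b) c"
  have "co m (\<lambda>a m'. co m' (\<lambda>b m0. ?t3 a b m0)) = co m (\<lambda>c m0. sw2 H c (\<lambda>a b. ?t3 a b m0))"
    using lco_comodule by (simp add: left_comodule_def Let_def co_def)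
  from arg_cong[of _ _ F, OF this] show ?thesis
    unfolding sw2_def co_def by (simp add: linear_tlift_tlift[OF F(1)] F(2))
qed

lemma ro_coassoc:
  assumes t: "vector_space t"
    and f: "\<And>b c. lin sN t (\<lambda>a. f a b c)"
      "\<And>a c. lin sH t (\<lambda>b. f a b c)"
      "\<And>a b. lin sH t (\<lambda>c. f a b c)"
  shows "ro m (\<lambda>m' c. ro m' (\<lambda>a b. f a b c)) = ro m (\<lambda>a h. sw2 H h (\<lambda>b c. f a b c))"
proof -
  obtain F where F: "linear_map ((full sN \<otimes> full sH) \<otimes> full sH) (full t) F"
    "\<And>a b c. F (tens (full sN \<otimes> full sH) (full sH) (tens (full sN) (full sH) a b) c) = f a b c"
    using trilinear_lift[OF vs_N vs_H vs_H t f] by blast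
  let ?t3 = "\<lambda>a b c. tens (full sN \<otimes> full sH) (full sH) (tens (full sN) (full sH) a b) c"
  have "ro m (\<lambda>m' c. ro m' (\<lambda>a b. ?t3 a b c)) = ro m (\<lambda>a h. sw2 H h (\<lambda>b c. ?t3 a b c))"
    using rco_comodule by (simp add: right_comodule_def Let_def ro_def)
  from arg_cong[of _ _ F, OF this] show ?thesis
    unfolding sw2_def ro_def by (simp add: linear_tlift_tlift[OF F(1)] F(2))
qed

text \<open>
  The two coactions commute, \<open>\<gamma>\<^sub>0\<^sub>,\<^sub>-\<^sub>1 \<otimes> \<gamma>\<^sub>0\<^sub>,\<^sub>0 \<otimes> \<gamma>\<^sub>1 = \<gamma>\<^sub>-\<^sub>1 \<otimes> \<gamma>\<^sub>0\<^sub>,\<^sub>0 \<otimes> \<gamma>\<^sub>0\<^sub>,\<^sub>1\<close>.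
\<close>

lemma ro_co_swap:
  assumes t: "vector_space t"
    and f: "\<And>b c. lin sH t (\<lambda>a. f a b c)"
      "\<And>a c. lin sN t (\<lambda>b. f a b c)"
      "\<And>a b. lin sH t (\<lambda>c. f a b c)"
  shows "ro m (\<lambda>m' b. co m' (\<lambda>a m0. f a m0 b)) = co m (\<lambda>a m'. ro m' (\<lambda>m0 b. f a m0 b))"
proof -
  obtain F where F: "linear_map ((full sH \<otimes> full sN) \<otimes> full sH) (full t) F"
    "\<And>a b c. F (tens (full sH \<otimes> full sN) (full sH) (tens (full sH) (full sN) a b) c) = f a b c"
    using trilinear_lift[OF vs_H vs_N vs_H t f] by blast
  from arg_cong[of _ _ F, OF bicomodule] show ?thesis
    unfolding co_def ro_def by (simp add: linear_tlift_tlift[OF F(1)] F(2))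
qed

lemma co_counit:
  assumes "lin sN t g"
  shows "co m (\<lambda>a b. t (\<epsilon> a) (g b)) = g m"
proof -
  have "g (co m (\<lambda>a b. sN (\<epsilon> a) b)) = co m (\<lambda>a b. g (sN (\<epsilon> a) b))"
    by (rule co_push) (rule lin_add[OF assms])
  moreover have "co m (\<lambda>a b. sN (\<epsilon> a) b) = m"
    using lco_comodule by (simp add: left_comodule_def Let_def co_def)
  ultimately show ?thesis by (simp add: lin_scale[OF assms])
qed

lemma ro_counit:
  assumes "lin sN t g"
  shows "ro m (\<lambda>b a. t (\<epsilon> a) (g b)) = g m"
proof -
  have "g (ro m (\<lambda>b a. sN (\<epsilon> a) b)) = ro m (\<lambda>b a. g (sN (\<epsilon> a) b))"
    by (rule ro_push) (rule lin_add[OF assms])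
  moreover have "ro m (\<lambda>b a. sN (\<epsilon> a) b) = m"
    using rco_comodule by (simp add: right_comodule_def Let_def ro_def)
  ultimately show ?thesis by (simp add: lin_scale[OF assms])
qed

lemma co_la:
  assumes "vector_space t" "\<And>b. lin sH t (\<lambda>a. f a b)"
    "\<And>a. lin sN t (\<lambda>b. f a b)"
  shows "co (la h m) f = sw2 H h (\<lambda>h1 h2. co m (\<lambda>a m0. f (h1 * a) (la h2 m0)))"
proof -
  have F: "linear_map (full sH \<otimes> full sN) (full t) (tlift (full sH) (full sN) f)"
    by (rule tlift_universal(1)) (use assms bilinear_full[OF assms(2,3)] in simp_all)
  show ?thesis unfolding co_def lco_la sw2_def
    by (subst linear_tlift_tlift[OF F]) (simp_all add: tlift_tens_full[OF _ _ assms])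
qed

lemma ro_la:
  assumes "vector_space t" "\<And>b. lin sN t (\<lambda>a. f a b)"
    "\<And>a. lin sH t (\<lambda>b. f a b)"
  shows "ro (la h m) f = sw2 H h (\<lambda>h1 h2. ro m (\<lambda>m0 a. f (la h1 m0) (h2 * a)))"
proof -
  have F: "linear_map (full sN \<otimes> full sH) (full t) (tlift (full sN) (full sH) f)"
    by (rule tlift_universal(1)) (use assms bilinear_full[OF assms(2,3)] in simp_all)
  show ?thesis unfolding ro_def rco_la sw2_def
    by (subst linear_tlift_tlift[OF F]) (simp_all add: tlift_tens_full[OF _ _ assms])
qed

lemma co_tens: "co m (tens (full sH) (full sN)) = lco m"
  using tlift_unique[of "full sH" "full sN" "full sH \<otimes> full sN" "tens (full sH) (full sN)" "\<lambda>x. x" "lco m"]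
  by (simp add: co_def bilinear_tens linear_map_def)

lemma ro_tens: "ro m (tens (full sN) (full sH)) = rco m"
  using tlift_unique[of "full sN" "full sH" "full sN \<otimes> full sH" "tens (full sN) (full sH)" "\<lambda>x. x" "rco m"]
  by (simp add: ro_def bilinear_tens linear_map_def)

definition coinv where "coinv = {m. lco m = tens (full sH) (full sN) 1 m}"

text \<open>
  The map \<open>m \<mapsto> S(m\<^sub>-\<^sub>1) m\<^sub>0\<close>. It is the identity on coinvariants and has coinvariant values, so it is a projection
  onto them.
\<close>

definition proj where "proj m = co m (\<lambda>a m0. la (S a) m0)"

lemma lin_proj [simp]: "lin s sN f \<Longrightarrow> lin s sN (\<lambda>x. proj (f x))"
  unfolding proj_def by simp

lemma co_coinv:
  assumes "m \<in> coinv" "vector_space t" "\<And>b. lin sH t (\<lambda>a. f a b)"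
    "\<And>a. lin sN t (\<lambda>b. f a b)"
  shows "co m f = f 1 m"
  using assms(1) by (simp add: co_def coinv_def tlift_tens_full[OF _ _ assms(2-)])

lemma proj_coinv: "m \<in> coinv \<Longrightarrow> proj m = m"
  by (simp add: proj_def co_coinv[OF _ vs_N] antipode_one la_one)

lemma proj_mem: "proj m \<in> coinv"
proof -
  let ?t = "tens (full sH) (full sN)"
  have "lco (proj m) = co (proj m) ?t" by (simp add: co_tens)
  also have "... = co m (\<lambda>a m0. co (la (S a) m0) ?t)"
  proof -
    have "lin sN tscale (\<lambda>m. co m ?t)"
      by simp
    from lin_add[OF this] show ?thesis unfolding proj_def by (rule co_push)
  qed
  also have "... = co m (\<lambda>a m'. co m' (\<lambda>b m0. sw2 H (S a) (\<lambda>p q. ?t (p * b) (la q m0))))"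
    by (simp add: co_la[OF vector_space_tscale] co_sw2_swap)
  also have "... = co m (\<lambda>c m0. sw2 H c (\<lambda>a b. sw2 H (S a) (\<lambda>p q. ?t (p * b) (la q m0))))"
    by (rule co_coassoc[OF vector_space_tscale]) simp_all
  also have "... = co m (\<lambda>c m0. ?t 1 (la (S c) m0))"
    by (subst comult_antipode_cancel[OF vector_space_tscale]) simp_all
  also have "... = ?t 1 (proj m)"
    unfolding proj_def by (rule co_push[symmetric]) (rule tens_simps)
  finally show ?thesis by (simp add: coinv_def)
qed

text \<open>
  The decomposition \<open>m = m\<^sub>-\<^sub>1 P(m\<^sub>0)\<close> that underlies the fundamental theorem of Hopf modules.
\<close>

lemma hopf_module_decomposition: "co m (\<lambda>a m0. la a (proj m0)) = m"
proof -
  have "co m (\<lambda>a m0. la a (proj m0)) = co m (\<lambda>a m'. co m' (\<lambda>b m0. la (a * S b) m0))"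
  proof -
    have "la a (co m' (\<lambda>b m0. la (S b) m0)) = co m' (\<lambda>b m0. la (a * S b) m0)" for a m'
    proof -
      have "lin sN sN (la a)" by simp
      from lin_add[OF this] show ?thesis by (subst co_push[of "la a"]) (simp_all add: la_mult[symmetric])
    qed
    then show ?thesis by (simp add: proj_def)
  qed
  also have "... = co m (\<lambda>c m0. sw2 H c (\<lambda>a b. la (a * S b) m0))"
    by (rule co_coassoc[OF vs_N]) simp_all
  also have "... = co m (\<lambda>c m0. sN (\<epsilon> c) m0)"
  proof -
    have "sw2 H c (\<lambda>a b. la (a * S b) m0) = sN (\<epsilon> c) m0" for c m0
      using antipode_right[of sN "\<lambda>x. la x m0" c] by (simp add: la_one)
    then show ?thesis by simp
  qed
  also have "... = m" by (rule co_counit[OF lin_id])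
  finally show ?thesis .
qed

text \<open>
  For coinvariant \<open>m\<close> this is \<open>S(h1)h2 m = \<epsilon>(h) m\<close>; the general case follows since \<open>m\<close> is a sum of multiples of
  coinvariants, by the preceding lemma.
\<close>

lemma proj_la: "proj (la h m) = sN (\<epsilon> h) (proj m)"
proof -
  interpret vs: vector_space sN by simp
  have coinv: "proj (la h m) = sN (\<epsilon> h) m" if "m \<in> coinv" for h m
  proof -
    have "proj (la h m) = sw2 H h (\<lambda>h1 h2. la (S h1 * h2) m)"
      unfolding proj_def by (simp add: co_la[OF vs_N] co_coinv[OF that vs_N] la_mult)
    then show ?thesis using antipode_left[of sN "\<lambda>x. la x m" h] by (simp add: la_one)
  qed
  have add: "proj (la h (x + y)) = proj (la h x) + proj (la h y)" for h x y
  proof -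
    have "lin sN sN (\<lambda>x. proj (la h x))" by simp
    from lin_add[OF this] show ?thesis .
  qed
  have c1: "proj (la h m) = co m (\<lambda>a m0. sN (\<epsilon> h * \<epsilon> a) (proj m0))" for h
  proof -
    have "proj (la h m) = proj (la h (co m (\<lambda>a m0. la a (proj m0))))" by (simp add: hopf_module_decomposition)
    also have "... = co m (\<lambda>a m0. proj (la h (la a (proj m0))))"
      by (rule co_push) (rule add)
    finally show ?thesis by (simp add: la_mult[symmetric] coinv[OF proj_mem] counit_mult)
  qed
  have "co m (\<lambda>a m0. sN (\<epsilon> a) (proj m0)) = proj m"
    by (rule co_counit) simp
  moreover have "co m (\<lambda>a m0. sN (\<epsilon> h * \<epsilon> a) (proj m0)) = sN (\<epsilon> h) (co m (\<lambda>a m0. sN (\<epsilon> a) (proj m0)))"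
    by (subst co_push[of "sN (\<epsilon> h)"]) (simp_all add: vs.scale_right_distrib)
  ultimately show ?thesis using c1[of h] by simp
qed

text \<open>
  The right coaction restricts to the coinvariants: \<open>P \<otimes> id\<close> fixes \<open>m\<^sub>0 \<otimes> m\<^sub>1\<close>, because the two coactions commute and the
  left coaction of \<open>m\<close> is trivial.
\<close>

lemma rco_coinv:
  assumes "m \<in> coinv"
  shows "rco m \<in> car (\<lparr>scl = sN, car = coinv\<rparr> \<otimes> full sH)"
proof -
  let ?t = "tens (full sN) (full sH)"
  have "ro m (\<lambda>m' b. ?t (proj m') b) = ro m (\<lambda>m' b. co m' (\<lambda>a m0. ?t (la (S a) m0) b))"
  proof -
    have "?t (proj m') b = co m' (\<lambda>a m0. ?t (la (S a) m0) b)" for m' b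
      unfolding proj_def by (subst co_push[of "\<lambda>x. ?t x b"]) (simp_all add: tens_simps)
    then show ?thesis by simp
  qed
  also have "... = co m (\<lambda>a m'. ro m' (\<lambda>m0 b. ?t (la (S a) m0) b))"
    by (rule ro_co_swap[OF vector_space_tscale]) simp_all
  also have "... = ro m ?t"
    by (subst co_coinv[OF assms vector_space_tscale]) (simp_all add: antipode_one la_one)
  also have "... = rco m" by (rule ro_tens)
  finally have eq: "ro m (\<lambda>m' b. ?t (proj m') b) = rco m" .
  have "?t (proj m') b \<in> car (\<lparr>scl = sN, car = coinv\<rparr> \<otimes> full sH)" for m' b
    \<comment> \<open>Pure tensors depend only on the scalar multiplications, not on the chosen subspaces.\<close>
    by (subst tens_cong[of _ "\<lparr>scl = sN, car = coinv\<rparr>" _ "full sH"]) (auto simp: proj_mem)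
  then have "ro m (\<lambda>m' b. ?t (proj m') b) \<in> car (\<lparr>scl = sN, car = coinv\<rparr> \<otimes> full sH)"
    unfolding ro_def by (intro tlift_mem) simp_all
  then show ?thesis by (simp add: eq)
qed

end

section \<open>Twisted module algebras and twisted bimodules\<close>

locale twisted_algebra = hopf_sweedler H
  for H :: "('k::field, 'h::{ring, monoid_mult}) hopf" +
  fixes B :: "('k, 'h, 'b::{ring, monoid_mult}) twisted_alg"
  assumes tma: "twisted_module_algebra H B"
begin

abbreviation "sB \<equiv> bscale B"
abbreviation "\<sigma> \<equiv> sigma B"

lemmas tmaD = tma[unfolded twisted_module_algebra_def]

lemma vs_B [simp]: "vector_space sB"
  using tmaD by (simp add: k_algebra_def)

lemma B_mult_scale: "sB c (a * b) = sB c a * b" "sB c (a * b) = a * sB c b"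
proof -
  have "k_algebra sB" using tmaD by blast
  then show "sB c (a * b) = sB c a * b" "sB c (a * b) = a * sB c b"
    unfolding k_algebra_def by blast+
qed

lemma bil_B: "bilinear_map (full sB) (full sB) (full sB) (*)"
  by (rule bilinear_full) (simp_all add: lin_iff distrib_left distrib_right B_mult_scale[symmetric])

lemma bil_meas: "bilinear_map (full sH) (full sB) (full sB) (meas B)"
  and bil_sigma: "bilinear_map (full sH) (full sH) (full sB) \<sigma>"
  and bil_sigma_inv: "bilinear_map (full sH) (full sH) (full sB) (sigma_inv B)"
  using tmaD by blast+

lemmas lin_B [simp] = lin_comp_bilinear[OF bil_B] lin_comp_bilinear[OF bil_meas]
  lin_comp_bilinear[OF bil_sigma] lin_comp_bilinear[OF bil_sigma_inv]

lemma meas_one: "meas B h 1 = sB (\<epsilon> h) 1" and one_meas: "meas B 1 b = b"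
  and meas_mult: "meas B h (b * b') = sw2 H h (\<lambda>h1 h2. meas B h1 b * meas B h2 b')"
  and sigma_one: "\<sigma> h 1 = sB (\<epsilon> h) 1" "\<sigma> 1 h = sB (\<epsilon> h) 1"
  using tmaD by blast+

lemma sigma_inv_sigma: "sw22 h h' (\<lambda>a a' b b'. sigma_inv B a a' * \<sigma> b b') = sB (\<epsilon> h * \<epsilon> h') 1"
  using tmaD unfolding sw22_def by blast

lemma cocycle:
  "sw22 h h' (\<lambda>a a' b b'. sw2 H h'' (\<lambda>c d. meas B a (\<sigma> a' c) * \<sigma> b (b' * d))) =
   sw22 h h' (\<lambda>a a' b b'. \<sigma> a a' * \<sigma> (b * b') h'')"
  using tmaD unfolding sw22_def by blast

lemma meas_meas: "meas B h (meas B h' x) =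
    sw22 h h' (\<lambda>a a' r r'. sw22 r r' (\<lambda>b b' c c'. \<sigma> a a' * meas B (b * b') x * sigma_inv B c c'))"
proof -
  have "meas B h (meas B h' x) = sw3 H h (\<lambda>h1 h2 h3. sw3 H h' (\<lambda>h1' h2' h3'.
          \<sigma> h1 h1' * meas B (h2 * h2') x * sigma_inv B h3 h3'))"
    using tmaD by blast
  then show ?thesis unfolding sw3_def sw22_def by (subst (2) sw2_swap)
qed

text \<open>
  The twisted module identity with \<open>\<sigma>\<^sup>-\<^sup>1\<close> moved to the other side,
  \<open>(h1 \<cdot> (h'1 \<cdot> x)) \<sigma>(h2 \<otimes> h'2) = \<sigma>(h1 \<otimes> h'1) (h2h'2 \<cdot> x)\<close>. In this form it makes sense, and carries over,
  for bimodules.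
\<close>

lemma meas_meas_sigma:
  "sw22 h h' (\<lambda>a a' b b'. meas B a (meas B a' x) * \<sigma> b b') =
   sw22 h h' (\<lambda>a a' b b'. \<sigma> a a' * meas B (b * b') x)"
proof -
  have r: "sw22 h h' f * z = sw22 h h' (\<lambda>a a' b b'. f a a' b b' * z)" for z :: 'b and h h' f
    by (rule sw22_push[of "\<lambda>x. x * z"]) (rule distrib_right)
  have l: "z * sw22 h h' f = sw22 h h' (\<lambda>a a' b b'. z * f a a' b b')" for z :: 'b and h h' f
    by (rule sw22_push[of "\<lambda>x. z * x"]) (rule distrib_left)
  have "sw22 h h' (\<lambda>a a' b b'. meas B a (meas B a' x) * \<sigma> b b') =
    sw22 h h' (\<lambda>q q' d d'. sw22 q q' (\<lambda>a a' r r'. sw22 r r' (\<lambda>b b' c c'.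
      \<sigma> a a' * meas B (b * b') x * sigma_inv B c c' * \<sigma> d d')))"
    by (simp add: meas_meas r)
  also have "... = sw22 h h' (\<lambda>a a' q q'. sw22 q q' (\<lambda>r r' d d'. sw22 r r' (\<lambda>b b' c c'.
      \<sigma> a a' * meas B (b * b') x * sigma_inv B c c' * \<sigma> d d')))"
    by (rule coassoc22[OF vs_B]) simp_all
  also have "... = sw22 h h' (\<lambda>a a' q q'. sw22 q q' (\<lambda>b b' r r'. sw22 r r' (\<lambda>c c' d d'.
      \<sigma> a a' * meas B (b * b') x * sigma_inv B c c' * \<sigma> d d')))"
    by (subst coassoc22[OF vs_B]) simp_all
  also have "... = sw22 h h' (\<lambda>a a' q q'. sw22 q q' (\<lambda>b b' r r'. sB (\<epsilon> r * \<epsilon> r') (\<sigma> a a' * meas B (b * b') x)))"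
    by (simp add: mult.assoc l[symmetric] sigma_inv_sigma B_mult_scale(2)[symmetric])
  also have "... = sw22 h h' (\<lambda>a a' b b'. \<sigma> a a' * meas B (b * b') x)"
    by (simp add: counit22_right[OF vs_B])
  finally show ?thesis .
qed

end

text \<open>
  The structure that \<open>B\<close> and its space of forms have in common: a \<open>B\<close>-bimodule on which \<open>H\<close> acts, up to the
  cocycle \<open>\<sigma>\<close>, compatibly with the two actions of \<open>B\<close>.
\<close>

locale twisted_bimodule = twisted_algebra H B
  for H :: "('k::field, 'h::{ring, monoid_mult}) hopf"
    and B :: "('k, 'h, 'b::{ring, monoid_mult}) twisted_alg" +
  fixes sM :: "'k \<Rightarrow> 'm::ab_group_add \<Rightarrow> 'm"
    and lm :: "'b \<Rightarrow> 'm \<Rightarrow> 'm" and rm :: "'m \<Rightarrow> 'b \<Rightarrow> 'm" and hm :: "'h \<Rightarrow> 'm \<Rightarrow> 'm"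
  assumes vs_M [simp]: "vector_space sM"
    and bil_lm: "bilinear_map (full sB) (full sM) (full sM) lm"
    and bil_rm: "bilinear_map (full sM) (full sB) (full sM) rm"
    and bil_hm: "bilinear_map (full sH) (full sM) (full sM) hm"
    and lm_one: "lm 1 m = m" and rm_one: "rm m 1 = m"
    and lm_mult: "lm (a * b) m = lm a (lm b m)"
    and rm_mult: "rm m (a * b) = rm (rm m a) b"
    and rm_lm: "rm (lm a m) b = lm a (rm m b)"
    and hm_one: "hm 1 m = m"
    and hm_lm: "hm h (lm b m) = sw2 H h (\<lambda>x y. lm (meas B x b) (hm y m))"
    and hm_rm: "hm h (rm m b) = sw2 H h (\<lambda>x y. rm (hm x m) (meas B y b))"
    and hm_hm: "hopf_sweedler.sw22 H h h' (\<lambda>a a' b b'. rm (hm a (hm a' m)) (\<sigma> b b')) =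
       hopf_sweedler.sw22 H h h' (\<lambda>a a' b b'. lm (\<sigma> a a') (hm (b * b') m))"
begin

lemmas lin_M [simp] = lin_comp_bilinear[OF bil_lm] lin_comp_bilinear[OF bil_rm] lin_comp_bilinear[OF bil_hm]

end

lemma (in twisted_algebra) regular_bimodule:
  "twisted_bimodule H B sB (*) (*) (meas B)"
  by (intro twisted_bimodule.intro twisted_bimodule_axioms.intro twisted_algebra_axioms)
    (simp_all add: bil_B bil_meas mult.assoc one_meas meas_mult meas_meas_sigma)

text \<open>
  Forms \<open>b db'\<close> span, and on them \<open>h \<cdot> (b db') = (h1 \<cdot> b) d(h2 \<cdot> b')\<close>. For the right action one
  writes \<open>b (db') b'' = b d(b'b'') - bb' db''\<close>. For the twisted identity one uses that \<open>d\<close> commutes with multiplication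
  by \<open>\<sigma>\<close> on either side, as \<open>d\<sigma> = 0\<close>; so the identity for \<open>B\<close> can be applied under \<open>d\<close> to the second factor and then to the
  first.
\<close>

lemma (in twisted_algebra) fodc_bimodule:
  fixes E :: "('k, 'h, 'b, 'v::ab_group_add) twisted_fodc"
  assumes E: "twisted_module_fodc H B E"
  shows "twisted_bimodule H B (fscale E) (lact E) (ract E) (hact E)"
proof -
  note ED = E[unfolded twisted_module_fodc_def is_fodc_def]
  let ?s = "fscale E" let ?d = "diff E" let ?lm = "lact E" let ?rm = "ract E" let ?hm = "hact E"
  have vs [simp]: "vector_space ?s" using ED by blast
  interpret vs: vector_space ?s by simp
  have bl: "bilinear_map (full sB) (full ?s) (full ?s) ?lm"
    and br: "bilinear_map (full ?s) (full sB) (full ?s) ?rm"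
    and bh: "bilinear_map (full sH) (full ?s) (full ?s) ?hm"
    and ld: "lin sB ?s ?d" using ED by blast+
  note lin [simp] = lin_comp_bilinear[OF bl] lin_comp_bilinear[OF br] lin_comp_bilinear[OF bh] lin_comp[OF ld]
  have one: "?lm 1 m = m" "?rm m 1 = m" and lmult: "?lm (a * b) m = ?lm a (?lm b m)"
    and rmult: "?rm m (a * b) = ?rm (?rm m a) b" and rl: "?rm (?lm a m) b = ?lm a (?rm m b)"
    and leib: "?d (a * b) = ?rm (?d a) b + ?lm a (?d b)" for a b m using ED by blast+
  have dsigma: "?d (\<sigma> h h') = 0" for h h' using ED by blast
  have hd: "?hm h (?lm b (?d b')) = sw2 H h (\<lambda>x y. ?lm (meas B x b) (?d (meas B y b')))" for h b b'
    using ED by simp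
  have add: "?lm a (m + m') = ?lm a m + ?lm a m'" "?rm (m + m') a = ?rm m a + ?rm m' a"
    "?hm h (m + m') = ?hm h m + ?hm h m'" "?lm (a + a') m = ?lm a m + ?lm a' m"
    "?d (a + a') = ?d a + ?d a'" for a a' m m' h
    using bl br bh ld by (simp_all add: bilinear_map_def lin_iff)
  have zero: "?lm a 0 = 0" "?rm 0 a = 0" for a
    using add(1)[of a 0 0] add(2)[of 0 0 a] by simp_all
  have diff: "?lm a (m - m') = ?lm a m - ?lm a m'" "?hm h (m - m') = ?hm h m - ?hm h m'" for a m m' h
    using add(1)[of a "m - m'" m'] add(3)[of h "m - m'" m'] by (simp_all add: algebra_simps)
  note push = sw2_push[of "\<lambda>x. ?lm a x" for a] sw2_push[of "\<lambda>x. ?rm x a" for a] sw2_push[of "\<lambda>x. ?hm h x" for h]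
    sw2_push[of "\<lambda>x. ?lm x m" for m] sw2_push[of ?d]
  note push = push(1)[OF add(1)] push(2)[OF add(2)] push(3)[OF add(3)] push(4)[OF add(4)] push(5)[OF add(5)]
  note push22 = sw22_push[of "\<lambda>x. ?lm a x" for a] sw22_push[of "\<lambda>x. ?lm x m" for m] sw22_push[of ?d]
  note push22 = push22(1)[OF add(1)] push22(2)[OF add(4)] push22(3)[OF add(5)]
  have forms_eqI: "F m = G m" if "lin ?s ?s F" "lin ?s ?s G"
    "\<And>b b'. F (?lm b (?d b')) = G (?lm b (?d b'))" for F G m
  proof -
    have "F = G" by (rule lin_eq_on_span[OF vs that(1,2), of "{?lm a (?d b) |a b. True}"]) (use that ED in auto)
    then show ?thesis by simp
  qed
  have diff_sw2: "sw2 H h (\<lambda>a b. f a b - g a b) = sw2 H h f - sw2 H h g" for h and f g :: "_ \<Rightarrow> _ \<Rightarrow> 'v"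
    by (simp add: sw2_def tlift_trep sum_list_subtractf case_prod_unfold)
  show ?thesis
  proof (intro twisted_bimodule.intro twisted_bimodule_axioms.intro twisted_algebra_axioms)
    show "?hm 1 m = m" for m
      by (rule forms_eqI[of "\<lambda>m. ?hm 1 m" "\<lambda>m. m"]) (simp_all add: hd sw2_one[OF vs] one_meas)
    show "?hm h (?lm b m) = sw2 H h (\<lambda>x y. ?lm (meas B x b) (?hm y m))" for h b m
    proof (rule forms_eqI[of "\<lambda>m. ?hm h (?lm b m)" "\<lambda>m. sw2 H h (\<lambda>x y. ?lm (meas B x b) (?hm y m))"])
      fix b1 b2
      have "?hm h (?lm b (?lm b1 (?d b2))) = sw2 H h (\<lambda>x y. sw2 H x (\<lambda>u v. ?lm (meas B u b) (?lm (meas B v b1) (?d (meas B y b2)))))"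
        by (simp add: lmult[symmetric] hd meas_mult push)
      also have "... = sw2 H h (\<lambda>u r. sw2 H r (\<lambda>v y. ?lm (meas B u b) (?lm (meas B v b1) (?d (meas B y b2)))))"
        by (rule coassoc[OF vs]) simp_all
      finally show "?hm h (?lm b (?lm b1 (?d b2))) = sw2 H h (\<lambda>x y. ?lm (meas B x b) (?hm y (?lm b1 (?d b2))))"
        by (simp add: hd push)
    qed simp_all
    show "?hm h (?rm m b) = sw2 H h (\<lambda>x y. ?rm (?hm x m) (meas B y b))" for h b m
    proof (rule forms_eqI[of "\<lambda>m. ?hm h (?rm m b)" "\<lambda>m. sw2 H h (\<lambda>x y. ?rm (?hm x m) (meas B y b))"])
      fix b1 b2
      have "?hm h (?rm (?lm b1 (?d b2)) b) = ?hm h (?lm b1 (?d (b2 * b))) - ?hm h (?lm (b1 * b2) (?d b))"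
        by (simp add: rl leib diff(2)[symmetric] lmult diff(1)[symmetric])
      also have "?hm h (?lm (b1 * b2) (?d b)) =
          sw2 H h (\<lambda>x y. sw2 H x (\<lambda>u v. ?lm (meas B u b1) (?lm (meas B v b2) (?d (meas B y b)))))"
        unfolding hd by (simp add: meas_mult push lmult)
      also have "... = sw2 H h (\<lambda>u r. sw2 H r (\<lambda>v y. ?lm (meas B u b1) (?lm (meas B v b2) (?d (meas B y b)))))"
        by (rule coassoc[OF vs]) simp_all
      also have "?hm h (?lm b1 (?d (b2 * b))) - ... =
          sw2 H h (\<lambda>u r. sw2 H r (\<lambda>v y. ?lm (meas B u b1) (?rm (?d (meas B v b2)) (meas B y b))))"
        unfolding hd by (simp add: meas_mult push leib add(1) diff_sw2[symmetric])
      also have "... = sw2 H h (\<lambda>x y. sw2 H x (\<lambda>u v. ?lm (meas B u b1) (?rm (?d (meas B v b2)) (meas B y b))))"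
        by (rule coassoc[symmetric, OF vs]) simp_all
      finally show "?hm h (?rm (?lm b1 (?d b2)) b) = sw2 H h (\<lambda>x y. ?rm (?hm x (?lm b1 (?d b2))) (meas B y b))"
        by (simp add: hd push rl)
    qed simp_all
    show "sw22 h h' (\<lambda>a a' b b'. ?rm (?hm a (?hm a' m)) (\<sigma> b b')) =
       sw22 h h' (\<lambda>a a' b b'. ?lm (\<sigma> a a') (?hm (b * b') m))" for h h' m
    proof (rule forms_eqI[of "\<lambda>m. sw22 h h' (\<lambda>a a' b b'. ?rm (?hm a (?hm a' m)) (\<sigma> b b'))" "\<lambda>m. sw22 h h' (\<lambda>a a' b b'. ?lm (\<sigma> a a') (?hm (b * b') m))"])
      fix b b'
      let ?m = "?lm b (?d b')"
      have "?rm (?hm a (?hm a' ?m)) z = sw22 a a' (\<lambda>x x' y y'. ?lm (meas B x (meas B x' b)) (?rm (?d (meas B y (meas B y' b'))) z))" for a a' z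
        unfolding sw22_def by (subst sw2_swap) (simp add: hd push rl)
      then have "sw22 h h' (\<lambda>a a' b b'. ?rm (?hm a (?hm a' ?m)) (\<sigma> b b')) =
          sw22 h h' (\<lambda>a a' c c'. sw22 a a' (\<lambda>x x' y y'. ?lm (meas B x (meas B x' b)) (?rm (?d (meas B y (meas B y' b'))) (\<sigma> c c'))))"
        by simp
      also have "... = sw22 h h' (\<lambda>x x' q q'. sw22 q q' (\<lambda>y y' c c'. ?lm (meas B x (meas B x' b)) (?rm (?d (meas B y (meas B y' b'))) (\<sigma> c c'))))"
        by (rule coassoc22[OF vs]) simp_all
      also have "... = sw22 h h' (\<lambda>x x' q q'. ?lm (meas B x (meas B x' b)) (?d (sw22 q q' (\<lambda>y y' c c'. meas B y (meas B y' b') * \<sigma> c c'))))"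
        by (simp add: push22 leib dsigma zero)
      also have "... = sw22 h h' (\<lambda>x x' q q'. sw22 q q' (\<lambda>y y' c c'. ?lm (meas B x (meas B x' b) * \<sigma> y y') (?d (meas B (c * c') b'))))"
        by (simp add: meas_meas_sigma push22 leib dsigma zero lmult)
      also have "... = sw22 h h' (\<lambda>q q' c c'. sw22 q q' (\<lambda>x x' y y'. ?lm (meas B x (meas B x' b) * \<sigma> y y') (?d (meas B (c * c') b'))))"
        by (rule coassoc22[symmetric, OF vs]) simp_all
      also have "... = sw22 h h' (\<lambda>q q' c c'. sw22 q q' (\<lambda>x x' y y'. ?lm (\<sigma> x x' * meas B (y * y') b) (?d (meas B (c * c') b'))))"
        by (simp only: push22(2)[symmetric] meas_meas_sigma)
      also have "... = sw22 h h' (\<lambda>x x' q q'. sw22 q q' (\<lambda>y y' c c'. ?lm (\<sigma> x x' * meas B (y * y') b) (?d (meas B (c * c') b'))))"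
        by (rule coassoc22[OF vs]) simp_all
      also have "... = sw22 h h' (\<lambda>a a' b b'. ?lm (\<sigma> a a') (?hm (b * b') ?m))"
        by (simp add: hd sw22_mult[OF vs] push22 lmult)
      finally show "sw22 h h' (\<lambda>a a' b b'. ?rm (?hm a (?hm a' ?m)) (\<sigma> b b')) =
        sw22 h h' (\<lambda>a a' b b'. ?lm (\<sigma> a a') (?hm (b * b') ?m))" .
    qed simp_all
  qed (use one lmult rmult rl bl br bh in simp_all)
qed

section \<open>The crossed product action\<close>

text \<open>
  The space \<open>M \<otimes> N\<close> with the action of the crossed product. The cases \<open>(B, H)\<close>, \<open>(\<Omega>\<^sup>1(B), H)\<close> and
  \<open>(B, \<Omega>\<^sup>1(H))\<close> of \<open>(M, N)\<close> give the product of the crossed product and the two components of its calculus.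
\<close>

locale crossed_module =
  twisted_bimodule H B sM lm rm hm + covariant_module H sN la lco rco
  for H :: "('k::field, 'h::{ring, monoid_mult}) hopf"
    and B :: "('k, 'h, 'b::{ring, monoid_mult}) twisted_alg"
    and sM :: "'k \<Rightarrow> 'm::ab_group_add \<Rightarrow> 'm"
    and lm rm hm
    and sN :: "'k \<Rightarrow> 'n::ab_group_add \<Rightarrow> 'n"
    and la lco rco
begin

abbreviation "mn \<equiv> tens (full sM) (full sN)"
abbreviation "bh \<equiv> tens (full sB) (full sH)"

definition act where
  "act x t = tlift (full sB) (full sH) (\<lambda>b h. tlift (full sM) (full sN) (\<lambda>m g.
     sw3 H h (\<lambda>h1 h2 h3. co g (\<lambda>k g0. mn (rm (lm b (hm h1 m)) (\<sigma> h2 k)) (la h3 g0)))) t) x"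

text \<open>
  The value of \<open>act\<close> on pure tensors, as a function of its four arguments; unlike \<open>act\<close> it is
  multilinear on full types.
\<close>

definition act_pure where
  "act_pure b h m g = sw2 H h (\<lambda>h1 r. sw2 H r (\<lambda>h2 h3.
     co g (\<lambda>k g0. mn (rm (lm b (hm h1 m)) (\<sigma> h2 k)) (la h3 g0))))"

lemma lin_act_pure [simp]:
  "lin s sB f1 \<Longrightarrow> lin s tscale (\<lambda>x. act_pure (f1 x) h m g)"
  "lin s sH f2 \<Longrightarrow> lin s tscale (\<lambda>x. act_pure b (f2 x) m g)"
  "lin s sM f3 \<Longrightarrow> lin s tscale (\<lambda>x. act_pure b h (f3 x) g)"
  "lin s sN f4 \<Longrightarrow> lin s tscale (\<lambda>x. act_pure b h m (f4 x))"
  unfolding act_pure_def by simp_all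

lemma sw2_mem: "(\<And>a b. f a b \<in> car (V \<otimes> W)) \<Longrightarrow> sw2 H h f \<in> car (V \<otimes> W)"
  unfolding sw2_def by (rule tlift_mem) simp_all

lemma co_mem: "(\<And>a b. f a b \<in> car (V \<otimes> W)) \<Longrightarrow> co g f \<in> car (V \<otimes> W)"
  unfolding co_def by (rule tlift_mem) simp_all

lemma act_pure_mem [simp]: "act_pure b h m g \<in> car (full sM \<otimes> full sN)"
  unfolding act_pure_def by (intro sw2_mem co_mem) simp

lemma act_eq_pure: "act x t = tlift (full sB) (full sH) (\<lambda>b h. tlift (full sM) (full sN) (act_pure b h) t) x"
  by (simp add: act_def act_pure_def[abs_def] sw3_def)

lemma bilinear_act: "bilinear_map (full sB \<otimes> full sH) (full sM \<otimes> full sN) (full sM \<otimes> full sN) act"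
proof -
  let ?MN = "full sM \<otimes> full sN"
  have "bilinear_map (full sM) (full sN) ?MN (act_pure b h)" for b h
    by (rule bilinear_map_codomain[OF bilinear_full]) simp_all
  then have inner: "linear_map ?MN ?MN (tlift (full sM) (full sN) (act_pure b h))" for b h
    by (intro tlift_universal(1)) simp_all
  have "bilinear_map (full sB) (full sH) ?MN (\<lambda>b h. tlift (full sM) (full sN) (act_pure b h) t)" if "t \<in> car ?MN" for t
    by (rule bilinear_map_codomain[OF bilinear_full])
      (simp_all add: vector_space_tscale linear_mapD(1)[OF inner that, simplified])
  then have "linear_map (full sB \<otimes> full sH) ?MN (\<lambda>x. act x t)" if "t \<in> car ?MN" for t
    unfolding act_eq_pure using that by (intro tlift_universal(1)) simp_all
  moreover have "linear_map ?MN ?MN (act x)" if "x \<in> car (full sB \<otimes> full sH)" for x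
    unfolding act_eq_pure[abs_def] by (rule linear_map_tlift_param[OF _ _ that inner]) simp_all
  ultimately show ?thesis by (simp add: bilinear_map_def)
qed

lemma act_mem: "x \<in> car (full sB \<otimes> full sH) \<Longrightarrow> t \<in> car (full sM \<otimes> full sN) \<Longrightarrow> act x t \<in> car (full sM \<otimes> full sN)"
  using bilinear_act by (simp add: bilinear_map_def linear_map_def)

lemma act_tens: "act (bh b h) (mn m g) = act_pure b h m g"
proof -
  have "tlift (full sM) (full sN) (act_pure b h) (mn m g) = act_pure b h m g" for b h
    by (rule tlift_tens_full[where t = tscale]) simp_all
  moreover have "tlift (full sB) (full sH) (\<lambda>b h. tlift (full sM) (full sN) (act_pure b h) (mn m g)) (bh b h) = tlift (full sM) (full sN) (act_pure b h) (mn m g)"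
    by (rule tlift_tens_full[where t = tscale]) simp_all
  ultimately show ?thesis by (simp add: act_eq_pure)
qed

lemma act_pure_one: "act_pure 1 1 m g = mn m g"
proof -
  have "act_pure 1 1 m g = co g (\<lambda>k g0. mn (rm m (\<sigma> 1 k)) g0)"
    unfolding act_pure_def
    by (simp add: sw2_one[OF vector_space_tscale] vector_space_tscale lm_one hm_one la_one)
  also have "... = co g (\<lambda>k g0. tscale (\<epsilon> k) (mn m g0))"
    using lin_scale[OF lin_comp_bilinear(2)[OF bil_rm lin_id]] tens_simps(3)[of "full sM" "full sN"]
    by (simp add: sigma_one rm_one)
  also have "... = mn m g" by (rule co_counit) simp
  finally show ?thesis .
qed

lemma act_one:
  assumes "t \<in> car (full sM \<otimes> full sN)"
  shows "act (bh 1 1) t = t"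
proof (rule linear_ext_tens[OF _ _ _ linear_map_ident _ assms])
  show "linear_map (full sM \<otimes> full sN) (full sM \<otimes> full sN) (act (bh 1 1))"
    using bilinear_act by (simp add: bilinear_map_def)
qed (simp_all add: act_tens act_pure_one)

text \<open>
  First half of associativity: \<open>h\<close> acts on \<open>b'm \<otimes> g\<close> by \<open>(h1 \<cdot> b')\<close> times the action of \<open>h2\<close> on \<open>m \<otimes> g\<close>.
\<close>

lemma act_pure_lm: "act_pure b h (lm b' m) g = sw2 H h (\<lambda>w r. act_pure (b * meas B w b') r m g)"
proof -
  have push: "mn (rm (lm c (sw2 H h f)) y) z = sw2 H h (\<lambda>a b. mn (rm (lm c (f a b)) y) z)" for c h f y z
    by (rule sw2_lin[where g = "\<lambda>x. mn (rm (lm c x) y) z" and s = sM and t = tscale]) simp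
  have "act_pure b h (lm b' m) g = sw2 H h (\<lambda>h1 r. sw2 H r (\<lambda>h2 h3. sw2 H h1 (\<lambda>w v.
     co g (\<lambda>k g0. mn (rm (lm (b * meas B w b') (hm v m)) (\<sigma> h2 k)) (la h3 g0)))))"
    unfolding act_pure_def by (simp add: hm_lm push co_sw2_swap lm_mult)
  also have "... = sw2 H h (\<lambda>h1 r. sw2 H h1 (\<lambda>w v. sw2 H r (\<lambda>h2 h3.
     co g (\<lambda>k g0. mn (rm (lm (b * meas B w b') (hm v m)) (\<sigma> h2 k)) (la h3 g0)))))"
    by (subst (2) sw2_swap) (rule refl)
  also have "... = sw2 H h (\<lambda>w u. sw2 H u (\<lambda>v r. sw2 H r (\<lambda>h2 h3.
     co g (\<lambda>k g0. mn (rm (lm (b * meas B w b') (hm v m)) (\<sigma> h2 k)) (la h3 g0)))))"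
    by (rule coassoc[OF vector_space_tscale]) simp_all
  finally show ?thesis unfolding act_pure_def .
qed

lemma co_sw4: "co g (\<lambda>k g0. sw4 h (\<lambda>a b c d. f a b c d k g0)) = sw4 h (\<lambda>a b c d. co g (\<lambda>k g0. f a b c d k g0))"
  unfolding sw4_def by (simp only: co_sw2_swap)

lemma sw22_co: "sw22 h h' (\<lambda>a b c d. co g (\<lambda>k g0. f a b c d k g0)) = co g (\<lambda>k g0. sw22 h h' (\<lambda>a b c d. f a b c d k g0))"
  unfolding sw22_def by (simp only: co_sw2_swap)

text \<open>
  Second half of associativity: acting by \<open>h'\<close> and then by \<open>h\<close> is acting by
  \<open>\<sigma>(h1 \<otimes> h'1) \<otimes> h2h'2\<close>. The left side expands to
  \<open>(h1 \<cdot> (h'1 \<cdot> m)) (h2 \<cdot> \<sigma>(h'2 \<otimes> g\<^sub>-\<^sub>2)) \<sigma>(h3 \<otimes> h'3g\<^sub>-\<^sub>1) \<otimes> h4h'4g\<^sub>0\<close>. The cocycle condition on the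
  factors 2 and 3 gives \<open>(h1 \<cdot> (h'1 \<cdot> m)) \<sigma>(h2 \<otimes> h'2) \<sigma>(h3h'3 \<otimes> g\<^sub>-\<^sub>1) \<otimes> h4h'4g\<^sub>0\<close>, and the twisted
  module identity on the factors 1 and 2 gives the right side.
\<close>

lemma act_pure_twisted:
  "sw2 H h' (\<lambda>a' r'. sw2 H r' (\<lambda>b' c'. co g (\<lambda>k g0. act_pure z h (rm (hm a' m) (\<sigma> b' k)) (la c' g0)))) =
   sw22 h h' (\<lambda>a a' q q'. act_pure (z * \<sigma> a a') (q * q') m g)"
    (is "?L = _")
proof -
  note vt = vector_space_tscale
  let ?F = "\<lambda>x a' y b' b p' c q' k k' g00.
    mn (rm (lm z (hm x (hm a' m))) (meas B y (\<sigma> b' k) * \<sigma> b (p' * k'))) (la (c * q') g00)"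
  have exp: "act_pure z h (rm (hm a' m) (\<sigma> b' k)) (la c' g0) =
     sw4 h (\<lambda>x y b c. sw2 H c' (\<lambda>p' q'. co g0 (\<lambda>k' g00. ?F x a' y b' b p' c q' k k' g00)))" for a' b' c' k g0
  proof -
    have push: "mn (rm (lm z (sw2 H h f)) y) w = sw2 H h (\<lambda>a b. mn (rm (lm z (f a b)) y) w)" for h f y w
      by (rule sw2_lin[where g = "\<lambda>x. mn (rm (lm z x) y) w" and s = sM and t = tscale]) simp
    have "act_pure z h (rm (hm a' m) (\<sigma> b' k)) (la c' g0) =
      sw2 H h (\<lambda>a r. sw2 H r (\<lambda>b c. co (la c' g0) (\<lambda>k' g00. sw2 H a (\<lambda>x y.
        mn (rm (lm z (rm (hm x (hm a' m)) (meas B y (\<sigma> b' k)))) (\<sigma> b k')) (la c g00)))))"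
      unfolding act_pure_def by (simp add: hm_rm push)
    also have "... = sw2 H h (\<lambda>a r. sw2 H r (\<lambda>b c. sw2 H a (\<lambda>x y. sw2 H c' (\<lambda>p' q'. co g0 (\<lambda>k' g00.
        ?F x a' y b' b p' c q' k k' g00)))))"
      by (simp add: co_sw2_swap co_la[OF vt] la_mult rm_lm rm_mult)
    also have "... = sw4 h (\<lambda>x y b c. sw2 H c' (\<lambda>p' q'. co g0 (\<lambda>k' g00. ?F x a' y b' b p' c q' k k' g00)))"
      by (rule coassoc_left4[OF vt]) simp_all
    finally show ?thesis .
  qed
  have "?L = sw2 H h' (\<lambda>a' r'. sw2 H r' (\<lambda>b' c'. sw2 H c' (\<lambda>p' q'.
      co g (\<lambda>k g0. sw4 h (\<lambda>x y b c. co g0 (\<lambda>k' g00. ?F x a' y b' b p' c q' k k' g00))))))"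
    by (simp only: exp sw4_sw2 co_sw2_swap)
  also have "... = sw4 h' (\<lambda>a' b' p' q'. co g (\<lambda>k g0. sw4 h (\<lambda>x y b c. co g0 (\<lambda>k' g00. ?F x a' y b' b p' c q' k k' g00))))"
    by (rule coassoc_right4[OF vt]) (simp_all add: sw4_def)
  also have "... = sw4 h' (\<lambda>a' b' p' q'. sw4 h (\<lambda>x y b c. co g (\<lambda>k g0. sw2 H k (\<lambda>k k'. ?F x a' y b' b p' c q' k k' g0))))"
    by (simp add: co_sw4 co_coassoc[OF vt])
  also have "... = sw22 h h' (\<lambda>x a' r r'. sw22 r r' (\<lambda>u u' c q'. co g (\<lambda>k g0. sw22 u u' (\<lambda>y b' b p'.
      sw2 H k (\<lambda>k k'. ?F x a' y b' b p' c q' k k' g0)))))"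
    by (simp only: sw4_sw4 sw22_co)
  also have "... = sw22 h h' (\<lambda>x a' r r'. sw22 r r' (\<lambda>u u' c q'. co g (\<lambda>k g0. sw22 u u' (\<lambda>y b' b p'.
      mn (rm (lm z (hm x (hm a' m))) (\<sigma> y b' * \<sigma> (b * p') k)) (la (c * q') g0)))))"
  proof -
    have "sw22 u u' (\<lambda>y b' b p'. sw2 H k (\<lambda>k k'. mn (rm X (meas B y (\<sigma> b' k) * \<sigma> b (p' * k'))) Y)) =
      sw22 u u' (\<lambda>y b' b p'. mn (rm X (\<sigma> y b' * \<sigma> (b * p') k)) Y)" for u u' k X Y
    proof -
      have "lin sB tscale (\<lambda>v. mn (rm X v) Y)" by simp
      note F = lin_add[OF this]
      show ?thesis
        \<comment> \<open>The cocycle condition, under the linear map that fills in the other factors.\<close>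
        using arg_cong[OF cocycle[of u u' k], of "\<lambda>v. mn (rm X v) Y"]
        by (simp add: sw22_push[of "\<lambda>v. mn (rm X v) Y", OF F] sw2_push[of "\<lambda>v. mn (rm X v) Y", OF F])
    qed
    then show ?thesis by simp
  qed
  also have "... = sw22 h h' (\<lambda>x a' r r'. sw22 r r' (\<lambda>y b' w w'. sw22 w w' (\<lambda>b p' c q'. co g (\<lambda>k g0.
      mn (rm (lm z (hm x (hm a' m))) (\<sigma> y b' * \<sigma> (b * p') k)) (la (c * q') g0)))))"
    unfolding sw22_co[symmetric] by (simp add: coassoc22[OF vt])
  also have "... = sw22 h h' (\<lambda>v v' w w'. sw22 v v' (\<lambda>x a' y b'. sw22 w w' (\<lambda>b p' c q'. co g (\<lambda>k g0.
      mn (rm (lm z (rm (hm x (hm a' m)) (\<sigma> y b'))) (\<sigma> (b * p') k)) (la (c * q') g0)))))"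
    by (simp add: coassoc22[OF vt] rm_mult rm_lm)
  also have "... = sw22 h h' (\<lambda>v v' w w'. sw22 v v' (\<lambda>x a' y b'. sw22 w w' (\<lambda>b p' c q'. co g (\<lambda>k g0.
      mn (rm (lm z (lm (\<sigma> x a') (hm (y * b') m))) (\<sigma> (b * p') k)) (la (c * q') g0)))))"
  proof -
    have "sw22 v v' (\<lambda>x a' y b'. F (rm (hm x (hm a' m)) (\<sigma> y b'))) = sw22 v v' (\<lambda>x a' y b'. F (lm (\<sigma> x a') (hm (y * b') m)))"
      if "lin sM tscale F" for F :: "_ \<Rightarrow> ('k, 'm, 'n) tensor" and v v'
      \<comment> \<open>The twisted module identity, under a linear map \<open>F\<close> that fills in the other factors.\<close>
      using arg_cong[OF hm_hm[of v v' m], of F] by (simp add: sw22_push[OF lin_add[OF that]])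
    note this[of "\<lambda>X. sw22 w w' (\<lambda>b p' c q'. co g (\<lambda>k g0. mn (rm (lm z X) (\<sigma> (b * p') k)) (la (c * q') g0)))" for w w']
    then show ?thesis by simp
  qed
  also have "... = sw22 h h' (\<lambda>x a' q q'. sw22 q q' (\<lambda>y b' w w'. sw22 w w' (\<lambda>b p' c q'. co g (\<lambda>k g0.
      mn (rm (lm z (lm (\<sigma> x a') (hm (y * b') m))) (\<sigma> (b * p') k)) (la (c * q') g0)))))"
    by (rule coassoc22[OF vt]) simp_all
  also have "... = sw22 h h' (\<lambda>a a' q q'. act_pure (z * \<sigma> a a') (q * q') m g)"
    unfolding act_pure_def by (simp add: sw22_mult[OF vt] lm_mult)
  finally show ?thesis .
qed

lemma act_act_pure:
  "act (bh b h) (act_pure b' h' m g) = sw2 H h (\<lambda>h1 r. sw2 H r (\<lambda>h2 h3. sw2 H h' (\<lambda>k l.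
     act_pure (b * meas B h1 b' * \<sigma> h2 k) (h3 * l) m g)))"
proof -
  note vt = vector_space_tscale
  have lin: "linear_map (full sM \<otimes> full sN) (full sM \<otimes> full sN) (act (bh b h))"
    using bilinear_act by (simp add: bilinear_map_def)
  have "act (bh b h) (act_pure b' h' m g) = sw2 H h' (\<lambda>a' r'. sw2 H r' (\<lambda>b1 c'. co g (\<lambda>k g0.
      act_pure b h (lm b' (rm (hm a' m) (\<sigma> b1 k))) (la c' g0))))"
  proof -
    have "act (bh b h) (co g (\<lambda>k g0. mn (f k g0) (f' k g0))) = co g (\<lambda>k g0. act_pure b h (f k g0) (f' k g0))" for f f'
      unfolding co_def by (subst linear_tlift[OF _ _ _ lin]) (simp_all add: act_tens)
    moreover have "act (bh b h) (sw2 H l f) = sw2 H l (\<lambda>x y. act (bh b h) (f x y))"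
      if "\<And>x y. f x y \<in> car (full sM \<otimes> full sN)" for l f
      unfolding sw2_def by (subst linear_tlift[OF _ _ _ lin]) (simp_all add: that)
    ultimately show ?thesis unfolding act_pure_def[of b'] by (simp add: sw2_mem co_mem rm_lm)
  qed
  also have "... = sw2 H h (\<lambda>w r. sw2 H h' (\<lambda>a' r'. sw2 H r' (\<lambda>b1 c'. co g (\<lambda>k g0.
      act_pure (b * meas B w b') r (rm (hm a' m) (\<sigma> b1 k)) (la c' g0)))))"
    by (simp only: act_pure_lm co_sw2_swap sw2_swap[where h' = h])
  also have "... = sw2 H h (\<lambda>h1 r. sw2 H r (\<lambda>h2 h3. sw2 H h' (\<lambda>k l.
     act_pure (b * meas B h1 b' * \<sigma> h2 k) (h3 * l) m g)))"
    by (simp only: act_pure_twisted sw22_def)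
  finally show ?thesis .
qed

end

context twisted_algebra begin

lemma regular_covariant: "covariant_module H sH (*) (comult H) (comult H)"
proof -
  have 1: "\<And>h. sw2 H h (\<lambda>a h3. sw2 H a (\<lambda>h1 h2. tens (full sH \<otimes> full sH) (full sH) (tens (full sH) (full sH) h1 h2) h3)) =
           sw2 H h (\<lambda>h1 b. sw2 H b (\<lambda>h2 h3. tens (full sH \<otimes> full sH) (full sH) (tens (full sH) (full sH) h1 h2) h3))"
    by (rule coassoc[OF vector_space_tscale]) simp_all
  have 2: "sw2 H h (\<lambda>h1 h2. sH (\<epsilon> h1) h2) = h" "sw2 H h (\<lambda>h1 h2. sH (\<epsilon> h2) h1) = h" for h
    by (rule counit_left[where t = sH, OF lin_id], rule counit_right[where t = sH, OF lin_id])
  have 3: "comult H (h * h') = sw2 H h (\<lambda>a b. sw2 H h' (\<lambda>a' b'. tens (full sH) (full sH) (a * a') (b * b')))" for h h'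
    using hopfD by blast
  show ?thesis
    by (intro covariant_module.intro covariant_module_axioms.intro hopf_sweedler_axioms)
     (use lin_comult 1 2 3 in \<open>simp_all add: mult.assoc left_comodule_def right_comodule_def Let_def sw2_def
       bilinear_full[of sH sH "(*)" sH]\<close>)
qed

lemma regular_crossed: "crossed_module H B sB (*) (*) (meas B) sH (*) (comult H) (comult H)"
  by (intro crossed_module.intro regular_bimodule regular_covariant)

lemma cp_mult_eq: "cp_mult H B = crossed_module.act H B sB (*) (*) (meas B) sH (*) (comult H)"
proof -
  interpret crossed_module H B sB "(*)" "(*)" "meas B" sH "(*)" "comult H" "comult H"
    by (rule regular_crossed)
  show ?thesis
    by (intro ext) (simp add: cp_mult_def act_def co_def sw2_def)
qed

lemma bilinear_cp_mult: "bilinear_map (cp_space H B) (cp_space H B) (cp_space H B) (cp_mult H B)"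
  unfolding cp_mult_eq by (rule crossed_module.bilinear_act[OF regular_crossed])

lemma cp_mult_tens: "cp_mult H B (tens (full sB) (full sH) b h) (tens (full sB) (full sH) b' h') =
    sw2 H h (\<lambda>h1 r. sw2 H r (\<lambda>h2 h3. sw2 H h' (\<lambda>k l.
      tens (full sB) (full sH) (b * meas B h1 b' * \<sigma> h2 k) (h3 * l))))"
proof -
  interpret crossed_module H B sB "(*)" "(*)" "meas B" sH "(*)" "comult H" "comult H"
    by (rule regular_crossed)
  show ?thesis unfolding cp_mult_eq act_tens act_pure_def by (simp add: co_def sw2_def)
qed

text \<open>
  Two of the three factors of the coproduct collapse, by \<open>h \<cdot> 1 = \<epsilon>(h)1\<close> and \<open>\<sigma>(h \<otimes> 1) = \<epsilon>(h)1\<close>.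
\<close>

lemma cp_mult_one:
  assumes "x \<in> car (cp_space H B)"
  shows "cp_mult H B x (cp_one H B) = x"
proof (rule linear_ext_tens[OF _ _ _ linear_map_ident _ assms])
  interpret vB: vector_space sB by simp
  note vt = vector_space_tscale
  show "linear_map (cp_space H B) (cp_space H B) (\<lambda>x. cp_mult H B x (cp_one H B))"
    using bilinear_cp_mult by (simp add: bilinear_map_def cp_one_def)
  show "cp_mult H B (tens (full sB) (full sH) b h) (cp_one H B) = tens (full sB) (full sH) b h" for b h
  proof -
    have "cp_mult H B (tens (full sB) (full sH) b h) (cp_one H B) =
      sw2 H h (\<lambda>h1 r. sw2 H r (\<lambda>h2 h3. tscale (\<epsilon> h2) (tscale (\<epsilon> h1) (tens (full sB) (full sH) b h3))))"
      unfolding cp_one_def cp_mult_tens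
      by (simp add: sw2_one[OF vt])
        (simp add: meas_one sigma_one B_mult_scale[symmetric] tens_simps(3)[of "full sB", simplified])
    then show ?thesis by (simp add: counit_left[where t = tscale] del: tensor.scale_scale)
  qed
qed simp_all

end

context crossed_module begin

lemma act_assoc:
  assumes x: "x \<in> car (cp_space H B)" and y: "y \<in> car (cp_space H B)" and t: "t \<in> car (full sM \<otimes> full sN)"
  shows "act (cp_mult H B x y) t = act x (act y t)"
proof -
  let ?A = "full sB \<otimes> full sH" and ?MN = "full sM \<otimes> full sN"
  have A1: "linear_map ?A ?MN (\<lambda>x. act x t)" if "t \<in> car ?MN" for t
    using bilinear_act that by (simp add: bilinear_map_def)
  have A2: "linear_map ?MN ?MN (\<lambda>t. act x t)" if "x \<in> car ?A" for x
    using bilinear_act that by (simp add: bilinear_map_def)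
  have M1: "linear_map ?A ?A (\<lambda>x. cp_mult H B x y)" if "y \<in> car ?A" for y
    using bilinear_cp_mult that by (simp add: bilinear_map_def)
  have M2: "linear_map ?A ?A (\<lambda>y. cp_mult H B x y)" if "x \<in> car ?A" for x
    using bilinear_cp_mult that by (simp add: bilinear_map_def)
  have Mm: "cp_mult H B x y \<in> car ?A" if "x \<in> car ?A" "y \<in> car ?A" for x y
    using M1[OF that(2)] that by (simp add: linear_map_def)
  have pure: "act (cp_mult H B (bh b h) (bh b' h')) (mn m g) = act (bh b h) (act (bh b' h') (mn m g))" for b h b' h' m g
  proof -
    note lin = A1[of "mn m g", simplified]
    have "act (sw2 H l f) (mn m g) = sw2 H l (\<lambda>x y. act (f x y) (mn m g))"
      if "\<And>x y. f x y \<in> car ?A" for l f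
      unfolding sw2_def by (subst linear_tlift[OF _ _ _ lin]) (simp_all add: that)
    then show ?thesis by (simp add: cp_mult_tens sw2_mem act_tens act_act_pure)
  qed
  have 1: "act (cp_mult H B (bh b h) (bh b' h')) t = act (bh b h) (act (bh b' h') t)" for b h b' h'
    by (rule linear_ext_tens[OF _ _ A2 linear_map_comp[OF A2 A2] _ t]) (simp_all add: Mm pure)
  have 2: "act (cp_mult H B (bh b h) y) t = act (bh b h) (act y t)" for b h
    by (rule linear_ext_tens[OF _ _ linear_map_comp[OF M2 A1] linear_map_comp[OF A1 A2] _ y]) (simp_all add: 1 t)
  show ?thesis
    by (rule linear_ext_tens[OF _ _ linear_map_comp[OF M1 A1] A1 _ x]) (simp_all add: 2 t y act_mem)
qed

text \<open>
  The right coaction is compatible with the action. The map \<open>J\<close> stands for the inclusion of \<open>M \<otimes> N \<otimes> H\<close> into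
  \<open>\<Omega> \<otimes> H\<close>, for either summand \<open>M \<otimes> N\<close> of the calculus \<open>\<Omega>\<close>.
\<close>

lemma coaction_act_pure:
  assumes tt: "vector_space t" and J: "\<And>a. lin tscale t (\<lambda>u. J u a)"
    "\<And>u. lin sH t (\<lambda>a. J u a)"
  shows "tlift (full sM) (full sN) (\<lambda>m g. ro g (\<lambda>g0 a. J (mn m g0) a)) (act_pure b h m g) =
    sw2 H h (\<lambda>p q. ro g (\<lambda>g0 a. J (act_pure b p m g0) (q * a)))"
proof -
  let ?R = "tlift (full sM) (full sN) (\<lambda>m g. ro g (\<lambda>g0 a. J (mn m g0) a))"
  note [simp] = tt
  note [simp] = lin_comp[OF J(1)] lin_comp[OF J(2)]
  have lin: "linear_map (full sM \<otimes> full sN) (full t) ?R"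
    by (rule tlift_universal(1)) (simp_all add: bilinear_full)
  have R_tens: "?R (mn m g) = ro g (\<lambda>g0 a. J (mn m g0) a)" for m g
    by (rule tlift_tens_full[where t = t]) simp_all
  let ?G = "\<lambda>h1 h2 h3 q k g00 a. J (mn (rm (lm b (hm h1 m)) (\<sigma> h2 k)) (la h3 g00)) (q * a)"
  have "?R (act_pure b h m g) = sw2 H h (\<lambda>h1 r. sw2 H r (\<lambda>h2 h3. co g (\<lambda>k g0.
      ro (la h3 g0) (\<lambda>g0 a. J (mn (rm (lm b (hm h1 m)) (\<sigma> h2 k)) g0) a))))"
  proof -
    have "?R (co g (\<lambda>k g0. mn (f k g0) (f' k g0))) = co g (\<lambda>k g0. ro (f' k g0) (\<lambda>g0' a. J (mn (f k g0) g0') a))" for f f'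
      unfolding co_def by (subst linear_tlift[OF _ _ _ lin]) (simp_all add: R_tens)
    moreover have "?R (sw2 H l f) = sw2 H l (\<lambda>x y. ?R (f x y))"
      if "\<And>x y. f x y \<in> car (full sM \<otimes> full sN)" for l f
      unfolding sw2_def by (subst linear_tlift[OF _ _ _ lin]) (simp_all add: that)
    ultimately show ?thesis unfolding act_pure_def[of b] by (simp add: sw2_mem co_mem)
  qed
  also have "... = sw2 H h (\<lambda>h1 s. sw2 H s (\<lambda>h2 u. sw2 H u (\<lambda>h3 q. co g (\<lambda>k g'. ro g' (\<lambda>g00 a. ?G h1 h2 h3 q k g00 a)))))"
    by (simp add: ro_la[OF tt] co_sw2_swap)
  also have "... = sw2 H h (\<lambda>h1 s. sw2 H s (\<lambda>r q. sw2 H r (\<lambda>h2 h3. co g (\<lambda>k g'. ro g' (\<lambda>g00 a. ?G h1 h2 h3 q k g00 a)))))"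
    by (simp add: coassoc[OF tt])
  also have "... = sw2 H h (\<lambda>p q. sw2 H p (\<lambda>h1 r. sw2 H r (\<lambda>h2 h3. co g (\<lambda>k g'. ro g' (\<lambda>g00 a. ?G h1 h2 h3 q k g00 a)))))"
    by (rule coassoc[symmetric, OF tt]) simp_all
  also have "... = sw2 H h (\<lambda>p q. ro g (\<lambda>g0 a. J (act_pure b p m g0) (q * a)))"
  proof -
    have push: "J (sw2 H l f) a = sw2 H l (\<lambda>x y. J (f x y) a)" "J (co g f') a = co g (\<lambda>x y. J (f' x y) a)" for l f f' a g
      using sw2_push[of "\<lambda>u. J u a", OF lin_add[OF J(1)]] co_push[of "\<lambda>u. J u a", OF lin_add[OF J(1)]] by blast+
    show ?thesis unfolding act_pure_def by (simp add: push ro_sw2_swap ro_co_swap[OF tt])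
  qed
  finally show ?thesis .
qed

end

section \<open>The vertical map\<close>

locale vertical = twisted_algebra H B + covariant_module H sN la lco rco
  for H :: "('k::field, 'h::{ring, monoid_mult}) hopf"
    and B :: "('k, 'h, 'b::{ring, monoid_mult}) twisted_alg"
    and sN :: "'k \<Rightarrow> 'n::ab_group_add \<Rightarrow> 'n"
    and la lco rco
begin

lemma crossed_BN: "crossed_module H B sB (*) (*) (meas B) sN la lco rco"
  by (intro crossed_module.intro regular_bimodule covariant_module_axioms)

abbreviation "an \<equiv> tens (cp_space H B) (full sN)"
abbreviation "btens \<equiv> tens (full sB) (full sH)"

definition vert where
  "vert t = tlift (full sB) (full sN) (\<lambda>b g. co g (\<lambda>k g'. co g' (\<lambda>k' g0. an (btens b k) (la (S k') g0)))) t"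

text \<open>
  The inner coaction of \<open>b \<otimes> \<gamma> \<mapsto> b \<otimes> \<gamma>\<^sub>-\<^sub>2 \<otimes> S(\<gamma>\<^sub>-\<^sub>1)\<gamma>\<^sub>0\<close> is summed into the projection \<open>P\<close>, which shows that the
  values lie in \<open>A \<otimes> \<Gamma>\<close>.
\<close>

lemma vert_proj: "vert t = tlift (full sB) (full sN) (\<lambda>b g. co g (\<lambda>k g'. an (btens b k) (proj g'))) t"
proof -
  have "an u (proj g) = co g (\<lambda>k' g0. an u (la (S k') g0))" for u g
    unfolding proj_def by (rule co_push) (simp add: tens_simps)
  then show ?thesis by (simp add: vert_def)
qed

lemma is_vs_coinv: "is_vs \<lparr>scl = sN, car = coinv\<rparr>"
proof -
  interpret N: vector_space sN by simp
  have fix_iff: "m \<in> coinv \<longleftrightarrow> proj m = m" for m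
    using proj_coinv proj_mem by metis
  have lin: "lin sN sN (\<lambda>x. proj x)" by simp
  have "N.subspace coinv"
    using lin_add[OF lin] lin_scale[OF lin] linear_map_zero[OF _ lin] vs_N
    by (auto simp: N.subspace_def fix_iff)
  then show ?thesis by (simp add: is_vs_def)
qed

lemma linear_vert:
  "linear_map (full sB \<otimes> full sN) (cp_space H B \<otimes> \<lparr>scl = sN, car = coinv\<rparr>) vert"
proof -
  let ?Hor = "cp_space H B \<otimes> \<lparr>scl = sN, car = coinv\<rparr>"
  have "an u m \<in> car ?Hor" if "u \<in> car (cp_space H B)" "m \<in> coinv" for u m
    by (subst tens_cong[of _ "cp_space H B" _ "\<lparr>scl = sN, car = coinv\<rparr>"]) (auto simp: that)
  then have "co g (\<lambda>k g'. an (btens b k) (proj g')) \<in> car ?Hor" for b g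
    unfolding co_def by (intro tlift_mem) (simp_all add: proj_mem)
  then have "bilinear_map (full sB) (full sN) ?Hor (\<lambda>b g. co g (\<lambda>k g'. an (btens b k) (proj g')))"
    by (intro bilinear_map_codomain[OF bilinear_full]) simp_all
  then show ?thesis
    unfolding vert_proj[abs_def] by (intro tlift_universal(1)) simp_all
qed

lemma vert_tens: "vert (tens (full sB) (full sN) b g) = co g (\<lambda>k g'. an (btens b k) (proj g'))"
  unfolding vert_proj by (rule tlift_tens_full[where t = tscale]) simp_all

text \<open>
  Left linearity on pure tensors. The factor \<open>h4\<close> that multiplies the form disappears by
  \<open>P(h\<gamma>) = \<epsilon>(h)P(\<gamma>)\<close>, and what remains is the product in \<open>A\<close>.
\<close>

lemma vert_act:
  "vert (crossed_module.act H B sB (*) (*) (meas B) sN la lco (btens b h) (tens (full sB) (full sN) b' g)) =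
   co g (\<lambda>k g'. an (cp_mult H B (btens b h) (btens b' k)) (proj g'))"
proof -
  interpret crossed_module H B sB "(*)" "(*)" "meas B" sN la lco rco by (rule crossed_BN)
  note vt = vector_space_tscale
  note lin = linear_vert
  have "vert (act_pure b h b' g) = sw2 H h (\<lambda>h1 r. sw2 H r (\<lambda>h2 h3. co g (\<lambda>k g0.
      co (la h3 g0) (\<lambda>k' g'. an (bh (b * meas B h1 b' * \<sigma> h2 k) k') (proj g')))))"
  proof -
    have "vert (co g (\<lambda>k g0. mn (f k g0) (f' k g0))) = co g (\<lambda>k g0. vert (mn (f k g0) (f' k g0)))" for f f'
      unfolding co_def by (subst linear_tlift[OF _ _ _ lin]) simp_all
    moreover have "vert (sw2 H l f) = sw2 H l (\<lambda>x y. vert (f x y))"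
      if "\<And>x y. f x y \<in> car (full sB \<otimes> full sN)" for l f
      unfolding sw2_def by (subst linear_tlift[OF _ _ _ lin]) (simp_all add: that)
    ultimately show ?thesis unfolding act_pure_def[of b] by (simp add: sw2_mem co_mem vert_tens)
  qed
  also have "... = sw2 H h (\<lambda>h1 r. sw2 H r (\<lambda>h2 h3. sw2 H h3 (\<lambda>p q. tscale (\<epsilon> q) (co g (\<lambda>k g0.
      co g0 (\<lambda>k' g'. an (bh (b * meas B h1 b' * \<sigma> h2 k) (p * k')) (proj g')))))))"
  proof -
    have "tscale c (co g f) = co g (\<lambda>a b. tscale c (f a b))" for c g and f :: "'h \<Rightarrow> 'n \<Rightarrow> ('k, ('k, 'b, 'h) tensor, 'n) tensor"
      by (rule co_push) (simp add: tensor.scale_right_distrib)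
    then show ?thesis
      by (simp add: co_la[OF vt] co_sw2_swap proj_la tens_simps(4)[of _ "full sN", simplified])
  qed
  also have "... = sw2 H h (\<lambda>h1 r. sw2 H r (\<lambda>h2 h3. co g (\<lambda>k g0.
      co g0 (\<lambda>k' g'. an (bh (b * meas B h1 b' * \<sigma> h2 k) (h3 * k')) (proj g')))))"
    by (simp add: counit_right[where t = tscale])
  also have "... = co g (\<lambda>k g'. sw2 H h (\<lambda>h1 r. sw2 H r (\<lambda>h2 h3. sw2 H k (\<lambda>k k'.
      an (bh (b * meas B h1 b' * \<sigma> h2 k) (h3 * k')) (proj g')))))"
    by (simp add: co_sw2_swap co_coassoc[OF vt])
  also have "... = co g (\<lambda>k g'. an (cp_mult H B (bh b h) (bh b' k)) (proj g'))"
    by (simp add: cp_mult_tens sw2_push[of "\<lambda>x. an x z" for z, OF tens_simps(1)])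
  finally show ?thesis by (simp add: act_tens)
qed

end

section \<open>The crossed product calculus\<close>

locale crossed_calculus = twisted_algebra H B
  for H :: "('k::field, 'h::{ring, monoid_mult}) hopf"
    and B :: "('k, 'h, 'b::{ring, monoid_mult}) twisted_alg" +
  fixes L :: "('k, 'h, 'w::ab_group_add) bicov_fodc"
    and E :: "('k, 'h, 'b, 'v::ab_group_add) twisted_fodc"
  assumes bij: "bij S" and bicov: "bicovariant_fodc H L" and tmf: "twisted_module_fodc H B E"
begin

text \<open>
  The interpretations that follow make the results on \<open>M \<otimes> N\<close> available for the two summands: with the prefix \<open>EH\<close> for forms on
  \<open>B\<close> tensored with \<open>H\<close>, and with the prefix \<open>BL\<close> for \<open>B\<close> tensored with forms on \<open>H\<close>.
\<close>

lemma covariant_L: "covariant_module H (fscale L) (lact L) (lcoact L) (rcoact L)"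
  by (intro covariant_module.intro covariant_module_axioms.intro hopf_sweedler_axioms)
    (simp_all only: bicov[unfolded bicovariant_fodc_def is_fodc_def Let_def])

end

sublocale crossed_calculus \<subseteq> L: vertical H B "fscale L" "lact L" "lcoact L" "rcoact L"
  by (intro vertical.intro twisted_algebra_axioms covariant_L)

sublocale crossed_calculus \<subseteq> BL: crossed_module H B sB "(*)" "(*)" "meas B" "fscale L" "lact L" "lcoact L" "rcoact L"
  by (rule L.crossed_BN)

sublocale crossed_calculus \<subseteq> EH: crossed_module H B "fscale E" "lact E" "ract E" "hact E" sH "(*)" "comult H" "comult H"
  by (intro crossed_module.intro fodc_bimodule[OF tmf] regular_covariant)

context crossed_calculus begin

abbreviation "V \<equiv> hspace H"
abbreviation "A \<equiv> cp_space H B"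
abbreviation "\<Omega> \<equiv> cp_forms H L B E"
abbreviation "\<Gamma> \<equiv> coinv_forms H L"
abbreviation "lac \<equiv> lact (cp_calculus H L B E)"
abbreviation "\<rho> \<equiv> cp_forms_coact H L B E"
abbreviation "Hor \<equiv> hor_space H L B"
abbreviation "vr \<equiv> ver H L B E"
abbreviation "hg \<equiv> tens A \<Gamma>"

lemma coinv_forms_eq: "\<Gamma> = \<lparr>scl = fscale L, car = L.coinv\<rparr>"
  by (simp add: coinv_forms_def L.coinv_def)

lemma scl_coinv [simp]: "scl \<Gamma> = fscale L"
  by (simp add: coinv_forms_def)

lemma is_vs_coinv_forms [simp]: "is_vs \<Gamma>"
  unfolding coinv_forms_eq by (rule L.is_vs_coinv)

lemma is_vs_forms: "is_vs \<Omega>"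
  by simp

lemma car_forms: "car \<Omega> = car (forms E \<otimes> V) \<times> car (bspace B \<otimes> forms L)"
  and scl_forms: "scl \<Omega> c p = (tscale c (fst p), tscale c (snd p))"
  by (simp_all add: dsum_def)

lemma lact_eq: "lac x \<omega> = (EH.act x (fst \<omega>), BL.act x (snd \<omega>))"
  by (simp add: cp_calculus_def Let_def EH.act_def BL.act_def EH.co_def L.co_def sw2_def)

lemma bilinear_lact: "bilinear_map A \<Omega> \<Omega> lac"
  using EH.bilinear_act BL.bilinear_act
  by (auto simp: bilinear_map_def linear_map_def lact_eq car_forms dsum_def)

lemma lact_mem: "x \<in> car A \<Longrightarrow> \<omega> \<in> car \<Omega> \<Longrightarrow> lac x \<omega> \<in> car \<Omega>"
  using bilinear_lact by (simp add: bilinear_map_def linear_map_def)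

lemma lact_one: "\<omega> \<in> car \<Omega> \<Longrightarrow> lac (cp_one H B) \<omega> = \<omega>"
  by (auto simp: lact_eq cp_one_def EH.act_one BL.act_one car_forms)

lemma lact_assoc: "x \<in> car A \<Longrightarrow> y \<in> car A \<Longrightarrow> \<omega> \<in> car \<Omega> \<Longrightarrow> lac (cp_mult H B x y) \<omega> = lac x (lac y \<omega>)"
  by (auto simp: lact_eq EH.act_assoc BL.act_assoc car_forms)

lemma forms_induct [consumes 1, case_names hor ver add]:
  assumes "\<omega> \<in> car \<Omega>"
    and "\<And>\<beta> h. P (EH.mn \<beta> h, 0)"
    and "\<And>b \<gamma>. P (0, BL.mn b \<gamma>)"
    and "\<And>\<omega> \<omega>'. \<omega> \<in> car \<Omega> \<Longrightarrow> \<omega>' \<in> car \<Omega> \<Longrightarrow> P \<omega> \<Longrightarrow> P \<omega>' \<Longrightarrow> P (\<omega> + \<omega>')"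
  shows "P \<omega>"
proof -
  obtain s t where \<omega>: "\<omega> = (s, t)" and s: "s \<in> car (forms E \<otimes> V)" and t: "t \<in> car (bspace B \<otimes> forms L)"
    using assms(1) by (auto simp: car_forms)
  have z: "0 \<in> car (forms E \<otimes> V)" "0 \<in> car (bspace B \<otimes> forms L)" by (simp_all add: is_vs_mem)
  have vs: "is_vs (forms E)" "is_vs (bspace B)" by simp_all
  have "P (s, 0)" using s vs(1)
  proof (induction rule: tensor_induct)
    case (add u v)
    then show ?case using assms(4)[of "(u, 0)" "(v, 0)"] z by (simp add: car_forms)
  qed (simp_all add: assms(2))
  moreover have "P (0, t)" using t vs(2)
  proof (induction rule: tensor_induct)
    case (add u v)
    then show ?case using assms(4)[of "(0, u)" "(0, v)"] z by (simp add: car_forms)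
  qed (simp_all add: assms(3))
  ultimately show ?thesis using assms(4)[of "(s, 0)" "(0, t)"] s t z by (simp add: \<omega> car_forms)
qed

abbreviation "JE \<equiv> \<lambda>u a. tens \<Omega> V (u, 0) a"
abbreviation "JB \<equiv> \<lambda>u a. tens \<Omega> V (0, u) a"

lemma lin_JE: "lin tscale tscale (\<lambda>u. JE u a)"
  and lin_JB: "lin tscale tscale (\<lambda>u. JB u a)"
proof -
  have "JE (u + u') a = JE u a + JE u' a" "JB (v + v') a = JB v a + JB v' a" for u u' v v'
    using tens_simps(1)[of \<Omega> "V" "(u, 0)" "(u', 0)" a] tens_simps(1)[of \<Omega> "V" "(0, v)" "(0, v')" a]
    by simp_all
  moreover have "JE (tscale c u) a = tscale c (JE u a)" "JB (tscale c v) a = tscale c (JB v a)" for c u v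
    using tens_simps(3)[of \<Omega> "V" c "(u, 0)" a] tens_simps(3)[of \<Omega> "V" c "(0, v)" a]
    by (simp_all add: scl_forms)
  ultimately show "lin tscale tscale (\<lambda>u. JE u a)" "lin tscale tscale (\<lambda>u. JB u a)"
    by (simp_all add: lin_iff)
qed

lemma coact_eq: "\<rho> \<omega> = tlift (forms E) V (\<lambda>\<beta> h. sw2 H h (\<lambda>h1 h2. JE (EH.mn \<beta> h1) h2)) (fst \<omega>) +
    tlift (bspace B) (forms L) (\<lambda>b \<gamma>. L.ro \<gamma> (\<lambda>\<gamma>0 \<gamma>1. JB (BL.mn b \<gamma>0) \<gamma>1)) (snd \<omega>)"
  by (simp add: cp_forms_coact_def L.ro_def)

lemma tens_forms_mem [simp]: "(EH.mn \<beta> h, 0) \<in> car \<Omega>" "(0, BL.mn b \<gamma>) \<in> car \<Omega>"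
  by (simp_all add: car_forms is_vs_mem)

lemma linear_coact: "linear_map \<Omega> (\<Omega> \<otimes> V) \<rho>"
proof -
  note [simp] = lin_comp[OF lin_JE] lin_comp[OF lin_JB]
  have "linear_map (forms E \<otimes> V) (\<Omega> \<otimes> V) (tlift (forms E) V (\<lambda>\<beta> h. sw2 H h (\<lambda>h1 h2. JE (EH.mn \<beta> h1) h2)))"
    by (rule tlift_universal(1)[OF _ _ _ bilinear_map_codomain[OF bilinear_full]])
      (simp_all add: EH.sw2_mem)
  moreover have "linear_map (bspace B \<otimes> forms L) (\<Omega> \<otimes> V)
     (tlift (bspace B) (forms L) (\<lambda>b \<gamma>. L.ro \<gamma> (\<lambda>\<gamma>0 \<gamma>1. JB (BL.mn b \<gamma>0) \<gamma>1)))"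
  proof (rule tlift_universal(1)[OF _ _ _ bilinear_map_codomain[OF bilinear_full]])
    show "L.ro \<gamma> (\<lambda>\<gamma>0 \<gamma>1. JB (BL.mn b \<gamma>0) \<gamma>1) \<in> car (\<Omega> \<otimes> V)" for b \<gamma>
      unfolding L.ro_def by (rule tlift_mem) simp_all
  qed simp_all
  ultimately have "linear_map \<Omega> (\<Omega> \<otimes> V) (\<lambda>\<omega>. tlift (forms E) V (\<lambda>\<beta> h. sw2 H h (\<lambda>h1 h2. JE (EH.mn \<beta> h1) h2)) (fst \<omega>) +
    tlift (bspace B) (forms L) (\<lambda>b \<gamma>. L.ro \<gamma> (\<lambda>\<gamma>0 \<gamma>1. JB (BL.mn b \<gamma>0) \<gamma>1)) (snd \<omega>))"
    by (intro linear_map_add) (auto simp: linear_map_def dsum_def)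
  then show ?thesis by (simp add: coact_eq[abs_def])
qed

lemma coact_mem: "\<omega> \<in> car \<Omega> \<Longrightarrow> \<rho> \<omega> \<in> car (\<Omega> \<otimes> V)"
  using linear_coact by (simp add: linear_map_def)

text \<open>
  Compatibility of coaction and action for \<open>a = b \<otimes> h\<close>, where \<open>a\<^sub>0 \<otimes> a\<^sub>1 = (b \<otimes> h1) \<otimes> h2\<close>. The two summands of the calculus are
  two instances of \<open>coaction_act_pure\<close>.
\<close>

lemma coact_lact:
  assumes "\<omega> \<in> car \<Omega>"
  shows "\<rho> (lac (EH.bh b h) \<omega>) = sw2 H h (\<lambda>p q. tlift \<Omega> V (\<lambda>\<omega>0 a. tens \<Omega> V (lac (EH.bh b p) \<omega>0) (q * a)) (\<rho> \<omega>))"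
proof -
  note vt = vector_space_tscale
  note [simp] = lin_comp[OF lin_JE] lin_comp[OF lin_JB]
  have bh: "EH.bh b h \<in> car A" for b h by simp
  let ?R = "\<lambda>p q. tlift \<Omega> V (\<lambda>\<omega>0 a. tens \<Omega> V (lac (EH.bh b p) \<omega>0) (q * a))"
  have bil: "bilinear_map \<Omega> V (\<Omega> \<otimes> V) (\<lambda>\<omega>0 a. tens \<Omega> V (lac (EH.bh b p) \<omega>0) (q * a))" for p q
    by (intro bilinear_mapI linear_map_tens bilinear_mapD(1)[OF bilinear_lact bh] lact_mem) simp_all
  have R: "linear_map (\<Omega> \<otimes> V) (\<Omega> \<otimes> V) (?R p q)" for p q
    by (rule tlift_universal(1)[OF _ _ _ bil]) simp_all
  have R_tens: "?R p q (tens \<Omega> V \<omega> a) = tens \<Omega> V (lac (EH.bh b p) \<omega>) (q * a)" if "\<omega> \<in> car \<Omega>" for p q \<omega> a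
    by (rule tlift_universal(2)[OF _ _ _ bil]) (use that in simp_all)
  note lin\<rho>L = linear_map_comp[OF bilinear_mapD(1)[OF bilinear_lact bh] linear_coact]
  have act0: "EH.act (EH.bh b p) 0 = 0" "BL.act (EH.bh b p) 0 = 0" for p
    by (rule linear_map_zero[OF _ bilinear_mapD(1)[OF EH.bilinear_act]], simp_all)
      (rule linear_map_zero[OF _ bilinear_mapD(1)[OF BL.bilinear_act]], simp_all)
  have zero: "tlift (forms E) V (\<lambda>\<beta> h. sw2 H h (\<lambda>h1 h2. JE (EH.mn \<beta> h1) h2)) 0 = 0"
    "tlift (bspace B) (forms L) (\<lambda>b \<gamma>. L.ro \<gamma> (\<lambda>\<gamma>0 \<gamma>1. JB (BL.mn b \<gamma>0) \<gamma>1)) 0 = 0"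
    by (rule linear_map_zero[OF _ tlift_universal(1)[where X = "full tscale"]]; simp add: bilinear_full)+
  show ?thesis using assms
  proof (induction rule: forms_induct)
    case (hor \<beta> h')
    have "\<rho> (EH.mn \<beta> h', 0) = sw2 H h' (\<lambda>g0 a. JE (EH.mn \<beta> g0) a)"
      unfolding coact_eq by (simp add: zero) (rule tlift_tens_full[where t = tscale], simp_all)
    moreover have "?R p q (sw2 H h' (\<lambda>g0 a. JE (EH.mn \<beta> g0) a)) = sw2 H h' (\<lambda>g0 a. JE (EH.act_pure b p \<beta> g0) (q * a))" for p q
      unfolding sw2_def by (subst linear_tlift[OF _ _ _ R], simp_all add: R_tens) (simp add: lact_eq act0 EH.act_tens)
    ultimately show ?case
      using EH.coaction_act_pure[of tscale JE b h \<beta> h', OF vt lin_JE]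
      by (simp add: coact_eq lact_eq act0 zero EH.act_tens EH.ro_def sw2_def)
  next
    case (ver b' \<gamma>)
    have "\<rho> (0, BL.mn b' \<gamma>) = L.ro \<gamma> (\<lambda>g0 a. JB (BL.mn b' g0) a)"
      unfolding coact_eq by (simp add: zero) (rule tlift_tens_full[where t = tscale], simp_all)
    moreover have "?R p q (L.ro \<gamma> (\<lambda>g0 a. JB (BL.mn b' g0) a)) = L.ro \<gamma> (\<lambda>g0 a. JB (BL.act_pure b p b' g0) (q * a))" for p q
      unfolding L.ro_def by (subst linear_tlift[OF _ _ _ R], simp_all add: R_tens) (simp add: lact_eq act0 BL.act_tens)
    ultimately show ?case
      using BL.coaction_act_pure[of tscale JB b h b' \<gamma>, OF vt lin_JB]
      by (simp add: coact_eq lact_eq act0 zero BL.act_tens)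
  next
    case (add \<omega> \<omega>')
    have "sw2 H h (\<lambda>p q. ?R p q (\<rho> (\<omega> + \<omega>'))) = sw2 H h (\<lambda>p q. ?R p q (\<rho> \<omega>)) + sw2 H h (\<lambda>p q. ?R p q (\<rho> \<omega>'))"
      using linear_mapD(2)[OF linear_coact add(1,2)] linear_mapD(2)[OF R coact_mem[OF add(1)] coact_mem[OF add(2)]]
      by (simp add: sw2_def tlift_trep[of "V"] sum_list_addf case_prod_unfold)
    then show ?case using add linear_mapD(2)[OF lin\<rho>L add(1,2)] by simp
  qed
qed

lemma ver_eq: "vr \<omega> = L.vert (snd \<omega>)"
  unfolding ver_def L.vert_def L.co_def by (simp add: tens_cong[of A A \<Gamma> "forms L"])

lemma linear_ver: "linear_map \<Omega> Hor (vr)"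
proof -
  have "linear_map \<Omega> Hor (\<lambda>\<omega>. L.vert (snd \<omega>))"
    using L.linear_vert unfolding coinv_forms_eq by (auto simp: linear_map_def dsum_def)
  then show ?thesis by (simp add: ver_eq[abs_def])
qed

lemma bilinear_hor_lact: "bilinear_map A Hor Hor (hor_lact H L B)"
proof (rule bilinear_mapI)
  have bil: "bilinear_map A \<Gamma> Hor (\<lambda>a' \<gamma>. hg (cp_mult H B a a') \<gamma>)" if "a \<in> car A" for a
    by (intro bilinear_mapI linear_map_tens bilinear_mapD(1)[OF bilinear_cp_mult that] linear_map_ident)
      (simp_all add: linear_mapD(1)[OF bilinear_mapD(1)[OF bilinear_cp_mult that]])
  show "linear_map Hor Hor (hor_lact H L B a)" if "a \<in> car A" for a
    unfolding hor_lact_def by (rule tlift_universal(1)[OF _ _ _ bil[OF that]]) simp_all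
  show "linear_map A Hor (\<lambda>a. hor_lact H L B a t)" if "t \<in> car Hor" for t
    unfolding hor_lact_def
    by (rule linear_map_tlift_param[OF _ _ that]) 
      (simp_all add: linear_map_tens bilinear_mapD(2)[OF bilinear_cp_mult])
qed

lemma hor_lact_tens:
  assumes "a \<in> car A" "a' \<in> car A" "\<gamma> \<in> car \<Gamma>"
  shows "hor_lact H L B a (hg a' \<gamma>) = hg (cp_mult H B a a') \<gamma>"
proof -
  have bil: "bilinear_map A \<Gamma> Hor (\<lambda>a' \<gamma>. hg (cp_mult H B a a') \<gamma>)"
    by (intro bilinear_mapI linear_map_tens bilinear_mapD(1)[OF bilinear_cp_mult assms(1)] linear_map_ident)
      (simp_all add: linear_mapD(1)[OF bilinear_mapD(1)[OF bilinear_cp_mult assms(1)]])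
  show ?thesis
    unfolding hor_lact_def by (rule tlift_universal(2)[OF _ _ _ bil assms(2,3)]) simp_all
qed

lemma ver_lact:
  assumes a: "a \<in> car A" and \<omega>: "\<omega> \<in> car \<Omega>"
  shows "vr (lac a \<omega>) = hor_lact H L B a (vr \<omega>)"
proof -
  have lin1: "linear_map \<Omega> Hor (\<lambda>\<omega>. vr (lac a \<omega>))" "linear_map \<Omega> Hor (\<lambda>\<omega>. hor_lact H L B a (vr \<omega>))"
    if "a \<in> car A" for a
    by (rule linear_map_comp[OF bilinear_mapD(1)[OF bilinear_lact that] linear_ver],
        rule linear_map_comp[OF linear_ver bilinear_mapD(1)[OF bilinear_hor_lact that]])
  have lin2: "linear_map A Hor (\<lambda>a. vr (lac a \<omega>))" 
    by (rule linear_map_comp[OF bilinear_mapD(2)[OF bilinear_lact \<omega>] linear_ver])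
  have lin3: "linear_map A Hor (\<lambda>a. hor_lact H L B a (vr \<omega>))"
    by (rule bilinear_mapD(2)[OF bilinear_hor_lact linear_mapD(1)[OF linear_ver \<omega>]])
  have pure: "vr (lac (EH.bh b h) \<omega>) = hor_lact H L B (EH.bh b h) (vr \<omega>)" for b h
    using \<omega>
  proof (induction rule: forms_induct)
    case (hor \<beta> h')
    have 0: "BL.act (EH.bh b h) 0 = 0"
      by (rule linear_map_zero[OF _ bilinear_mapD(1)[OF BL.bilinear_act]]) simp_all
    have "L.vert 0 = 0" by (rule linear_map_zero[OF _ L.linear_vert]) simp
    moreover have "hor_lact H L B (EH.bh b h) 0 = 0"
      by (rule linear_map_zero[OF _ bilinear_mapD(1)[OF bilinear_hor_lact]]) simp_all
    ultimately show ?case by (simp add: ver_eq lact_eq 0)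
  next
    case (ver b' \<gamma>)
    have an: "L.an = hg" by (rule tens_cong) simp_all
    have hl: "linear_map Hor Hor (hor_lact H L B (EH.bh b h))"
      by (rule bilinear_mapD(1)[OF bilinear_hor_lact]) simp
    have pm: "L.proj g \<in> car \<Gamma>" for g using L.proj_mem by (simp add: coinv_forms_eq)
    have "hor_lact H L B (EH.bh b h) (L.co \<gamma> (\<lambda>k g'. L.an (EH.bh b' k) (L.proj g'))) =
        L.co \<gamma> (\<lambda>k g'. L.an (cp_mult H B (EH.bh b h) (EH.bh b' k)) (L.proj g'))"
      unfolding L.co_def an by (subst linear_tlift[OF _ _ _ hl]) (simp_all add: hor_lact_tens pm)
    then show ?case by (simp add: ver_eq lact_eq L.vert_act L.vert_tens)
  next
    case (add \<omega> \<omega>')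
    then show ?case using linear_mapD(2)[OF lin1(1), of "EH.bh b h" \<omega> \<omega>'] linear_mapD(2)[OF lin1(2), of "EH.bh b h" \<omega> \<omega>'] by simp
  qed
  show ?thesis
    by (rule linear_ext_tens[OF _ _ lin2 lin3 _ a]) (simp_all add: pure)
qed

end

section \<open>Dual bases and coinvariant tensors\<close>

locale based_calculus = crossed_calculus H B L E
  for H :: "('k::field, 'h::{ring, monoid_mult}) hopf"
    and B :: "('k, 'h, 'b::{ring, monoid_mult}) twisted_alg"
    and L :: "('k, 'h, 'w::ab_group_add) bicov_fodc"
    and E :: "('k, 'h, 'b, 'v::ab_group_add) twisted_fodc" +
  fixes n :: nat and x :: "nat \<Rightarrow> 'w \<Rightarrow> 'k" and xd :: "nat \<Rightarrow> 'w"
  assumes x_basis: "indexed_basis (tangent_space H L) n x"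
    and xd_basis: "indexed_basis (coinv_forms H L) n xd"
    and dual: "\<forall>i\<in>{1..n}. \<forall>j\<in>{1..n}. x i (xd j) = (if i = j then 1 else 0)"
begin

abbreviation "T \<equiv> tangent_space H L"
abbreviation "TF \<equiv> tangent_forms H L B E"

lemma is_vs_T [simp]: "is_vs T"
proof -
  have "vector_space (\<lambda>c (\<alpha> :: 'w \<Rightarrow> 'k) \<gamma>. c * \<alpha> \<gamma>)"
    by unfold_locales (auto simp: fun_eq_iff algebra_simps)
  then show ?thesis
    by (auto simp: is_vs_def tangent_space_def module.subspace_def module_iff_vector_space
        linear_map_def ground_def is_vs_mem[OF is_vs_coinv_forms] algebra_simps)
qed

lemma tangent_linear: "\<alpha> \<in> car T \<Longrightarrow> linear_map \<Gamma> ground \<alpha>"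
  by (simp add: tangent_space_def)

lemma is_vs_ground [simp]: "is_vs (ground :: ('k, 'k) vs)"
  unfolding ground_def is_vs_full by unfold_locales (auto simp: algebra_simps)

lemma x_mem [simp]: "j \<in> {1..n} \<Longrightarrow> x j \<in> car T"
proof -
  interpret T: vector_space "scl T" by (rule is_vs_vector_space) simp
  show "j \<in> {1..n} \<Longrightarrow> x j \<in> car T"
    using x_basis T.span_base unfolding indexed_basis_def by (metis imageI)
qed

lemma xd_mem [simp]: "j \<in> {1..n} \<Longrightarrow> xd j \<in> car \<Gamma>"
proof -
  interpret G: vector_space "scl \<Gamma>" by (rule is_vs_vector_space) simp
  show "j \<in> {1..n} \<Longrightarrow> xd j \<in> car \<Gamma>"
    using xd_basis G.span_base unfolding indexed_basis_def by (metis imageI)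
qed

lemma coinv_expand:
  assumes "\<gamma> \<in> car \<Gamma>"
  shows "\<gamma> = (\<Sum>j=1..n. scl \<Gamma> (x j \<gamma>) (xd j))"
proof -
  interpret G: vector_space "scl \<Gamma>" by (rule is_vs_vector_space) simp
  have "\<gamma> \<in> G.span (xd ` {1..n})" using assms xd_basis by (simp add: indexed_basis_def)
  then obtain u where "\<gamma> = (\<Sum>v\<in>xd ` {1..n}. scl \<Gamma> (u v) v)"
    by (subst (asm) G.span_finite) auto
  moreover have "inj_on xd {1..n}" using xd_basis by (simp add: indexed_basis_def)
  ultimately have \<gamma>: "\<gamma> = (\<Sum>j=1..n. scl \<Gamma> (u (xd j)) (xd j))"
    by (simp add: sum.reindex del: scl_coinv)
  have "x i \<gamma> = u (xd i)" if i: "i \<in> {1..n}" for i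
  proof -
    note lin = tangent_linear[OF x_mem[OF i]]
    have "x i \<gamma> = (\<Sum>j=1..n. x i (scl \<Gamma> (u (xd j)) (xd j)))"
      unfolding \<gamma> by (rule linear_map_sum[OF _ lin]) (simp_all add: is_vs_mem(3)[OF is_vs_coinv_forms, simplified])
    also have "... = (\<Sum>j=1..n. if i = j then u (xd j) else 0)"
      by (rule sum.cong) (use dual i in \<open>simp_all add: linear_mapD(3)[OF lin, simplified] ground_def\<close>)
    also have "... = u (xd i)" using i by simp
    finally show ?thesis .
  qed
  then have "(\<Sum>j=1..n. scl \<Gamma> (x j \<gamma>) (xd j)) = (\<Sum>j=1..n. scl \<Gamma> (u (xd j)) (xd j))"
    by (intro sum.cong) simp_all
  then show ?thesis by (rule trans[OF \<gamma> sym])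
qed

lemma linear_coinv_expand:
  assumes f: "linear_map \<Gamma> Y f" and \<gamma>: "\<gamma> \<in> car \<Gamma>"
  shows "f \<gamma> = (\<Sum>j=1..n. scl Y (x j \<gamma>) (f (xd j)))"
proof -
  have "f \<gamma> = f (\<Sum>j=1..n. scl \<Gamma> (x j \<gamma>) (xd j))" using coinv_expand[OF \<gamma>] by simp
  also have "... = (\<Sum>j=1..n. f (scl \<Gamma> (x j \<gamma>) (xd j)))"
    by (rule linear_map_sum[OF _ f]) (simp_all add: is_vs_mem(3)[OF is_vs_coinv_forms, simplified])
  also have "... = (\<Sum>j=1..n. scl Y (x j \<gamma>) (f (xd j)))"
    by (rule sum.cong) (simp_all add: linear_mapD(3)[OF f, simplified])
  finally show ?thesis .
qed

lemma tangent_expand: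
  assumes "\<alpha> \<in> car T"
  shows "\<alpha> = (\<Sum>j=1..n. scl T (\<alpha> (xd j)) (x j))"
proof
  fix \<gamma>
  have s: "(\<Sum>j=1..n. scl T (\<alpha> (xd j)) (x j)) \<gamma> = (\<Sum>j=1..n. \<alpha> (xd j) * x j \<gamma>)"
    by (induction n) (simp_all add: tangent_space_def)
  show "\<alpha> \<gamma> = (\<Sum>j=1..n. scl T (\<alpha> (xd j)) (x j)) \<gamma>"
  proof (cases "\<gamma> \<in> car \<Gamma>")
    case True
    show ?thesis using linear_coinv_expand[OF tangent_linear[OF assms] True] s by (simp add: ground_def mult.commute)
  next
    case False
    then have "\<alpha> \<gamma> = 0" "\<And>j. j \<in> {1..n} \<Longrightarrow> x j \<gamma> = 0"
      using assms x_mem unfolding tangent_space_def by auto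
    then show ?thesis using s by simp
  qed
qed

text \<open>
  The coefficient of \<open>x\<^sub>k\<close> of a tensor in \<open>T \<otimes> X\<close>, obtained by evaluation at \<open>x\<^sup>k\<close>.
\<close>

definition coord where "coord X k t = tlift T X (\<lambda>\<alpha> \<omega>. scl X (\<alpha> (xd k)) \<omega>) t"

lemma linear_eval: "linear_map T ground (\<lambda>\<alpha>. \<alpha> \<gamma>)"
  by (simp add: linear_map_def ground_def tangent_space_def)

lemma coord:
  assumes X: "is_vs X" and k: "k \<in> {1..n}"
  shows "linear_map (T \<otimes> X) X (coord X k)"
    and "\<alpha> \<in> car T \<Longrightarrow> \<omega> \<in> car X \<Longrightarrow> coord X k (tens T X \<alpha> \<omega>) = scl X (\<alpha> (xd k)) \<omega>"
proof -
  note bil = bilinear_scale(2)[OF X linear_eval[of "xd k"]]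
  show "linear_map (T \<otimes> X) X (coord X k)"
    unfolding coord_def[abs_def] by (rule tlift_universal(1)[OF _ _ _ bil]) (simp_all add: X)
  show "\<alpha> \<in> car T \<Longrightarrow> \<omega> \<in> car X \<Longrightarrow> coord X k (tens T X \<alpha> \<omega>) = scl X (\<alpha> (xd k)) \<omega>"
    unfolding coord_def by (rule tlift_universal(2)[OF _ _ _ bil]) (simp_all add: X)
qed

lemma coord_mem: "is_vs X \<Longrightarrow> k \<in> {1..n} \<Longrightarrow> t \<in> car (T \<otimes> X) \<Longrightarrow> coord X k t \<in> car X"
  by (rule linear_mapD(1)[OF coord(1)])

lemma coord_sum:
  assumes X: "is_vs X" and k: "k \<in> {1..n}" and \<phi>: "\<And>j. j \<in> {1..n} \<Longrightarrow> \<phi> j \<in> car X"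
  shows "coord X k (\<Sum>j=1..n. tens T X (x j) (\<phi> j)) = \<phi> k"
proof -
  interpret X: vector_space "scl X" using X by (rule is_vs_vector_space)
  have "coord X k (\<Sum>j=1..n. tens T X (x j) (\<phi> j)) = (\<Sum>j=1..n. coord X k (tens T X (x j) (\<phi> j)))"
    by (rule linear_map_sum[OF is_vs_tprod coord(1)[OF X k]]) (simp add: \<phi>)
  also have "... = (\<Sum>j=1..n. if j = k then \<phi> j else 0)"
    by (rule sum.cong) (use dual k \<phi> in \<open>simp_all add: coord(2)[OF X k]\<close>)
  finally show ?thesis using k by simp
qed

lemma tangent_tensor_expand:
  assumes "is_vs X" "t \<in> car (T \<otimes> X)"
  shows "t = (\<Sum>j=1..n. tens T X (x j) (coord X j t))"
  unfolding coord_def using tens_expand(1)[OF is_vs_T assms(1) linear_eval x_mem tangent_expand assms(2)] .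

text \<open>
  The matrix \<open>m\<close> of the right coaction on \<open>\<Gamma>\<close>, see \<open>rcoact_xd\<close>.
\<close>

definition mc where "mc k j = tlift \<Gamma> V (\<lambda>\<gamma> a. sH (x k \<gamma>) a) (rcoact L (xd j))"

lemma rcoact_mem: "\<gamma> \<in> car \<Gamma> \<Longrightarrow> rcoact L \<gamma> \<in> car (\<Gamma> \<otimes> V)"
  using L.rco_coinv unfolding coinv_forms_eq by simp

lemma rcoact_linear: "linear_map \<Gamma> (\<Gamma> \<otimes> V) (rcoact L)"
  using L.lin_rco rcoact_mem by (simp add: linear_map_def)

lemma rcoact_xd:
  assumes "j \<in> {1..n}"
  shows "rcoact L (xd j) = (\<Sum>k=1..n. tens \<Gamma> V (xd k) (mc k j))"
  unfolding mc_def
  using tens_expand(1)[OF is_vs_coinv_forms _ tangent_linear[OF x_mem] xd_mem coinv_expand rcoact_mem[OF xd_mem[OF assms]]] by simp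

lemma tlift_rcoact_xd:
  assumes j: "j \<in> {1..n}" and X: "is_vs X" and f: "bilinear_map \<Gamma> V X f"
  shows "tlift \<Gamma> V f (rcoact L (xd j)) = (\<Sum>k=1..n. f (xd k) (mc k j))"
  unfolding rcoact_xd[OF j] by (rule tlift_sum[OF _ _ X f]) simp_all

lemma ro_xd:
  assumes j: "j \<in> {1..n}" and "vector_space t" "\<And>b. lin (fscale L) t (\<lambda>a. f a b)"
    "\<And>a. lin sH t (\<lambda>b. f a b)"
  shows "L.ro (xd j) f = (\<Sum>k=1..n. f (xd k) (mc k j))"
proof -
  have bil: "bilinear_map (forms L) V (full t) f" by (rule bilinear_full[OF assms(3,4)])
  have "L.ro (xd j) f = tlift \<Gamma> V f (rcoact L (xd j))"
    unfolding L.ro_def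
    by (rule tlift_subspace[OF _ _ _ bil]) (use assms rcoact_mem[OF xd_mem[OF j]] in simp_all)
  also have "... = (\<Sum>k=1..n. f (xd k) (mc k j))"
    by (rule tlift_rcoact_xd[OF j _ bilinear_mono[OF bil, where X' = "full t"]]) (use assms in simp_all)
  finally show ?thesis .
qed

text \<open>
  The functional \<open>x\<^sub>k\<close> vanishes outside \<open>\<Gamma>\<close> and so is linear only on \<open>\<Gamma>\<close>. Composition with the projection gives an
  extension that is linear on all forms, as the coassociativity rules require.
\<close>

definition xe where "xe k \<gamma> = x k (L.proj \<gamma>)"

lemma xe_xd: "k \<in> {1..n} \<Longrightarrow> j \<in> {1..n} \<Longrightarrow> xe k (xd j) = (if k = j then 1 else 0)"
  using dual xd_mem[of j] unfolding xe_def by (simp add: L.proj_coinv coinv_forms_eq)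

lemma lin_xe:
  assumes k: "k \<in> {1..n}" and t: "vector_space t"
  shows "lin s (fscale L) f \<Longrightarrow> lin s t (\<lambda>y. t (xe k (f y)) b)"
proof -
  interpret t: vector_space t by fact
  have "linear_map (forms L) \<Gamma> (\<lambda>y. L.proj y)"
    using L.lin_proj[OF lin_id] L.proj_mem by (simp add: linear_map_def coinv_forms_eq)
  then have "linear_map (forms L) ground (xe k)"
    unfolding xe_def[abs_def] by (rule linear_map_comp) (rule tangent_linear[OF x_mem[OF k]])
  then show "lin s (fscale L) f \<Longrightarrow> lin s t (\<lambda>y. t (xe k (f y)) b)"
    by (simp add: ground_def lin_iff t.scale_left_distrib)
qed

text \<open>
  The relation \<open>\<Delta>(m\<^sub>l\<^sub>k) = \<Sum> m\<^sub>l\<^sub>j \<otimes> m\<^sub>j\<^sub>k\<close>: apply \<open>x\<^sub>l\<close> to the first factor of the coassociativity of the coaction at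
  \<open>x\<^sup>k\<close>.
\<close>

lemma sw2_mc:
  assumes l: "l \<in> {1..n}" and k: "k \<in> {1..n}" and t: "vector_space t"
    and g [simp]: "\<And>b. lin sH t (\<lambda>a. g a b)" "\<And>a. lin sH t (\<lambda>b. g a b)"
  shows "sw2 H (mc l k) g = (\<Sum>j=1..n. g (mc l j) (mc j k))"
proof -
  interpret t: vector_space t by fact
  note [simp] = t lin_xe[OF l t] lin_counit_scale(2)[OF t]
  have sum_delta: "(\<Sum>i=1..n. t (xe l (xd i)) (F i)) = F l" for F
  proof -
    have "(\<Sum>i=1..n. t (xe l (xd i)) (F i)) = (\<Sum>i=1..n. if l = i then F i else 0)"
      by (rule sum.cong) (use l in \<open>simp_all add: xe_xd\<close>)
    then show ?thesis using l by simp
  qed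
  have "L.ro (xd k) (\<lambda>m' c. L.ro m' (\<lambda>a b. t (xe l a) (g b c))) = L.ro (xd k) (\<lambda>a h. sw2 H h (\<lambda>b c. t (xe l a) (g b c)))"
    by (rule L.ro_coassoc[OF t]) simp_all
  also have "... = (\<Sum>i=1..n. sw2 H (mc i k) (\<lambda>b c. t (xe l (xd i)) (g b c)))"
    by (rule ro_xd[OF k t]) simp_all
  also have "... = (\<Sum>i=1..n. t (xe l (xd i)) (sw2 H (mc i k) g))"
  proof (rule sum.cong[OF refl])
    fix i
    show "sw2 H (mc i k) (\<lambda>b c. t (xe l (xd i)) (g b c)) = t (xe l (xd i)) (sw2 H (mc i k) g)"
      by (rule sw2_push[symmetric]) (rule t.scale_right_distrib)
  qed
  also have "... = sw2 H (mc l k) g" by (rule sum_delta)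
  finally have R: "L.ro (xd k) (\<lambda>m' c. L.ro m' (\<lambda>a b. t (xe l a) (g b c))) = sw2 H (mc l k) g" .
  have "L.ro (xd k) (\<lambda>m' c. L.ro m' (\<lambda>a b. t (xe l a) (g b c))) = (\<Sum>j=1..n. L.ro (xd j) (\<lambda>a b. t (xe l a) (g b (mc j k))))"
    by (rule ro_xd[OF k t]) simp_all
  also have "... = (\<Sum>j=1..n. g (mc l j) (mc j k))"
  proof (rule sum.cong[OF refl])
    fix j assume j: "j \<in> {1..n}"
    show "L.ro (xd j) (\<lambda>a b. t (xe l a) (g b (mc j k))) = g (mc l j) (mc j k)"
      using sum_delta[of "\<lambda>i. g (mc i j) (mc j k)"] by (subst ro_xd[OF j t]) simp_all
  qed
  finally show ?thesis using R by simp
qed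

lemma counit_mc:
  assumes l: "l \<in> {1..n}" and k: "k \<in> {1..n}"
  shows "\<epsilon> (mc l k) = (if l = k then 1 else 0)"
proof -
  have vk: "vector_space ((*) :: 'k \<Rightarrow> 'k \<Rightarrow> 'k)" using is_vs_ground by (simp add: ground_def)
  have lx: "lin s (fscale L) f \<Longrightarrow> lin s (*) (\<lambda>y. xe l (f y))" for s f
    using lin_xe[OF l vk, of s f 1] by simp
  have le: "lin s sH f \<Longrightarrow> lin s (*) (\<lambda>y. \<epsilon> (f y) * c)" for s f c
    by (rule lin_counit_scale(1)[OF vk])
  have "(if l = k then 1 else 0) = L.ro (xd k) (\<lambda>b a. \<epsilon> a * xe l b)"
    using L.ro_counit[OF lx[OF lin_id], of "xd k"] xe_xd[OF l k] by simp
  also have "... = (\<Sum>i=1..n. \<epsilon> (mc i k) * xe l (xd i))"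
    by (rule ro_xd[OF k vk]) (use le[OF lin_id] lin_counit_scale(2)[OF vk lx[OF lin_id]] in simp_all)
  also have "... = (\<Sum>i=1..n. if l = i then \<epsilon> (mc i k) else 0)"
    by (rule sum.cong) (use l in \<open>simp_all add: xe_xd\<close>)
  finally show ?thesis using l by simp
qed

text \<open>
  The identities \<open>S\<^sup>-\<^sup>1(h2)h1 = \<epsilon>(h) = h2S\<^sup>-\<^sup>1(h1)\<close> for \<open>h = m\<^sub>l\<^sub>k\<close>.
\<close>

lemma mc_inverse:
  assumes l: "l \<in> {1..n}" and k: "k \<in> {1..n}"
  shows "(\<Sum>j=1..n. inv S (mc j k) * mc l j) = (if l = k then 1 else 0)"
    and "(\<Sum>j=1..n. mc j k * inv S (mc l j)) = (if l = k then 1 else 0)"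
proof -
  interpret vs: vector_space sH by simp
  note [simp] = lin_comp[OF lin_inv_antipode[OF bij]]
  show "(\<Sum>j=1..n. inv S (mc j k) * mc l j) = (if l = k then 1 else 0)"
    using inv_antipode(1)[OF bij, of "mc l k"] sw2_mc[OF l k vs_H, of "\<lambda>a b. inv S b * a"] counit_mc[OF l k] by simp
  show "(\<Sum>j=1..n. mc j k * inv S (mc l j)) = (if l = k then 1 else 0)"
    using inv_antipode(2)[OF bij, of "mc l k"] sw2_mc[OF l k vs_H, of "\<lambda>a b. b * inv S a"] counit_mc[OF l k] by simp
qed

text \<open>
  The coefficient of \<open>x\<^sub>k\<close> in the coaction of \<open>\<alpha>\<close>: the defining property of the coaction on \<open>T\<close>, evaluated at
  \<open>x\<^sup>k\<close>.
\<close>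

definition tc where "tc \<alpha> k = (\<Sum>j=1..n. sH (\<alpha> (xd j)) (inv S (mc j k)))"

lemma tc_x: "j \<in> {1..n} \<Longrightarrow> k \<in> {1..n} \<Longrightarrow> tc (x j) k = inv S (mc j k)"
proof -
  interpret vs: vector_space sH by simp
  assume j: "j \<in> {1..n}"
  have "tc (x j) k = (\<Sum>i=1..n. if i = j then inv S (mc i k) else 0)"
    unfolding tc_def by (rule sum.cong) (use dual j in auto)
  then show ?thesis using j by simp
qed

lemma linear_tc: "linear_map T V (\<lambda>\<alpha>. tc \<alpha> k)"
proof -
  interpret vs: vector_space sH by simp
  have "linear_map T V (\<lambda>\<alpha>. sH (\<alpha> (xd j)) (inv S (mc j k)))" for j
    by (simp add: linear_map_def tangent_space_def vs.scale_left_distrib)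
  then show ?thesis unfolding tc_def by (intro linear_map_sum_fun) simp_all
qed

lemma tangent_coact_eq:
  assumes \<alpha>: "\<alpha> \<in> car T"
  shows "tangent_coact H L \<alpha> = (\<Sum>k=1..n. tens T V (x k) (tc \<alpha> k))"
proof -
  interpret vs: vector_space sH by simp
  let ?rhs = "\<lambda>\<gamma>. tlift \<Gamma> V (\<lambda>\<gamma>0 \<gamma>1. sH (\<alpha> \<gamma>0) (inv S \<gamma>1)) (rcoact L \<gamma>)"
  let ?lhs = "\<lambda>\<gamma> t. tlift T V (\<lambda>\<alpha>0 \<alpha>1. sH (\<alpha>0 \<gamma>) \<alpha>1) t"
  let ?t = "\<Sum>k=1..n. tens T V (x k) (tc \<alpha> k)"
  have bil: "bilinear_map \<Gamma> V V (\<lambda>\<gamma>0 \<gamma>1. sH (\<alpha> \<gamma>0) (inv S \<gamma>1))"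
  proof -
    have "linear_map V V (\<lambda>h. sH c (inv S h))" for c
      using lin_counit_scale(2)[OF vs_H lin_inv_antipode[OF bij]] .
    then show ?thesis
      using tangent_linear[OF \<alpha>] by (simp add: bilinear_map_def linear_map_def ground_def vs.scale_left_distrib)
  qed
  have rhs_lin: "linear_map \<Gamma> V ?rhs"
    by (rule linear_map_comp[OF rcoact_linear tlift_universal(1)[OF _ _ _ bil]]) simp_all
  have rhs_xd: "?rhs (xd k) = tc \<alpha> k" if "k \<in> {1..n}" for k
    unfolding tc_def by (rule tlift_rcoact_xd[OF that _ bil]) simp
  have mem: "?t \<in> car (T \<otimes> V)" by (rule is_vs_sum) simp_all
  have lhs_eq: "?lhs (xd k) t = coord V k t" for k t by (simp add: coord_def)
  have lhs_bil: "bilinear_map T V V (\<lambda>\<alpha>0 \<alpha>1. sH (\<alpha>0 \<gamma>) \<alpha>1)" for \<gamma>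
    by (simp add: bilinear_map_def linear_map_def tangent_space_def vs.scale_left_distrib vs.scale_right_distrib mult.commute)
  have ok: "?lhs \<gamma> ?t = ?rhs \<gamma>" if \<gamma>: "\<gamma> \<in> car \<Gamma>" for \<gamma>
  proof -
    have "?rhs \<gamma> = (\<Sum>k=1..n. sH (x k \<gamma>) (tc \<alpha> k))"
      using linear_coinv_expand[OF rhs_lin \<gamma>] by (simp add: rhs_xd)
    also have "... = ?lhs \<gamma> ?t"
      by (rule tlift_sum[symmetric, OF _ _ _ lhs_bil]) simp_all
    finally show ?thesis by simp
  qed
  show ?thesis
    unfolding tangent_coact_def
  proof (rule the_equality)
    show "?t \<in> car (T \<otimes> V) \<and> (\<forall>\<gamma>\<in>car \<Gamma>. ?lhs \<gamma> ?t = ?rhs \<gamma>)" using mem ok by blast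
    \<comment> \<open>A tensor in \<open>T \<otimes> H\<close> is determined by its evaluations at the \<open>x\<^sup>k\<close>.\<close>
    fix t assume t: "t \<in> car (T \<otimes> V) \<and> (\<forall>\<gamma>\<in>car \<Gamma>. ?lhs \<gamma> t = ?rhs \<gamma>)"
    then have "t = (\<Sum>j=1..n. tens T V (x j) (coord V j t))"
      using tangent_tensor_expand[of V t] by simp
    also have "... = ?t"
    proof (rule sum.cong[OF refl])
      fix k assume k: "k \<in> {1..n}"
      have "coord V k t = tc \<alpha> k"
        using t rhs_xd[OF k] xd_mem[OF k] unfolding lhs_eq[symmetric] by simp
      then show "tens T V (x k) (coord V k t) = tens T V (x k) (tc \<alpha> k)" by simp
    qed
    finally show "t = ?t" .
  qed
qed

abbreviation "\<Omega>H \<equiv> tens \<Omega> V"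

text \<open>
  Left multiplication on the second factor makes \<open>\<Omega> \<otimes> H\<close> an \<open>H\<close>-module. Systems of equations with coefficients in \<open>H\<close> are solved in
  this module.
\<close>

definition rmul where "rmul h = tlift \<Omega> V (\<lambda>\<omega>0 \<omega>1. \<Omega>H \<omega>0 (h * \<omega>1))"

lemma bil_rmul: "bilinear_map \<Omega> V (\<Omega> \<otimes> V) (\<lambda>\<omega>0 \<omega>1. \<Omega>H \<omega>0 (h * \<omega>1))"
  by (intro bilinear_mapI linear_map_tens linear_map_ident) simp_all

lemma linear_rmul: "linear_map (\<Omega> \<otimes> V) (\<Omega> \<otimes> V) (rmul h)"
  unfolding rmul_def by (rule tlift_universal(1)[OF _ _ _ bil_rmul]) simp_all

lemma rmul_tens: "\<omega> \<in> car \<Omega> \<Longrightarrow> rmul h (\<Omega>H \<omega> a) = \<Omega>H \<omega> (h * a)"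
  unfolding rmul_def by (rule tlift_universal(2)[OF _ _ _ bil_rmul]) simp_all

lemma linear_rmul_arg: "u \<in> car (\<Omega> \<otimes> V) \<Longrightarrow> linear_map V (\<Omega> \<otimes> V) (\<lambda>h. rmul h u)"
  unfolding rmul_def by (rule linear_map_tlift_param) (intro linear_map_tens | simp)+

lemma rmul_rmul: "u \<in> car (\<Omega> \<otimes> V) \<Longrightarrow> rmul h (rmul h' u) = rmul (h * h') u"
  by (rule linear_ext_tens[OF _ _ linear_map_comp[OF linear_rmul linear_rmul] linear_rmul])
    (simp_all add: rmul_tens mult.assoc)

lemma rmul_one: "u \<in> car (\<Omega> \<otimes> V) \<Longrightarrow> rmul 1 u = u"
  by (rule linear_ext_tens[OF _ _ linear_rmul linear_map_ident]) (simp_all add: rmul_tens)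

abbreviation "TFH \<equiv> tens TF V"

definition lead where "lead k = tlift \<Omega> V (\<lambda>\<omega> h. TFH (tens T \<Omega> (x k) \<omega>) h)"
definition tcoord where "tcoord k = tlift TF V (\<lambda>u h. \<Omega>H (coord \<Omega> k u) h)"

lemma lead:
  assumes k: "k \<in> {1..n}"
  shows "linear_map (\<Omega> \<otimes> V) (TF \<otimes> V) (lead k)" "\<omega> \<in> car \<Omega> \<Longrightarrow> lead k (\<Omega>H \<omega> h) = TFH (tens T \<Omega> (x k) \<omega>) h"
proof -
  have bil: "bilinear_map \<Omega> V (TF \<otimes> V) (\<lambda>\<omega> h. TFH (tens T \<Omega> (x k) \<omega>) h)"
    by (intro bilinear_mapI linear_map_tens linear_map_ident) (simp_all add: x_mem[OF k])
  show "linear_map (\<Omega> \<otimes> V) (TF \<otimes> V) (lead k)" unfolding lead_def by (rule tlift_universal(1)[OF _ _ _ bil]) simp_all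
  show "\<omega> \<in> car \<Omega> \<Longrightarrow> lead k (\<Omega>H \<omega> h) = TFH (tens T \<Omega> (x k) \<omega>) h"
    unfolding lead_def by (rule tlift_universal(2)[OF _ _ _ bil]) simp_all
qed

lemma tcoord:
  assumes k: "k \<in> {1..n}"
  shows "linear_map (TF \<otimes> V) (\<Omega> \<otimes> V) (tcoord k)"
    "u \<in> car TF \<Longrightarrow> tcoord k (TFH u h) = \<Omega>H (coord \<Omega> k u) h"
proof -
  have bil: "bilinear_map TF V (\<Omega> \<otimes> V) (\<lambda>u h. \<Omega>H (coord \<Omega> k u) h)"
    by (intro bilinear_mapI linear_map_tens linear_map_ident coord(1)[OF _ k]) (simp_all add: coord_mem[OF _ k])
  show "linear_map (TF \<otimes> V) (\<Omega> \<otimes> V) (tcoord k)" unfolding tcoord_def by (rule tlift_universal(1)[OF _ _ _ bil]) simp_all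
  show "u \<in> car TF \<Longrightarrow> tcoord k (TFH u h) = \<Omega>H (coord \<Omega> k u) h"
    unfolding tcoord_def by (rule tlift_universal(2)[OF _ _ _ bil]) simp_all
qed

lemma tcoord_lead:
  assumes k: "k \<in> {1..n}" and l: "l \<in> {1..n}" and u: "u \<in> car (\<Omega> \<otimes> V)"
  shows "tcoord l (lead k u) = (if k = l then u else 0)"
proof (rule linear_ext_tens[OF _ _ linear_map_comp[OF lead(1)[OF k] tcoord(1)[OF l]] _ _ u])
  interpret W: vector_space "scl \<Omega>" by (rule is_vs_vector_space) simp
  show "linear_map (\<Omega> \<otimes> V) (\<Omega> \<otimes> V) (\<lambda>u. if k = l then u else 0)"
    by (simp add: linear_map_def is_vs_mem)
  show "tcoord l (lead k (\<Omega>H \<omega> h)) = (if k = l then \<Omega>H \<omega> h else 0)" if "\<omega> \<in> car \<Omega>" for \<omega> h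
    using that k l dual by (simp add: lead(2) tcoord(2) coord(2))
qed simp_all

lemma tangent_forms_coact_eq:
  assumes \<phi>: "\<And>j. j \<in> {1..n} \<Longrightarrow> \<phi> j \<in> car \<Omega>"
  shows "tangent_forms_coact H L B E (\<Sum>j=1..n. tens T \<Omega> (x j) (\<phi> j)) =
    (\<Sum>j=1..n. \<Sum>k=1..n. lead k (rmul (inv S (mc j k)) (\<rho> (\<phi> j))))"
proof -
  let ?G = "\<lambda>\<alpha> \<omega>. tlift T V (\<lambda>\<alpha>0 \<alpha>1. tlift \<Omega> V (\<lambda>\<omega>0 \<omega>1.
         TFH (tens T \<Omega> \<alpha>0 \<omega>0) (\<alpha>1 * \<omega>1)) (\<rho> \<omega>)) (tangent_coact H L \<alpha>)"
  have G: "?G \<alpha> \<omega> = (\<Sum>k=1..n. lead k (rmul (tc \<alpha> k) (\<rho> \<omega>)))" if \<alpha>: "\<alpha> \<in> car T" and \<omega>: "\<omega> \<in> car \<Omega>" for \<alpha> \<omega>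
  proof -
    have bil: "bilinear_map T V (TF \<otimes> V) (\<lambda>\<alpha>0 \<alpha>1. tlift \<Omega> V (\<lambda>\<omega>0 \<omega>1. TFH (tens T \<Omega> \<alpha>0 \<omega>0) (\<alpha>1 * \<omega>1)) (\<rho> \<omega>))"
      by (intro bilinear_mapI linear_map_tlift_param coact_mem \<omega>)
        (intro linear_map_tens linear_map_ident | simp)+
    have "?G \<alpha> \<omega> = (\<Sum>k=1..n. tlift \<Omega> V (\<lambda>\<omega>0 \<omega>1. TFH (tens T \<Omega> (x k) \<omega>0) (tc \<alpha> k * \<omega>1)) (\<rho> \<omega>))"
      unfolding tangent_coact_eq[OF \<alpha>] by (rule tlift_sum[OF _ _ _ bil]) simp_all
    also have "... = (\<Sum>k=1..n. lead k (rmul (tc \<alpha> k) (\<rho> \<omega>)))"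
    proof (rule sum.cong[OF refl])
      fix k assume k: "k \<in> {1..n}"
      have "lead k (rmul (tc \<alpha> k) (\<rho> \<omega>)) = tlift \<Omega> V (\<lambda>\<omega>0 \<omega>1. lead k (\<Omega>H \<omega>0 (tc \<alpha> k * \<omega>1))) (\<rho> \<omega>)"
        unfolding rmul_def by (rule linear_tlift[OF _ _ coact_mem[OF \<omega>] lead(1)[OF k]]) simp_all
      also have "... = tlift \<Omega> V (\<lambda>\<omega>0 \<omega>1. TFH (tens T \<Omega> (x k) \<omega>0) (tc \<alpha> k * \<omega>1)) (\<rho> \<omega>)"
        by (rule tlift_cong[OF _ coact_mem[OF \<omega>]]) (simp_all add: lead(2)[OF k])
      finally show "tlift \<Omega> V (\<lambda>\<omega>0 \<omega>1. TFH (tens T \<Omega> (x k) \<omega>0) (tc \<alpha> k * \<omega>1)) (\<rho> \<omega>) = lead k (rmul (tc \<alpha> k) (\<rho> \<omega>))" by simp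
    qed
    finally show ?thesis .
  qed
  have bilG: "bilinear_map T \<Omega> (TF \<otimes> V) (\<lambda>\<alpha> \<omega>. \<Sum>k=1..n. lead k (rmul (tc \<alpha> k) (\<rho> \<omega>)))"
  proof (intro bilinear_mapI linear_map_sum_fun)
    fix k \<alpha> assume k: "k \<in> {1..n}"
    show "linear_map \<Omega> (TF \<otimes> V) (\<lambda>\<omega>. lead k (rmul (tc \<alpha> k) (\<rho> \<omega>)))"
      by (rule linear_map_comp[OF linear_map_comp[OF linear_coact linear_rmul] lead(1)[OF k]])
  next
    fix k \<omega> assume k: "k \<in> {1..n}" and \<omega>: "\<omega> \<in> car \<Omega>"
    show "linear_map T (TF \<otimes> V) (\<lambda>\<alpha>. lead k (rmul (tc \<alpha> k) (\<rho> \<omega>)))"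
      by (rule linear_map_comp[OF linear_map_comp[OF linear_tc linear_rmul_arg[OF coact_mem[OF \<omega>]]] lead(1)[OF k]])
  qed simp_all
  have mem: "(\<Sum>j=1..n. tens T \<Omega> (x j) (\<phi> j)) \<in> car TF" by (rule is_vs_sum) (simp_all add: \<phi>)
  have "tangent_forms_coact H L B E (\<Sum>j=1..n. tens T \<Omega> (x j) (\<phi> j)) =
      tlift T \<Omega> (\<lambda>\<alpha> \<omega>. \<Sum>k=1..n. lead k (rmul (tc \<alpha> k) (\<rho> \<omega>))) (\<Sum>j=1..n. tens T \<Omega> (x j) (\<phi> j))"
    unfolding tangent_forms_coact_def by (rule tlift_cong[OF _ mem G]) simp_all
  also have "... = (\<Sum>j=1..n. \<Sum>k=1..n. lead k (rmul (tc (x j) k) (\<rho> (\<phi> j))))"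
    by (rule tlift_sum[OF _ _ _ bilG]) (simp_all add: \<phi>)
  also have "... = (\<Sum>j=1..n. \<Sum>k=1..n. lead k (rmul (inv S (mc j k)) (\<rho> (\<phi> j))))"
    by (intro sum.cong refl) (simp add: tc_x)
  finally show ?thesis .
qed

text \<open>
  Coinvariance says that \<open>\<Sum>\<^sub>j S\<^sup>-\<^sup>1(m\<^sub>j\<^sub>k) \<rho>(\<phi>\<^sub>j) = \<phi>\<^sub>k \<otimes> 1\<close> for all \<open>k\<close>, with \<open>H\<close> acting on the second factor. This
  linear system is solved by multiplying with \<open>m\<^sub>k\<^sub>l\<close> and summing over \<open>k\<close>; conversely, the solution is
  substituted. Each direction uses one of the two relations in \<open>mc_inverse\<close>.
\<close>

lemma coinvariant_iff:
  assumes \<phi>: "\<And>j. j \<in> {1..n} \<Longrightarrow> \<phi> j \<in> car \<Omega>"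
  defines "t \<equiv> (\<Sum>j=1..n. tens T \<Omega> (x j) (\<phi> j))"
  shows "tangent_forms_coact H L B E t = TFH t 1 \<longleftrightarrow>
    (\<forall>k\<in>{1..n}. \<rho> (\<phi> k) = (\<Sum>l=1..n. \<Omega>H (\<phi> l) (mc l k)))"
proof -
  have \<rho>\<phi>: "\<rho> (\<phi> j) \<in> car (\<Omega> \<otimes> V)" if "j \<in> {1..n}" for j by (rule coact_mem[OF \<phi>[OF that]])
  have rm: "rmul h u \<in> car (\<Omega> \<otimes> V)" if "u \<in> car (\<Omega> \<otimes> V)" for h u
    by (rule linear_mapD(1)[OF linear_rmul that])
  let ?R = "\<lambda>k. \<Sum>j=1..n. rmul (inv S (mc j k)) (\<rho> (\<phi> j))"
  have "tangent_forms_coact H L B E t = (\<Sum>k=1..n. \<Sum>j=1..n. lead k (rmul (inv S (mc j k)) (\<rho> (\<phi> j))))"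
    unfolding t_def by (subst sum.swap) (rule tangent_forms_coact_eq[OF \<phi>])
  also have "... = (\<Sum>k=1..n. lead k (?R k))"
    by (intro sum.cong refl linear_map_sum[symmetric, OF _ lead(1)] rm \<rho>\<phi>) simp_all
  finally have L: "tangent_forms_coact H L B E t = (\<Sum>k=1..n. lead k (?R k))" .
  have R: "TFH t 1 = (\<Sum>k=1..n. lead k (\<Omega>H (\<phi> k) 1))"
    by (simp add: t_def tens_sum lead(2) \<phi>)
  have coord: "tcoord l (\<Sum>k=1..n. lead k (f k)) = f l" if l: "l \<in> {1..n}" and f: "\<And>k. k \<in> {1..n} \<Longrightarrow> f k \<in> car (\<Omega> \<otimes> V)" for l f
  proof -
    have "tcoord l (\<Sum>k=1..n. lead k (f k)) = (\<Sum>k=1..n. tcoord l (lead k (f k)))"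
      by (rule linear_map_sum[OF _ tcoord(1)[OF l]]) (auto intro!: linear_mapD(1)[OF lead(1)] f)
    also have "... = (\<Sum>k=1..n. if k = l then f k else 0)"
      by (intro sum.cong refl tcoord_lead[OF _ l] f)
    finally show ?thesis using l by simp
  qed
  have "tangent_forms_coact H L B E t = TFH t 1 \<longleftrightarrow> (\<forall>k\<in>{1..n}. ?R k = \<Omega>H (\<phi> k) 1)"
  proof -
    have Rm: "?R k \<in> car (\<Omega> \<otimes> V)" for k by (rule is_vs_sum) (auto intro!: rm \<rho>\<phi>)
    have "?R k = \<Omega>H (\<phi> k) 1" if "tangent_forms_coact H L B E t = TFH t 1" "k \<in> {1..n}" for k
      using coord[of k ?R] coord[of k "\<lambda>k. \<Omega>H (\<phi> k) 1"] that \<phi> Rm unfolding L R by simp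
    then show ?thesis unfolding L R by auto
  qed
  also have "... \<longleftrightarrow> (\<forall>k\<in>{1..n}. \<rho> (\<phi> k) = (\<Sum>l=1..n. \<Omega>H (\<phi> l) (mc l k)))"
  proof
    assume *: "\<forall>k\<in>{1..n}. ?R k = \<Omega>H (\<phi> k) 1"
    show "\<forall>k\<in>{1..n}. \<rho> (\<phi> k) = (\<Sum>l=1..n. \<Omega>H (\<phi> l) (mc l k))"
    proof
      fix l assume l: "l \<in> {1..n}"
      have "(\<Sum>k=1..n. \<Omega>H (\<phi> k) (mc k l)) = (\<Sum>k=1..n. rmul (mc k l) (\<Omega>H (\<phi> k) 1))"
        by (rule sum.cong) (simp_all add: rmul_tens \<phi>)
      also have "... = (\<Sum>k=1..n. rmul (mc k l) (\<Sum>j=1..n. rmul (inv S (mc j k)) (\<rho> (\<phi> j))))"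
        by (rule sum.cong) (simp_all only: bspec[OF *])
      also have "... = (\<Sum>k=1..n. \<Sum>j=1..n. rmul (mc k l * inv S (mc j k)) (\<rho> (\<phi> j)))"
      proof (rule sum.cong[OF refl])
        fix k
        have "rmul (mc k l) (\<Sum>j=1..n. rmul (inv S (mc j k)) (\<rho> (\<phi> j))) =
            (\<Sum>j=1..n. rmul (mc k l) (rmul (inv S (mc j k)) (\<rho> (\<phi> j))))"
          by (rule linear_map_sum[OF _ linear_rmul]) (auto intro!: rm \<rho>\<phi>)
        also have "... = (\<Sum>j=1..n. rmul (mc k l * inv S (mc j k)) (\<rho> (\<phi> j)))"
          by (intro sum.cong refl rmul_rmul \<rho>\<phi>)
        finally show "rmul (mc k l) (\<Sum>j=1..n. rmul (inv S (mc j k)) (\<rho> (\<phi> j))) =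
            (\<Sum>j=1..n. rmul (mc k l * inv S (mc j k)) (\<rho> (\<phi> j)))" .
      qed
      also have "... = (\<Sum>j=1..n. \<Sum>k=1..n. rmul (mc k l * inv S (mc j k)) (\<rho> (\<phi> j)))"
        by (rule sum.swap)
      also have "... = (\<Sum>j=1..n. rmul (\<Sum>k=1..n. mc k l * inv S (mc j k)) (\<rho> (\<phi> j)))"
        by (intro sum.cong refl linear_map_sum[symmetric, OF _ linear_rmul_arg[OF \<rho>\<phi>]]) simp_all
      also have "... = (\<Sum>j=1..n. if j = l then \<rho> (\<phi> j) else 0)"
      proof (rule sum.cong[OF refl])
        fix j assume j: "j \<in> {1..n}"
        have "rmul 0 (\<rho> (\<phi> j)) = 0" by (rule linear_map_zero[OF _ linear_rmul_arg[OF \<rho>\<phi>[OF j]]]) simp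
        then show "rmul (\<Sum>k=1..n. mc k l * inv S (mc j k)) (\<rho> (\<phi> j)) = (if j = l then \<rho> (\<phi> j) else 0)"
          unfolding mc_inverse(2)[OF j l] using rmul_one[OF \<rho>\<phi>[OF j]] by (cases "j = l") simp_all
      qed
      also have "... = \<rho> (\<phi> l)" using l by simp
      finally show "\<rho> (\<phi> l) = (\<Sum>k=1..n. \<Omega>H (\<phi> k) (mc k l))" by simp
    qed
  next
    assume r: "\<forall>k\<in>{1..n}. \<rho> (\<phi> k) = (\<Sum>l=1..n. \<Omega>H (\<phi> l) (mc l k))"
    show "\<forall>k\<in>{1..n}. ?R k = \<Omega>H (\<phi> k) 1"
    proof
      fix k assume k: "k \<in> {1..n}"
      have "?R k = (\<Sum>j=1..n. \<Sum>l=1..n. \<Omega>H (\<phi> l) (inv S (mc j k) * mc l j))"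
      proof (rule sum.cong[OF refl])
        fix j assume j: "j \<in> {1..n}"
        have "rmul (inv S (mc j k)) (\<rho> (\<phi> j)) = (\<Sum>l=1..n. rmul (inv S (mc j k)) (\<Omega>H (\<phi> l) (mc l j)))"
          unfolding bspec[OF r j] by (rule linear_map_sum[OF _ linear_rmul]) (simp_all add: \<phi>)
        then show "rmul (inv S (mc j k)) (\<rho> (\<phi> j)) = (\<Sum>l=1..n. \<Omega>H (\<phi> l) (inv S (mc j k) * mc l j))"
          by (simp add: rmul_tens \<phi>)
      qed
      also have "... = (\<Sum>l=1..n. \<Sum>j=1..n. \<Omega>H (\<phi> l) (inv S (mc j k) * mc l j))"
        by (rule sum.swap)
      also have "... = (\<Sum>l=1..n. if l = k then \<Omega>H (\<phi> l) 1 else 0)"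
        unfolding tens_sum(2)[symmetric] by (intro sum.cong refl) (subst mc_inverse(1)[OF _ k], simp_all)
      also have "... = \<Omega>H (\<phi> k) 1" using k by simp
      finally show "?R k = \<Omega>H (\<phi> k) 1" .
    qed
  qed
  finally show ?thesis .
qed

end

context based_calculus begin

section \<open>Connections and connection forms\<close>

abbreviation "form \<equiv> form_of_connection H L B E n x xd"
abbreviation "Conn \<equiv> connections H L B E"
abbreviation "e \<equiv> cp_one H B"

lemma e_mem [simp]: "e \<in> car A"
  by (simp add: cp_one_def)

text \<open>
  It suffices to compare linear maps on \<open>A \<otimes> \<Gamma>\<close> on the elements \<open>(b \<otimes> h) \<otimes> x\<^sup>k\<close>; the coactions are explicit on
  these.
\<close>

lemma hor_ext:
  assumes f: "linear_map Hor X f" and g: "linear_map Hor X' g"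
    and eq: "\<And>b h k. k \<in> {1..n} \<Longrightarrow> f (hg (EH.bh b h) (xd k)) = g (hg (EH.bh b h) (xd k))"
    and s: "scl X = scl X'" and t: "t \<in> car Hor"
  shows "f t = g t"
proof (rule linear_ext_tens[OF _ _ f g _ t])
  have 1: "f (hg a (xd k)) = g (hg a (xd k))" if a: "a \<in> car A" and k: "k \<in> {1..n}" for a k
    by (rule linear_ext_tens[OF _ _ linear_map_comp[OF _ f] linear_map_comp[OF _ g] _ a])
      (simp_all add: linear_map_tens[OF _ _ linear_map_ident] xd_mem[OF k] eq[OF k])
  fix a \<gamma> assume a: "a \<in> car A" and \<gamma>: "\<gamma> \<in> car \<Gamma>"
  have expand: "F (hg a \<gamma>) = (\<Sum>k=1..n. scl Y (x k \<gamma>) (F (hg a (xd k))))" if F: "linear_map Hor Y F" for F :: "_ \<Rightarrow> 'x::ab_group_add" and Y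
  proof -
    have lin: "linear_map \<Gamma> Y (\<lambda>\<gamma>. F (hg a \<gamma>))"
      by (rule linear_map_comp[OF linear_map_tens(2)[OF _ _ linear_map_ident a] F]) simp_all
    show ?thesis by (rule linear_coinv_expand[OF lin \<gamma>])
  qed
  show "f (hg a \<gamma>) = g (hg a \<gamma>)"
    unfolding expand[OF f] expand[OF g] by (rule sum.cong) (simp_all add: 1 a s)
qed simp_all

lemma linear_cp_coact: "linear_map A (A \<otimes> V) (cp_coact H B)"
  and cp_coact_bh: "cp_coact H B (EH.bh b h) = sw2 H h (\<lambda>h1 h2. tens A V (EH.bh b h1) h2)"
proof -
  have bil: "bilinear_map (bspace B) V (A \<otimes> V) (\<lambda>b h. sw2 H h (\<lambda>h1 h2. tens A V (EH.bh b h1) h2))"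
    by (rule bilinear_map_codomain[OF bilinear_full]) (simp_all add: EH.sw2_mem)
  show "linear_map A (A \<otimes> V) (cp_coact H B)" unfolding cp_coact_def by (rule tlift_universal(1)[OF _ _ _ bil]) simp_all
  show "cp_coact H B (EH.bh b h) = sw2 H h (\<lambda>h1 h2. tens A V (EH.bh b h1) h2)"
    unfolding cp_coact_def by (rule tlift_universal(2)[OF _ _ _ bil]) simp_all
qed

lemma linear_hor_coact: "linear_map Hor (Hor \<otimes> V) (hor_coact H L B)"
  and hor_coact_bh: "k \<in> {1..n} \<Longrightarrow> hor_coact H L B (hg (EH.bh b h) (xd k)) =
    sw2 H h (\<lambda>h1 h2. \<Sum>l=1..n. tens Hor V (hg (EH.bh b h1) (xd l)) (h2 * mc l k))"
proof -
  let ?K = "\<lambda>a0 a1 \<gamma>. tlift \<Gamma> V (\<lambda>\<gamma>0 \<gamma>1. tens Hor V (hg a0 \<gamma>0) (a1 * \<gamma>1)) (rcoact L \<gamma>)"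
  have b0: "bilinear_map \<Gamma> V (Hor \<otimes> V) (\<lambda>\<gamma>0 \<gamma>1. tens Hor V (hg a0 \<gamma>0) (a1 * \<gamma>1))" if "a0 \<in> car A" for a0 a1
    by (intro bilinear_mapI linear_map_tens linear_map_ident) (simp_all add: that)
  have K\<gamma>: "linear_map \<Gamma> (Hor \<otimes> V) (?K a0 a1)" if "a0 \<in> car A" for a0 a1
    by (rule linear_map_comp[OF rcoact_linear tlift_universal(1)[OF _ _ _ b0[OF that]]]) simp_all
  have Ka: "bilinear_map A V (Hor \<otimes> V) (\<lambda>a0 a1. ?K a0 a1 \<gamma>)" if "\<gamma> \<in> car \<Gamma>" for \<gamma>
    by (intro bilinear_mapI linear_map_tlift_param rcoact_mem that)
      (intro linear_map_tens linear_map_ident | simp)+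
  have bil: "bilinear_map A \<Gamma> (Hor \<otimes> V) (\<lambda>a \<gamma>. tlift A V (\<lambda>a0 a1. ?K a0 a1 \<gamma>) (cp_coact H B a))"
  proof (rule bilinear_mapI)
    show "linear_map \<Gamma> (Hor \<otimes> V) (\<lambda>\<gamma>. tlift A V (\<lambda>a0 a1. ?K a0 a1 \<gamma>) (cp_coact H B a))" if a: "a \<in> car A" for a
      by (rule linear_map_tlift_param[OF _ _ linear_mapD(1)[OF linear_cp_coact a] K\<gamma>]) simp_all
    show "linear_map A (Hor \<otimes> V) (\<lambda>a. tlift A V (\<lambda>a0 a1. ?K a0 a1 \<gamma>) (cp_coact H B a))" if \<gamma>: "\<gamma> \<in> car \<Gamma>" for \<gamma>
      by (rule linear_map_comp[OF linear_cp_coact tlift_universal(1)[OF _ _ _ Ka[OF \<gamma>]]]) simp_all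
  qed
  show "linear_map Hor (Hor \<otimes> V) (hor_coact H L B)"
    unfolding hor_coact_def by (rule tlift_universal(1)[OF _ _ _ bil]) simp_all
  assume k: "k \<in> {1..n}"
  note Kl = Ka[OF xd_mem[OF k]]
  have "hor_coact H L B (hg (EH.bh b h) (xd k)) = tlift A V (\<lambda>a0 a1. ?K a0 a1 (xd k)) (cp_coact H B (EH.bh b h))"
    unfolding hor_coact_def by (rule tlift_universal(2)[OF _ _ _ bil]) (simp_all add: xd_mem[OF k])
  also have "... = sw2 H h (\<lambda>h1 h2. ?K (EH.bh b h1) h2 (xd k))"
    unfolding cp_coact_bh sw2_def
    by (subst linear_tlift[OF _ _ _ tlift_universal(1)[OF _ _ _ Kl]])
      (simp_all add: tlift_universal(2)[OF _ _ _ Kl])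
  also have "... = sw2 H h (\<lambda>h1 h2. \<Sum>l=1..n. tens Hor V (hg (EH.bh b h1) (xd l)) (h2 * mc l k))"
    by (subst tlift_rcoact_xd[OF k _ b0]) simp_all
  finally show "hor_coact H L B (hg (EH.bh b h) (xd k)) =
    sw2 H h (\<lambda>h1 h2. \<Sum>l=1..n. tens Hor V (hg (EH.bh b h1) (xd l)) (h2 * mc l k))" .
qed

lemma colinear_bh:
  assumes c: "linear_map Hor \<Omega> c"
  defines "D \<equiv> \<lambda>t. tlift Hor V (\<lambda>t0 t1. \<Omega>H (c t0) t1) (hor_coact H L B t)"
  shows "linear_map Hor (\<Omega> \<otimes> V) D"
    and "k \<in> {1..n} \<Longrightarrow> D (hg (EH.bh b h) (xd k)) = sw2 H h (\<lambda>h1 h2. \<Sum>l=1..n. \<Omega>H (c (hg (EH.bh b h1) (xd l))) (h2 * mc l k))"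
proof -
  have bil: "bilinear_map Hor V (\<Omega> \<otimes> V) (\<lambda>t0 t1. \<Omega>H (c t0) t1)"
    by (intro bilinear_mapI linear_map_tens linear_map_ident c) (simp_all add: linear_mapD(1)[OF c])
  have lin: "linear_map (Hor \<otimes> V) (\<Omega> \<otimes> V) (tlift Hor V (\<lambda>t0 t1. \<Omega>H (c t0) t1))"
    by (rule tlift_universal(1)[OF _ _ _ bil]) simp_all
  show "linear_map Hor (\<Omega> \<otimes> V) D" unfolding D_def by (rule linear_map_comp[OF linear_hor_coact lin])
  assume k: "k \<in> {1..n}"
  have mem: "(\<Sum>l=1..n. tens Hor V (hg (EH.bh b h1) (xd l)) (h2 * mc l k)) \<in> car (Hor \<otimes> V)" for h1 h2
    by (rule is_vs_sum) simp_all
  have "D (hg (EH.bh b h) (xd k)) = sw2 H h (\<lambda>h1 h2. tlift Hor V (\<lambda>t0 t1. \<Omega>H (c t0) t1)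
      (\<Sum>l=1..n. tens Hor V (hg (EH.bh b h1) (xd l)) (h2 * mc l k)))"
    unfolding D_def hor_coact_bh[OF k] sw2_def by (rule linear_tlift[OF _ _ _ lin]) (simp_all add: mem[simplified])
  also have "... = sw2 H h (\<lambda>h1 h2. \<Sum>l=1..n. \<Omega>H (c (hg (EH.bh b h1) (xd l))) (h2 * mc l k))"
    by (subst tlift_sum[OF _ _ _ bil]) simp_all
  finally show "D (hg (EH.bh b h) (xd k)) = sw2 H h (\<lambda>h1 h2. \<Sum>l=1..n. \<Omega>H (c (hg (EH.bh b h1) (xd l))) (h2 * mc l k))" .
qed

text \<open>
  The conditions on a connection form, coordinate by coordinate. As the vertical map takes values in \<open>A \<otimes> \<Gamma>\<close>, the element
  \<open>ver(\<phi>\<^sub>k)\<close> is determined by its pairings with the \<open>x\<^sub>i\<close>, and these are the coefficients at \<open>x\<^sub>k\<close> of the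
  normalisation condition for \<open>\<alpha> = x\<^sub>i\<close>.
\<close>

lemma connection_forms_iff:
  assumes \<phi>: "\<And>j. j \<in> {1..n} \<Longrightarrow> \<phi> j \<in> car \<Omega>"
  defines "t \<equiv> (\<Sum>j=1..n. tens T \<Omega> (x j) (\<phi> j))"
  shows "t \<in> connection_forms H L B E \<longleftrightarrow>
    (\<forall>k\<in>{1..n}. \<rho> (\<phi> k) = (\<Sum>l=1..n. \<Omega>H (\<phi> l) (mc l k))) \<and> (\<forall>k\<in>{1..n}. vr (\<phi> k) = hg e (xd k))"
proof -
  let ?F = "fundamental_field H L B E"
  have tmem: "t \<in> car TF" unfolding t_def by (rule is_vs_sum) (simp_all add: \<phi>)
  have bilF: "bilinear_map A \<Gamma> A (\<lambda>a \<gamma>. tscale (\<alpha> \<gamma>) a)" if "\<alpha> \<in> car T" for \<alpha>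
    using bilinear_scale(1)[OF is_vs_tprod tangent_linear[OF that], of "bspace B" V] by simp
  have linF: "linear_map \<Omega> A (?F \<alpha>)" if "\<alpha> \<in> car T" for \<alpha>
    unfolding fundamental_field_def
    by (rule linear_map_comp[OF linear_ver tlift_universal(1)[OF _ _ _ bilF[OF that]]]) simp_all
  have W: "tlift T \<Omega> (\<lambda>x \<omega>. tens T A x (?F \<alpha> \<omega>)) t = (\<Sum>j=1..n. tens T A (x j) (?F \<alpha> (\<phi> j)))" if "\<alpha> \<in> car T" for \<alpha>
  proof -
    have "bilinear_map T \<Omega> (T \<otimes> A) (\<lambda>x \<omega>. tens T A x (?F \<alpha> \<omega>))"
      by (intro bilinear_mapI linear_map_tens linear_map_ident linF that linear_mapD(1)[OF linF]) simp_all
    then show ?thesis unfolding t_def by (intro tlift_sum) (simp_all add: \<phi>)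
  qed
  have "(\<forall>\<alpha>\<in>car T. (\<Sum>j=1..n. tens T A (x j) (?F \<alpha> (\<phi> j))) = tens T A \<alpha> e) \<longleftrightarrow> (\<forall>k\<in>{1..n}. vr (\<phi> k) = hg e (xd k))"
  proof
    assume *: "\<forall>\<alpha>\<in>car T. (\<Sum>j=1..n. tens T A (x j) (?F \<alpha> (\<phi> j))) = tens T A \<alpha> e"
    show "\<forall>k\<in>{1..n}. vr (\<phi> k) = hg e (xd k)"
    proof
      fix k assume k: "k \<in> {1..n}"
      have F: "?F (x i) (\<phi> k) = (if i = k then e else 0)" if i: "i \<in> {1..n}" for i
      proof -
        have "?F (x i) (\<phi> k) = coord A k (\<Sum>j=1..n. tens T A (x j) (?F (x i) (\<phi> j)))"
          by (rule coord_sum[symmetric, OF _ k linear_mapD(1)[OF linF[OF x_mem[OF i]] \<phi>]]) simp_all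
        also have "... = coord A k (tens T A (x i) e)" using * x_mem[OF i] by simp
        also have "... = (if i = k then e else 0)"
          using dual i k by (simp add: coord(2)[OF _ k])
        finally show ?thesis .
      qed
      have "vr (\<phi> k) = (\<Sum>j=1..n. hg (tlift A \<Gamma> (\<lambda>a \<gamma>. scl A (x j \<gamma>) a) (vr (\<phi> k))) (xd j))"
        by (rule tens_expand(2)[OF _ _ tangent_linear[OF x_mem] xd_mem coinv_expand linear_mapD(1)[OF linear_ver \<phi>[OF k]]]) simp_all
      also have "... = (\<Sum>j=1..n. if j = k then hg e (xd j) else 0)"
        by (rule sum.cong) (use F in \<open>auto simp: fundamental_field_def\<close>)
      also have "... = hg e (xd k)" using k by simp
      finally show "vr (\<phi> k) = hg e (xd k)" .
    qed
  next
    assume v: "\<forall>k\<in>{1..n}. vr (\<phi> k) = hg e (xd k)"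
    show "\<forall>\<alpha>\<in>car T. (\<Sum>j=1..n. tens T A (x j) (?F \<alpha> (\<phi> j))) = tens T A \<alpha> e"
    proof
      fix \<alpha> assume \<alpha>: "\<alpha> \<in> car T"
      have "(\<Sum>j=1..n. tens T A (x j) (?F \<alpha> (\<phi> j))) = (\<Sum>j=1..n. tens T A (scl T (\<alpha> (xd j)) (x j)) e)"
      proof (rule sum.cong[OF refl])
        fix j assume j: "j \<in> {1..n}"
        have "?F \<alpha> (\<phi> j) = tscale (\<alpha> (xd j)) e"
          unfolding fundamental_field_def using v j
          by (simp add: tlift_universal(2)[OF _ _ _ bilF[OF \<alpha>]])
        then show "tens T A (x j) (?F \<alpha> (\<phi> j)) = tens T A (scl T (\<alpha> (xd j)) (x j)) e"
          using tens_simps(4)[of T A "x j" "\<alpha> (xd j)" e] by (simp add: tens_simps(3))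
      qed
      also have "... = tens T A (\<Sum>j=1..n. scl T (\<alpha> (xd j)) (x j)) e"
        by (rule tens_sum(1)[symmetric])
      also have "... = tens T A \<alpha> e" using tangent_expand[OF \<alpha>] by simp
      finally show "(\<Sum>j=1..n. tens T A (x j) (?F \<alpha> (\<phi> j))) = tens T A \<alpha> e" .
    qed
  qed
  then show ?thesis
    using coinvariant_iff[of \<phi>, OF \<phi>, folded t_def] tmem W by (simp add: connection_forms_def)
qed

lemma connectionD:
  assumes "c \<in> Conn"
  shows "linear_map Hor \<Omega> c" "a \<in> car A \<Longrightarrow> t \<in> car Hor \<Longrightarrow> c (hor_lact H L B a t) = lac a (c t)"
    "t \<in> car Hor \<Longrightarrow> \<rho> (c t) = tlift Hor V (\<lambda>t0 t1. \<Omega>H (c t0) t1) (hor_coact H L B t)"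
    "t \<in> car Hor \<Longrightarrow> vr (c t) = t"
  using assms by (simp_all add: connections_def)

lemma form_of_connection_mem:
  assumes c: "c \<in> Conn"
  shows "form c \<in> connection_forms H L B E"
proof -
  note lin = connectionD(1)[OF c]
  define \<phi> where "\<phi> j = c (hg e (xd j))" for j
  have hm: "hg e (xd k) \<in> car Hor" if "k \<in> {1..n}" for k using that by simp
  have \<phi>: "\<phi> j \<in> car \<Omega>" if "j \<in> {1..n}" for j
    unfolding \<phi>_def by (rule linear_mapD(1)[OF lin hm[OF that]])
  have "\<rho> (\<phi> k) = (\<Sum>l=1..n. \<Omega>H (\<phi> l) (mc l k))" if k: "k \<in> {1..n}" for k
  proof -
    have cm: "c (hg (EH.bh 1 h1) (xd l)) \<in> car \<Omega>" if "l \<in> {1..n}" for l h1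
      by (rule linear_mapD(1)[OF lin tens_mem[OF _ xd_mem[OF that]]]) simp
    \<comment> \<open>Colinearity at \<open>1 \<otimes> x\<^sup>k\<close>, where the coproduct of \<open>1\<close> is \<open>1 \<otimes> 1\<close>.\<close>
    have "\<rho> (\<phi> k) = sw2 H 1 (\<lambda>h1 h2. \<Sum>l=1..n. \<Omega>H (c (hg (EH.bh 1 h1) (xd l))) (h2 * mc l k))"
      using connectionD(3)[OF c hm[OF k]] colinear_bh(2)[OF lin k, of 1 1] by (simp add: \<phi>_def cp_one_def)
    also have "... = (\<Sum>l=1..n. \<Omega>H (c (hg (EH.bh 1 1) (xd l))) (1 * mc l k))"
    proof (rule sw2_one[OF vector_space_tscale])
      show "lin sH tscale (\<lambda>h1. \<Sum>l=1..n. \<Omega>H (c (hg (EH.bh 1 h1) (xd l))) (h2 * mc l k))" for h2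
        by (rule linear_map_weaken[where W = "\<Omega> \<otimes> V"], rule linear_map_sum_fun, simp,
            rule linear_map_tens(1), simp, simp, rule linear_map_comp[OF _ lin],
            rule linear_map_tens(1), simp, simp, rule linear_map_tens(2)[OF _ _ linear_map_ident]) simp_all
      show "lin sH tscale (\<lambda>h2. \<Sum>l=1..n. \<Omega>H (c (hg (EH.bh 1 h1) (xd l))) (h2 * mc l k))" for h1
        by (rule linear_map_weaken[where W = "\<Omega> \<otimes> V"], rule linear_map_sum_fun, simp,
            rule linear_map_tens(2)) (simp_all add: cm)
    qed
    finally show ?thesis by (simp add: \<phi>_def cp_one_def)
  qed
  moreover have "vr (\<phi> k) = hg e (xd k)" if "k \<in> {1..n}" for k
    unfolding \<phi>_def by (rule connectionD(4)[OF c hm[OF that]])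
  ultimately show ?thesis
    using connection_forms_iff[of \<phi>, OF \<phi>] by (simp add: form_of_connection_def \<phi>_def)
qed

text \<open>
  A connection is determined by its values on \<open>1 \<otimes> x\<^sup>k\<close>, since \<open>a \<otimes> x\<^sup>k = a(1 \<otimes> x\<^sup>k)\<close>.
\<close>

lemma connection_hg:
  assumes c: "c \<in> Conn" and a: "a \<in> car A" and k: "k \<in> {1..n}"
  shows "c (hg a (xd k)) = lac a (c (hg e (xd k)))"
proof -
  have "hor_lact H L B a (hg e (xd k)) = hg a (xd k)"
    by (simp add: hor_lact_tens a xd_mem[OF k] cp_mult_one)
  then show ?thesis using connectionD(2)[OF c a, of "hg e (xd k)"] xd_mem[OF k] by simp
qed

lemma form_of_connection_inj: "inj_on (form) (Conn)"
proof (rule inj_onI)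
  fix c c' assume c: "c \<in> Conn" and c': "c' \<in> Conn"
    and eq: "form c = form c'"
  have mem: "d (hg e (xd j)) \<in> car \<Omega>" if "j \<in> {1..n}" "d \<in> Conn" for j d
    by (rule linear_mapD(1)[OF connectionD(1)[OF that(2)]]) (simp add: xd_mem[OF that(1)])
  have e: "c (hg e (xd k)) = c' (hg e (xd k))" if k: "k \<in> {1..n}" for k
  proof -
    have "coord \<Omega> k (form d) = d (hg e (xd k))" if "d \<in> Conn" for d
      unfolding form_of_connection_def by (rule coord_sum[OF is_vs_forms k mem[OF _ that]])
    then show ?thesis using eq c c' by metis
  qed
  have "c t = c' t" if "t \<in> car Hor" for t
  proof (rule hor_ext[OF connectionD(1)[OF c] connectionD(1)[OF c'] _ refl that])
    fix b h k assume k: "k \<in> {1..n}"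
    have bh: "EH.bh b h \<in> car A" by simp
    show "c (hg (EH.bh b h) (xd k)) = c' (hg (EH.bh b h) (xd k))"
      using connection_hg[OF c bh k] connection_hg[OF c' bh k] e[OF k] by simp
  qed
  moreover have "c \<in> car Hor \<rightarrow>\<^sub>E car \<Omega>" "c' \<in> car Hor \<rightarrow>\<^sub>E car \<Omega>"
    using c c' by (simp_all add: connections_def)
  ultimately show "c = c'" by (intro PiE_ext)
qed

text \<open>
  All conditions on \<open>c\<close> compare linear maps on \<open>A \<otimes> \<Gamma>\<close>, so they are checked on \<open>(b \<otimes> h) \<otimes> x\<^sup>k\<close>, where \<open>c\<close> is the action on
  \<open>\<phi>\<^sub>k\<close>. They reduce to associativity of the action, to its compatibility with the coaction, and to left linearity of the vertical
  map.
\<close>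

lemma connection_of_form:
  assumes \<phi>: "\<And>j. j \<in> {1..n} \<Longrightarrow> \<phi> j \<in> car \<Omega>"
    and t: "(\<Sum>j=1..n. tens T \<Omega> (x j) (\<phi> j)) \<in> connection_forms H L B E"
  defines "c \<equiv> connection_of_form H L B E n x \<phi>"
  shows "c \<in> Conn"
    and "form c = (\<Sum>j=1..n. tens T \<Omega> (x j) (\<phi> j))"
    and "a \<in> car A \<Longrightarrow> \<gamma> \<in> car \<Gamma> \<Longrightarrow> c (hg a \<gamma>) = (\<Sum>j=1..n. scl \<Omega> (x j \<gamma>) (lac a (\<phi> j)))"
proof -
  interpret W: vector_space "scl \<Omega>" by (rule is_vs_vector_space) simp
  have col: "\<rho> (\<phi> k) = (\<Sum>l=1..n. \<Omega>H (\<phi> l) (mc l k))" and ve: "vr (\<phi> k) = hg e (xd k)" if "k \<in> {1..n}" for k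
    using connection_forms_iff[of \<phi>, OF \<phi>] t that by blast+
  let ?F = "\<lambda>a \<gamma>. \<Sum>j=1..n. scl \<Omega> (x j \<gamma>) (lac a (\<phi> j))"
  have bil: "bilinear_map A \<Gamma> \<Omega> ?F"
  proof (intro bilinear_mapI linear_map_sum_fun is_vs_forms)
    show "linear_map \<Gamma> \<Omega> (\<lambda>\<gamma>. scl \<Omega> (x j \<gamma>) (lac a (\<phi> j)))" if "a \<in> car A" "j \<in> {1..n}" for a j
      by (rule bilinear_mapD(1)[OF bilinear_scale(1)[OF is_vs_forms tangent_linear[OF x_mem[OF that(2)]]] lact_mem[OF that(1) \<phi>[OF that(2)]]])
    show "linear_map A \<Omega> (\<lambda>a. scl \<Omega> (x j \<gamma>) (lac a (\<phi> j)))" if "j \<in> {1..n}" for \<gamma> j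
      by (rule linear_map_scale[OF is_vs_forms bilinear_mapD(2)[OF bilinear_lact \<phi>[OF that]]])
  qed
  have c_eq: "c u = tlift A \<Gamma> ?F u" if "u \<in> car Hor" for u
    using that by (simp only: c_def connection_of_form_def restrict_apply' if_True)
  have lin: "linear_map Hor \<Omega> c"
    by (rule linear_map_cong[OF tlift_universal(1)[OF _ _ _ bil] _ c_eq]) simp_all
  show val: "c (hg a \<gamma>) = ?F a \<gamma>" if "a \<in> car A" "\<gamma> \<in> car \<Gamma>" for a \<gamma>
    unfolding c_eq[OF tens_mem[OF that]] by (rule tlift_universal(2)[OF _ _ _ bil that]) simp_all
  have vk: "c (hg a (xd k)) = lac a (\<phi> k)" if a: "a \<in> car A" and k: "k \<in> {1..n}" for a k
  proof -
    have "c (hg a (xd k)) = (\<Sum>j=1..n. if j = k then lac a (\<phi> j) else 0)"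
      unfolding val[OF a xd_mem[OF k]] by (rule sum.cong) (use dual k in auto)
    then show ?thesis using k by simp
  qed
  have "c (hor_lact H L B a u) = lac a (c u)" if a: "a \<in> car A" and u: "u \<in> car Hor" for a u
  proof (rule hor_ext[OF linear_map_comp[OF bilinear_mapD(1)[OF bilinear_hor_lact a] lin]
        linear_map_comp[OF lin bilinear_mapD(1)[OF bilinear_lact a]] _ refl u])
    fix b h k assume k: "k \<in> {1..n}"
    have m: "cp_mult H B a (EH.bh b h) \<in> car A"
      by (rule linear_mapD(1)[OF bilinear_mapD(1)[OF bilinear_cp_mult a]]) simp
    show "c (hor_lact H L B a (hg (EH.bh b h) (xd k))) = lac a (c (hg (EH.bh b h) (xd k)))"
      using hor_lact_tens[OF a _ xd_mem[OF k], of "EH.bh b h"] vk[OF m k] vk[OF _ k, of "EH.bh b h"] lact_assoc[OF a _ \<phi>[OF k], of "EH.bh b h"]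
      by simp
  qed
  moreover have "\<rho> (c u) = tlift Hor V (\<lambda>t0 t1. \<Omega>H (c t0) t1) (hor_coact H L B u)" if u: "u \<in> car Hor" for u
  proof (rule hor_ext[OF linear_map_comp[OF lin linear_coact] colinear_bh(1)[OF lin] _ refl u])
    fix b h k assume k: "k \<in> {1..n}"
    have bh: "EH.bh b p \<in> car A" for p by simp
    have "tlift \<Omega> V (\<lambda>\<omega>0 a. \<Omega>H (lac (EH.bh b p) \<omega>0) (q * a)) (\<Sum>l=1..n. \<Omega>H (\<phi> l) (mc l k)) =
        (\<Sum>l=1..n. \<Omega>H (lac (EH.bh b p) (\<phi> l)) (q * mc l k))" for p q
    proof (rule tlift_sum)
      show "bilinear_map \<Omega> V (\<Omega> \<otimes> V) (\<lambda>\<omega>0 a. \<Omega>H (lac (EH.bh b p) \<omega>0) (q * a))"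
        by (intro bilinear_mapI linear_map_tens bilinear_mapD(1)[OF bilinear_lact bh] lact_mem) simp_all
    qed (simp_all add: \<phi>)
    then have "\<rho> (c (hg (EH.bh b h) (xd k))) = sw2 H h (\<lambda>p q. \<Sum>l=1..n. \<Omega>H (lac (EH.bh b p) (\<phi> l)) (q * mc l k))"
      unfolding vk[OF bh k] coact_lact[OF \<phi>[OF k]] col[OF k] by simp
    also have "... = sw2 H h (\<lambda>h1 h2. \<Sum>l=1..n. \<Omega>H (c (hg (EH.bh b h1) (xd l))) (h2 * mc l k))"
      by (simp add: vk)
    finally show "\<rho> (c (hg (EH.bh b h) (xd k))) = tlift Hor V (\<lambda>t0 t1. \<Omega>H (c t0) t1) (hor_coact H L B (hg (EH.bh b h) (xd k)))"
      using colinear_bh(2)[OF lin k] by simp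
  qed
  moreover have "vr (c u) = u" if u: "u \<in> car Hor" for u
  proof (rule hor_ext[OF linear_map_comp[OF lin linear_ver] linear_map_ident _ refl u])
    fix b h k assume k: "k \<in> {1..n}"
    have bh: "EH.bh b h \<in> car A" by simp
    show "vr (c (hg (EH.bh b h) (xd k))) = hg (EH.bh b h) (xd k)"
      unfolding vk[OF bh k] ver_lact[OF bh \<phi>[OF k]] ve[OF k] hor_lact_tens[OF bh e_mem xd_mem[OF k]] cp_mult_one[OF bh] ..
  qed
  moreover have "c \<in> car Hor \<rightarrow>\<^sub>E car \<Omega>"
    using linear_mapD(1)[OF lin] unfolding c_def connection_of_form_def by auto
  ultimately show "c \<in> Conn"
    using lin by (simp add: connections_def)
  show "form c = (\<Sum>j=1..n. tens T \<Omega> (x j) (\<phi> j))"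
    unfolding form_of_connection_def by (rule sum.cong) (simp_all add: vk lact_one \<phi>)
qed

end

theorem proposition3p27:
  fixes H :: "('k::field, 'h::{ring, monoid_mult}) hopf"
    and L :: "('k, 'h, 'w::ab_group_add) bicov_fodc"
    and B :: "('k, 'h, 'b::{ring, monoid_mult}) twisted_alg"
    and E :: "('k, 'h, 'b, 'v::ab_group_add) twisted_fodc"
    and n :: nat
    and x :: "nat \<Rightarrow> 'w \<Rightarrow> 'k"
    and xd :: "nat \<Rightarrow> 'w"
  assumes "hopf_algebra H"
    and "bij (antipode H)"
    and "bicovariant_fodc H L"
    and "twisted_module_algebra H B"
    and "twisted_module_fodc H B E"
    and "indexed_basis (tangent_space H L) n x"
    and "indexed_basis (coinv_forms H L) n xd"
    and "\<forall>i\<in>{1..n}. \<forall>j\<in>{1..n}. x i (xd j) = (if i = j then 1 else 0)"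
  shows
    "bij_betw (form_of_connection H L B E n x xd) (connections H L B E) (connection_forms H L B E) \<and>
     (\<forall>\<phi>\<in>connection_forms H L B E. \<exists>\<phi>s. (\<forall>j\<in>{1..n}. \<phi>s j \<in> car (cp_forms H L B E)) \<and>
        \<phi> = (\<Sum>j=1..n. tens (tangent_space H L) (cp_forms H L B E) (x j) (\<phi>s j))) \<and>
     (\<forall>\<phi> \<phi>s. \<phi> \<in> connection_forms H L B E \<and> (\<forall>j\<in>{1..n}. \<phi>s j \<in> car (cp_forms H L B E)) \<and>
        \<phi> = (\<Sum>j=1..n. tens (tangent_space H L) (cp_forms H L B E) (x j) (\<phi>s j)) \<longrightarrow>
        connection_of_form H L B E n x \<phi>s \<in> connections H L B E \<and>
        form_of_connection H L B E n x xd (connection_of_form H L B E n x \<phi>s) = \<phi> \<and>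
        (\<forall>b h. \<forall>\<gamma>\<in>car (coinv_forms H L).
           connection_of_form H L B E n x \<phi>s
             (tens (cp_space H B) (coinv_forms H L) (tens (bspace B) (hspace H) b h) \<gamma>) =
           (\<Sum>j=1..n. scl (cp_forms H L B E) (x j \<gamma>)
              (lact (cp_calculus H L B E) (tens (bspace B) (hspace H) b h) (\<phi>s j)))))"
proof -
  interpret based_calculus H B L E n x xd
    using assms
    by (intro based_calculus.intro crossed_calculus.intro twisted_algebra.intro hopf_sweedler.intro
        twisted_algebra_axioms.intro crossed_calculus_axioms.intro based_calculus_axioms.intro)
  let ?form = "form_of_connection H L B E n x xd"
  have expand: "\<exists>\<phi>s. (\<forall>j\<in>{1..n}. \<phi>s j \<in> car \<Omega>) \<and> \<phi> = (\<Sum>j=1..n. tens T \<Omega> (x j) (\<phi>s j))"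
    if "\<phi> \<in> connection_forms H L B E" for \<phi>
  proof -
    have "\<phi> \<in> car TF" using that by (simp add: connection_forms_def)
    then show ?thesis
      by (intro exI[of _ "\<lambda>j. coord \<Omega> j \<phi>"] conjI ballI coord_mem[OF is_vs_forms] tangent_tensor_expand[OF is_vs_forms])
  qed
  have "?form ` connections H L B E = connection_forms H L B E"
  proof
    show "?form ` connections H L B E \<subseteq> connection_forms H L B E"
      using form_of_connection_mem by blast
    show "connection_forms H L B E \<subseteq> ?form ` connections H L B E"
    proof
      fix \<phi> assume \<phi>: "\<phi> \<in> connection_forms H L B E"
      then obtain \<phi>s where s: "\<And>j. j \<in> {1..n} \<Longrightarrow> \<phi>s j \<in> car \<Omega>" "\<phi> = (\<Sum>j=1..n. tens T \<Omega> (x j) (\<phi>s j))"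
        using expand by blast
      show "\<phi> \<in> ?form ` connections H L B E"
        using connection_of_form(1,2)[of \<phi>s, OF s(1)] \<phi> s(2) by (metis imageI)
    qed
  qed
  then have "bij_betw ?form (connections H L B E) (connection_forms H L B E)"
    using form_of_connection_inj by (simp add: bij_betw_def)
  moreover have "connection_of_form H L B E n x \<phi>s \<in> connections H L B E \<and>
      ?form (connection_of_form H L B E n x \<phi>s) = \<phi> \<and>
      (\<forall>b h. \<forall>\<gamma>\<in>car \<Gamma>. connection_of_form H L B E n x \<phi>s (hg (EH.bh b h) \<gamma>) =
         (\<Sum>j=1..n. scl \<Omega> (x j \<gamma>) (lac (EH.bh b h) (\<phi>s j))))"
    if \<phi>: "\<phi> \<in> connection_forms H L B E" and mem: "\<forall>j\<in>{1..n}. \<phi>s j \<in> car \<Omega>"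
      and eq: "\<phi> = (\<Sum>j=1..n. tens T \<Omega> (x j) (\<phi>s j))" for \<phi> \<phi>s
  proof -
    have bh: "EH.bh b h \<in> car A" for b h by simp
    have m: "\<phi>s j \<in> car \<Omega>" if "j \<in> {1..n}" for j using mem that by blast
    note c = connection_of_form[of \<phi>s, OF m \<phi>[unfolded eq]]
    show ?thesis using c(1,2) c(3)[OF _ bh] eq by blast
  qed
  ultimately show ?thesis using expand by blast
qed

end
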